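(* For $n=2$ variables the Poincaré series $P_{\{v''_i\}}(\underline{t})$ depends only on the Newton diagram $\Gamma$ and not on the function $f$ with $\Gamma_f=\Gamma$. That is: let $\Gamma\subset\mathbb{R}^2$ be a Newton diagram with edges $\gamma_1,\dots,\gamma_r$, and let $f,\tilde f\in\mathcal{O}_{\mathbb{C}^2,0}$ be function germs vanishing at $0$ with $\Gamma_f=\Gamma_{\tilde f}=\Gamma$. Then the Poincaré series $P_{\{v''_i\}}(\underline{t})$ of the filtration associated with $(\Gamma,f)$ is equal to the Poincaré series $P_{\{v''_i\}}(\underline{t})$ of the filtration associated with $(\Gamma,\tilde f)$.
   Context: $\mathcal{O}_{\mathbb{C}^2,0}$ is the ring of germs at $0$ of holomorphic functions in two variables $x,y$. For $\bar{k}=(k_x,k_y)$ write $\bar{x}^{\bar{k}}=x^{k_x}y^{k_y}$. Newton diagrams: for a nonzero $g=\sum a_{\bar{k}}\bar{x}^{\bar{k}}\in\mathcal{O}_{\mathbb{C}^2,0}$, its Newton polygon is the convex hull of $\bigcup_{a_{\bar{k}}\neq0}(\bar{k}+\mathbb{R}_{\ge0}^2)$, and its Newton diagram $\Gamma_g$ is the union of the compact faces (vertices and compact edges) of the Newton polygon. A Newton diagram in $\mathbb{R}^2$ is a set of the form $\Gamma_g$. Let $\Gamma$ be a Newton diagram with edges $\gamma_1,\dots,\gamma_r$, $r\ge1$. Let $\ell_i(\bar{k})=c_i$ be the reduced equation of the line containing $\gamma_i$: $\ell_i(\bar{k})=\ell_{i1}k_x+\ell_{i2}k_y$ with $\ell_{i1},\ell_{i2}$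 positive integers and $\gcd(\ell_{i1},\ell_{i2})=1$. For $g=\sum_{\bar{k}\in\mathbb{Z}^2}a_{\bar{k}}\bar{x}^{\bar{k}}\in\mathcal{O}_{\mathbb{C}^2,0}[x^{-1},y^{-1}]$ put $u_i(g)=\min_{\bar{k}:a_{\bar{k}}\neq0}\ell_i(\bar{k})$ ($u_i(0)=+\infty$). For a germ $f$ with $\Gamma_f=\Gamma$, the order functions $v''_i:\mathcal{O}_{\mathbb{C}^2,0}\to\mathbb{Z}_{\ge0}\cup\{+\infty\}$ associated with $(\Gamma,f)$ are $$v''_i(g)=\sup_{h\in\mathcal{O}_{\mathbb{C}^2,0}[x^{-1},y^{-1}]}u_i(g+hf),\qquad i=1,\dots,r.$$ They induce functions on $\mathcal{O}_{\mathbb{C}^2,0}/(f)$, and the Poincaré series below is the same for $\mathcal{O}_{\mathbb{C}^2,0}$ and $\mathcal{O}_{\mathbb{C}^2,0}/(f)$. For $\underline{\upsilon}\in\mathbb{Z}^r$ let $J(\underline{\upsilon})=\{g\in\mathcal{O}_{\mathbb{C}^2,0}:\ v''_i(g)\ge\upsilon_i\text{ for all }i\}$ (the associated multi-index filtration). With $\underline{1}=(1,\dots,1)$ and $\underline{t}^{\underline{\upsilon}}=t_1^{\upsilon_1}\cdots t_r^{\upsilon_r}$, the Poincaré series is $$P_{\{v''_i\}}(\underline{t})=\frac{\left(\sum_{\underline{\upsilon}\in\mathbb{Z}^r}\dim_{\mathbb{C}}\big(J(\underline{\upsilon})/J(\underline{\upsilon}+\underline{1})\big)\,\underline{t}^{\underline{\upsilon}}\right)\prod_{i=1}^r(t_i-1)}{t_1t_2\cdots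 t_r-1}.$$ The numerator is understood as the formal product of the (possibly bi-infinite) series with the polynomial $\prod(t_i-1)$; it is a power series in $\mathbb{Z}[[t_1,\dots,t_r]]$, so $P_{\{v''_i\}}(\underline{t})\in\mathbb{Z}[[t_1,\dots,t_r]]$. *)

theory Defs
  imports "HOL-Complex_Analysis.Complex_Analysis" "HOL-Library.Poly_Mapping"
begin

no_notation fps_nth (infixl "$" 75)

section \<open>Germs of holomorphic functions of two variables\<close>

text \<open>
  A (Laurent) series in \<open>x, y\<close> is represented by its family of coefficients: \<open>a (i, j)\<close> is the
  coefficient of \<open>x\<^sup>i y\<^sup>j\<close>.
\<close>

type_synonym lseries = "int \<times> int \<Rightarrow> complex"

definition supp :: "lseries \<Rightarrow> (int \<times> int) set" where
  "supp g = {k. g k \<noteq> 0}"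

definition monom_at :: "int \<times> int \<Rightarrow> complex \<Rightarrow> complex \<Rightarrow> complex" where
  "monom_at k x y = x powi fst k * y powi snd k"

text \<open>A function on an open set is holomorphic in two variables iff it is continuous and holomorphic
  in each variable separately (Osgood's lemma).\<close>

definition holomorphic2_on :: "(complex \<times> complex \<Rightarrow> complex) \<Rightarrow> (complex \<times> complex) set \<Rightarrow> bool" where
  "holomorphic2_on F S \<longleftrightarrow> continuous_on S F \<and>
     (\<forall>y. (\<lambda>x. F (x, y)) holomorphic_on {x. (x, y) \<in> S}) \<and>
     (\<forall>x. (\<lambda>y. F (x, y)) holomorphic_on {y. (x, y) \<in> S})"

abbreviation polydisc :: "real \<Rightarrow> (complex \<times> complex) set" where
  "polydisc \<rho> \<equiv> ball 0 \<rho> \<times> ball 0 \<rho>"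

definition is_expansion :: "lseries \<Rightarrow> (complex \<times> complex \<Rightarrow> complex) \<Rightarrow> real \<Rightarrow> bool" where
  "is_expansion g F \<rho> \<longleftrightarrow>
     (\<forall>(x, y) \<in> polydisc \<rho>. ((\<lambda>k. g k * monom_at k x y) has_sum F (x, y)) UNIV)"

text \<open>A germ at the origin of a holomorphic function is identified with its Taylor series.  Every
  holomorphic germ has exactly one Taylor series (\<open>holomorphic2_imp_germ\<close> and \<open>expansion_unique\<close>
  below).\<close>

definition germs :: "lseries set" where
  "germs = {g. (\<forall>(i, j) \<in> supp g. 0 \<le> i \<and> 0 \<le> j) \<and>
     (\<exists>F. \<exists>\<rho>>0. holomorphic2_on F (polydisc \<rho>) \<and> is_expansion g F \<rho>)}"

definition convergent_series :: "lseries set" where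
  "convergent_series = {g. (\<forall>(i, j) \<in> supp g. 0 \<le> i \<and> 0 \<le> j) \<and>
     (\<exists>\<rho>>0. \<forall>x y. norm x < \<rho> \<longrightarrow> norm y < \<rho> \<longrightarrow> (\<lambda>k. g k * monom_at k x y) summable_on UNIV)}"

lemma holomorphic2_power_series:
  assumes rho: "\<rho> > 0" and F: "holomorphic2_on F (polydisc \<rho>)"
  obtains A :: "nat \<Rightarrow> nat \<Rightarrow> complex" and r where "0 < r" "r \<le> \<rho>"
    "\<And>x y. norm x < r \<Longrightarrow> norm y < r \<Longrightarrow> ((\<lambda>(i, j). A i j * (x ^ i * y ^ j)) has_sum F (x, y)) UNIV"
proof -
  define r where "r = \<rho> / 2"
  have r: "0 < r" "r < \<rho>" using rho by (auto simp: r_def)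
  have cont: "continuous_on (polydisc \<rho>) F" 
    and hx: "\<And>y. norm y < \<rho> \<Longrightarrow> (\<lambda>x. F (x, y)) holomorphic_on ball 0 \<rho>"
    and hy: "\<And>x. norm x < \<rho> \<Longrightarrow> (\<lambda>y. F (x, y)) holomorphic_on ball 0 \<rho>"
    using F unfolding holomorphic2_on_def
    by (auto simp: ball_def)
  have "compact (F ` (cball 0 r \<times> cball 0 r))"
    using r by (intro compact_continuous_image continuous_on_subset[OF cont] compact_Times) auto
  then obtain M where M: "\<And>x y. norm x \<le> r \<Longrightarrow> norm y \<le> r \<Longrightarrow> norm (F (x, y)) \<le> M" and M0: "M \<ge> 0"
    by (smt (verit) bounded_iff compact_imp_bounded image_eqI mem_Sigma_iff mem_cball_0 norm_ge_zero)
  define c where "c i y = (deriv ^^ i) (\<lambda>x. F (x, y)) 0 / fact i" for i y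
  have cb: "norm (c i y) \<le> M / r ^ i" if "norm y \<le> r" for i y
  proof -
    have "norm ((deriv ^^ i) (\<lambda>x. F (x, y)) 0) \<le> fact i * M / r ^ i"
    proof (rule Cauchy_inequality)
      show "(\<lambda>x. F (x, y)) holomorphic_on ball 0 r"
        using hx[of y] that r by (auto intro: holomorphic_on_subset)
      show "continuous_on (cball 0 r) (\<lambda>x. F (x, y))"
        using hx[of y] that r by (intro holomorphic_on_imp_continuous_on) (auto intro: holomorphic_on_subset)
    qed (use r M that in auto)
    thus ?thesis by (simp add: c_def norm_divide field_simps)
  qed
  have cs: "(\<lambda>i. c i y * x ^ i) sums F (x, y)" if "norm y \<le> r" "norm x < \<rho>" for x y
    using holomorphic_power_series[OF hx[of y], of x] that r by (simp add: c_def)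
  have ch: "c i holomorphic_on ball 0 r" for i
  proof (induction i rule: less_induct)
    case (less i)
    define t :: "nat \<Rightarrow> real" where "t n = 1 / real (n + 2)" for n
    define X where "X n = complex_of_real (r * t n)" for n
    have t: "0 < t n" "t n < 1" for n by (auto simp: t_def field_simps)
    have Xr: "norm (X n) < \<rho>" "X n \<noteq> 0" "norm (X n) = r * t n" for n
    proof -
      have "r * t n < r * 1" using t[of n] r by (intro mult_strict_left_mono) auto
      hence "r * t n < \<rho>" using r by linarith
      thus "norm (X n) < \<rho>" "X n \<noteq> 0" "norm (X n) = r * t n" 
        using r t[of n] by (auto simp: X_def norm_mult simp del: of_real_mult)
    qed
    define G where "G n y = (F (X n, y) - (\<Sum>j<i. c j y * X n ^ j)) / X n ^ i" for n y
    have Gc: "norm (G n y - c i y) \<le> M / r ^ i * (1 / real (n + 1))" if "norm y \<le> r" for n y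
    proof -
      have "(\<lambda>k. c (k + i) y * X n ^ (k + i)) sums (F (X n, y) - (\<Sum>j<i. c j y * X n ^ j))"
        by (rule sums_split_initial_segment) (use cs[OF that Xr(1)] in auto)
      from sums_divide[OF this, of "X n ^ i"]
      have "(\<lambda>k. c (k + i) y * X n ^ k) sums G n y"
        using Xr[of n] by (simp add: G_def power_add)
      from sums_split_initial_segment[OF this, of 1]
      have 1: "(\<lambda>k. c (k + 1 + i) y * X n ^ (k + 1)) sums (G n y - c i y)" by simp
      have "(\<lambda>k. t n ^ k) sums (1 / (1 - t n))" by (intro geometric_sums) (use t[of n] in auto)
      from sums_mult[OF this, of "M / r ^ i * t n"] 
      have 2: "(\<lambda>k. M / r ^ i * t n ^ (k+1)) sums (M / r ^ i * (t n / (1 - t n)))" by (simp add: mult_ac)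
      have "t n / (1 - t n) = 1 / real (n + 1)" by (simp add: t_def field_simps)
      moreover have "norm (c (k + 1 + i) y * X n ^ (k + 1)) \<le> M / r ^ i * t n ^ (k+1)" for k
      proof -
        have "norm (c (k + 1 + i) y * X n ^ (k + 1)) \<le> M / r ^ (k + 1 + i) * (r * t n) ^ (k + 1)"
          unfolding norm_mult norm_power Xr(3) using r t[of n]
          by (intro mult_right_mono cb that) auto
        also have "\<dots> = M / r ^ i * t n ^ (k+1)" using r by (simp add: power_mult_distrib power_add field_simps)
        finally show ?thesis .
      qed
      ultimately show ?thesis using norm_sums_le[OF 1 2] by simp
    qed
    show ?case
    proof (rule holomorphic_uniform_sequence)
      show "open (ball 0 r :: complex set)" by simp
      show "G n holomorphic_on ball 0 r" for n unfolding G_def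
        using Xr[of n] r by (intro holomorphic_intros less holomorphic_on_subset[OF hy]) auto
      have u: "uniform_limit (cball 0 r) G (c i) sequentially"
        unfolding uniform_limit_iff
      proof (intro allI impI)
        fix e :: real assume "e > 0"
        have "(\<lambda>n. M / r ^ i * (1 / real (n + 1))) \<longlonglongrightarrow> M / r ^ i * 0"
          by (intro tendsto_intros) (use lim_1_over_n[where 'a=real, THEN LIMSEQ_Suc] in simp)
        hence "eventually (\<lambda>n. M / r ^ i * (1 / real (n + 1)) < e) sequentially"
          using \<open>e > 0\<close> by (intro order_tendstoD) auto
        thus "\<forall>\<^sub>F n in sequentially. \<forall>x\<in>cball 0 r. dist (G n x) (c i x) < e"
          by eventually_elim (unfold dist_norm, intro ballI le_less_trans[OF Gc], auto)
      qed
      show "\<exists>d>0. cball x d \<subseteq> ball 0 r \<and> uniform_limit (cball x d) G (c i) sequentially" if x: "x \<in> ball 0 r" for x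
      proof -
        obtain d where d: "d > 0" "cball x d \<subseteq> ball 0 r"
          using open_contains_cball[THEN iffD1, OF open_ball, THEN bspec, OF x] by (elim exE conjE)
        have "cball x d \<subseteq> cball 0 r" using d(2) ball_subset_cball by (rule order_trans)
        from uniform_limit_on_subset[OF u this] d show ?thesis by (intro exI[of _ d] conjI)
      qed
    qed
  qed
  define s where "s = r / 2"
  have s: "0 < s" "s < r" using r by (auto simp: s_def)
  define A where "A i j = (deriv ^^ j) (c i) 0 / fact j" for i j
  have Ab: "norm (A i j) \<le> M / r ^ i / s ^ j" for i j
  proof -
    have "norm ((deriv ^^ j) (c i) 0) \<le> fact j * (M / r ^ i) / s ^ j"
    proof (rule Cauchy_inequality)
      show "c i holomorphic_on ball 0 s"
        using s by (auto intro: holomorphic_on_subset[OF ch])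
      show "continuous_on (cball 0 s) (c i)"
        using s by (intro holomorphic_on_imp_continuous_on) (auto intro: holomorphic_on_subset[OF ch])
    qed (use s cb in auto)
    thus ?thesis by (simp add: A_def norm_divide field_simps)
  qed
  have As: "(\<lambda>j. A i j * y ^ j) sums c i y" if "norm y < r" for i y
    using holomorphic_power_series[OF ch[of i], of y] that by (simp add: A_def)
  show ?thesis
  proof (rule that)
    show "0 < s" "s \<le> \<rho>" using s r by auto
    fix x y :: complex assume xy: "norm x < s" "norm y < s"
    define a where "a = norm x / r"
    define b where "b = norm y / s"
    have ab: "0 \<le> a" "a < 1" "0 \<le> b" "b < 1" using xy s r by (auto simp: a_def b_def field_simps)
    have bd: "norm (A i j * (x ^ i * y ^ j)) \<le> M * a ^ i * b ^ j" for i j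
    proof -
      have "norm (A i j * (x ^ i * y ^ j)) \<le> M / r ^ i / s ^ j * (norm x ^ i * norm y ^ j)"
        unfolding norm_mult norm_power by (intro mult_right_mono Ab) auto
      also have "\<dots> = M * a ^ i * b ^ j" by (simp add: a_def b_def power_divide)
      finally show ?thesis .
    qed
    have gb: "((\<lambda>j. C * b ^ j) has_sum (C * (1 / (1 - b)))) UNIV" if "C \<ge> 0" for C
      using ab that by (intro sums_nonneg_imp_has_sum sums_mult geometric_sums) auto
    have "(\<lambda>(i, j). M * a ^ i * b ^ j) summable_on (UNIV \<times> UNIV :: (nat \<times> nat) set)"
    proof (rule summable_on_SigmaI)
      show "((\<lambda>j. case (i, j) of (i, j) \<Rightarrow> M * a ^ i * b ^ j) has_sum (M * a ^ i * (1 / (1 - b)))) UNIV" for i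
        using gb[of "M * a ^ i"] M0 ab by simp
      have "((\<lambda>i. M * (1 / (1 - b)) * a ^ i) has_sum (M * (1 / (1 - b)) * (1 / (1 - a)))) UNIV"
        using ab M0 by (intro sums_nonneg_imp_has_sum sums_mult geometric_sums) auto
      thus "(\<lambda>i. M * a ^ i * (1 / (1 - b))) summable_on UNIV"
        by (auto simp: summable_on_def mult_ac)
    qed (use M0 ab in auto)
    from Infinite_Sum.abs_summable_on_comparison_test'[OF this, of "\<lambda>(i, j). A i j * (x ^ i * y ^ j)"]
    have S: "(\<lambda>(i, j). A i j * (x ^ i * y ^ j)) summable_on (UNIV \<times> UNIV)"
      using bd by (subst summable_on_iff_abs_summable_on_complex) auto
    have "((\<lambda>(i, j). A i j * (x ^ i * y ^ j)) has_sum F (x, y)) (UNIV \<times> UNIV)"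
    proof (rule has_sum_SigmaI[OF _ _ S])
      have *: "summable (\<lambda>j. norm (A i j * (x ^ i * y ^ j)))" for i
        by (rule summable_comparison_test'[of "\<lambda>j. M * a ^ i * b ^ j" 0])
           (use bd ab in \<open>auto intro!: summable_mult summable_geometric\<close>)
      show "((\<lambda>j. case (i, j) of (i, j) \<Rightarrow> A i j * (x ^ i * y ^ j)) has_sum (c i y * x ^ i)) UNIV" for i
        using sums_mult2[OF As[of y i], of "x ^ i"] * xy s
        by (intro norm_summable_imp_has_sum) (auto simp: mult_ac)
      have cx: "norm (c i y * x ^ i) \<le> M * a ^ i" for i
        using mult_right_mono[OF cb[of y i], of "norm (x ^ i)"] xy s
        by (simp add: a_def norm_mult norm_power power_divide)
      have "summable (\<lambda>i. norm (c i y * x ^ i))"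
        by (rule summable_comparison_test'[of "\<lambda>i. M * a ^ i" 0]) 
           (use cx ab in \<open>auto intro!: summable_mult summable_geometric\<close>)
      thus "((\<lambda>i. c i y * x ^ i) has_sum F (x, y)) UNIV"
        using cs[of y x] xy s r by (intro norm_summable_imp_has_sum) auto
    qed
    thus "((\<lambda>(i, j). A i j * (x ^ i * y ^ j)) has_sum F (x, y)) UNIV" by simp
  qed
qed

lemma holomorphic2_imp_convergent_series:
  assumes "\<rho> > 0" "holomorphic2_on F (polydisc \<rho>)"
  shows "\<exists>g\<in>convergent_series. \<exists>r>0. is_expansion g F r"
proof -
  obtain A r where r: "0 < r" "r \<le> \<rho>" and A:
    "\<And>x y. norm x < r \<Longrightarrow> norm y < r \<Longrightarrow> ((\<lambda>(i, j). A i j * (x ^ i * y ^ j)) has_sum F (x, y)) (UNIV :: (nat \<times> nat) set)"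
    by (rule holomorphic2_power_series[OF assms]) (rule that)
  define g where "g = (\<lambda>(i, j). if 0 \<le> i \<and> 0 \<le> j then A (nat i) (nat j) else 0)"
  have *: "((\<lambda>k. g k * monom_at k x y) has_sum F (x, y)) UNIV" if "norm x < r" "norm y < r" for x y
  proof -
    let ?h = "\<lambda>(i, j). (int i, int j)"
    have "((\<lambda>k. g k * monom_at k x y) has_sum F (x, y)) UNIV \<longleftrightarrow>
          ((\<lambda>k. g k * monom_at k x y) has_sum F (x, y)) ({0..} \<times> {0..})"
      by (rule has_sum_cong_neutral) (auto simp: g_def split: if_splits)
    also have "\<dots> \<longleftrightarrow> ((\<lambda>k. g (?h k) * monom_at (?h k) x y) has_sum F (x, y)) (UNIV :: (nat \<times> nat) set)"
      by (rule sym, rule has_sum_reindex_bij_betw, rule bij_betwI[of _ _ _ "\<lambda>(i, j). (nat i, nat j)"]) auto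
    also have "(\<lambda>k. g (?h k) * monom_at (?h k) x y) = (\<lambda>(i, j). A i j * (x ^ i * y ^ j))"
      by (auto simp: fun_eq_iff g_def monom_at_def)
    finally show ?thesis using A that by simp
  qed
  have "g \<in> convergent_series"
    unfolding convergent_series_def using r * by (auto simp: supp_def g_def split: if_splits intro!: exI[of _ r] has_sum_imp_summable)
  moreover have "is_expansion g F r" using * by (auto simp: is_expansion_def)
  ultimately show ?thesis using r by blast
qed

lemma convergent_series_imp_holomorphic2:
  assumes g: "g \<in> convergent_series"
  shows "\<exists>F. \<exists>r>0. holomorphic2_on F (polydisc r) \<and> is_expansion g F r"
proof -
  from g obtain \<rho> where rho: "\<rho> > 0" and nn: "\<And>i j. g (i, j) \<noteq> 0 \<Longrightarrow> 0 \<le> i \<and> 0 \<le> j"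
    and sm: "\<And>x y. norm x < \<rho> \<Longrightarrow> norm y < \<rho> \<Longrightarrow> (\<lambda>k. g k * monom_at k x y) summable_on UNIV"
    unfolding convergent_series_def by (auto simp: supp_def)
  define r where "r = \<rho> / 2"
  have r: "0 < r" "r < \<rho>" using rho by (auto simp: r_def)
  define F where "F = (\<lambda>(x, y). \<Sum>\<^sub>\<infinity>k. g k * monom_at k x y)"
  define B where "B k = norm (g k * monom_at k (of_real r) (of_real r))" for k
  have B: "B summable_on UNIV"
    using sm[of "of_real r" "of_real r"] r unfolding B_def summable_on_iff_abs_summable_on_complex by auto
  have bd: "norm (g k * monom_at k x y) \<le> B k" if "norm x \<le> r" "norm y \<le> r" for k x y
  proof (cases "g k = 0")
    case False
    then obtain i j where k: "k = (int i, int j)" using nn by (metis nat_0_le surj_pair)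
    show ?thesis unfolding B_def k monom_at_def using that r
      by (auto simp: norm_mult norm_power intro!: mult_left_mono mult_mono power_mono)
  qed (auto simp: B_def)
  define P where "P = (\<lambda>X z. \<Sum>k\<in>X. g k * monom_at k (fst z) (snd z))"
  have U: "uniform_limit (cball 0 r \<times> cball 0 r) P F (finite_subsets_at_top UNIV)"
    unfolding P_def F_def case_prod_beta
    by (rule Weierstrass_m_test_general[OF _ B]) (use bd in auto)
  have mh: "g k * monom_at k x y = (if 0 \<le> fst k \<and> 0 \<le> snd k then g k * (x ^ nat (fst k) * y ^ nat (snd k)) else 0)" for k x y
    using nn[of "fst k" "snd k"] by (auto simp: monom_at_def power_int_def)
  have Pc: "continuous_on S (P X)" for S X
  proof -
    have "continuous_on S (\<lambda>z. g k * monom_at k (fst z) (snd z))" for k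
      unfolding mh by (cases "0 \<le> fst k \<and> 0 \<le> snd k") (auto intro!: continuous_intros)
    thus ?thesis unfolding P_def by (rule continuous_on_sum)
  qed
  have Px: "(\<lambda>x. P X (x, y)) holomorphic_on S" for S X y
  proof -
    have "(\<lambda>x. g k * monom_at k x y) holomorphic_on S" for k
      unfolding mh by (cases "0 \<le> fst k \<and> 0 \<le> snd k") (auto intro!: holomorphic_intros)
    thus ?thesis unfolding P_def fst_conv snd_conv by (rule holomorphic_on_sum)
  qed
  have Py: "(\<lambda>y. P X (x, y)) holomorphic_on S" for S X x
  proof -
    have "(\<lambda>y. g k * monom_at k x y) holomorphic_on S" for k
      unfolding mh by (cases "0 \<le> fst k \<and> 0 \<le> snd k") (auto intro!: holomorphic_intros)
    thus ?thesis unfolding P_def fst_conv snd_conv by (rule holomorphic_on_sum)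
  qed
  have "continuous_on (cball 0 r \<times> cball 0 r) F"
    by (rule uniform_limit_theorem[OF _ U]) (auto intro: Pc)
  hence 1: "continuous_on (polydisc r) F" by (rule continuous_on_subset) auto
  have 2: "(\<lambda>x. F (x, y)) holomorphic_on ball 0 r" if "norm y < r" for y
  proof (rule holomorphic_uniform_limit[where f = "\<lambda>X x. P X (x, y)" and F = "finite_subsets_at_top UNIV" and z = 0 and r = r])
    show "uniform_limit (cball 0 r) (\<lambda>X x. P X (x, y)) (\<lambda>x. F (x, y)) (finite_subsets_at_top UNIV)"
      using uniform_limit_compose'[OF U, of "\<lambda>x. (x, y)" "cball 0 r"] that by auto
  qed (auto intro: Px holomorphic_on_imp_continuous_on)
  have 3: "(\<lambda>y. F (x, y)) holomorphic_on ball 0 r" if "norm x < r" for x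
  proof (rule holomorphic_uniform_limit[where f = "\<lambda>X y. P X (x, y)" and F = "finite_subsets_at_top UNIV" and z = 0 and r = r])
    show "uniform_limit (cball 0 r) (\<lambda>X y. P X (x, y)) (\<lambda>y. F (x, y)) (finite_subsets_at_top UNIV)"
      using uniform_limit_compose'[OF U, of "\<lambda>y. (x, y)" "cball 0 r"] that by auto
  qed (auto intro: Py holomorphic_on_imp_continuous_on)
  have "holomorphic2_on F (polydisc r)"
    unfolding holomorphic2_on_def
  proof (intro conjI allI 1)
    show "(\<lambda>x. F (x, y)) holomorphic_on {x. (x, y) \<in> polydisc r}" for y
      using 2[of y] by (cases "norm y < r") (auto simp: ball_def holomorphic_on_def)
    show "(\<lambda>y. F (x, y)) holomorphic_on {y. (x, y) \<in> polydisc r}" for x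
      using 3[of x] by (cases "norm x < r") (auto simp: ball_def holomorphic_on_def)
  qed
  moreover have "is_expansion g F r"
    unfolding is_expansion_def F_def using sm r by (auto intro!: has_sum_infsum)
  ultimately show ?thesis using r by blast
qed

lemma convergent_expansion_unique:
  assumes g: "g \<in> convergent_series" "h \<in> convergent_series" and r: "r > 0" and eg: "is_expansion g F r" "is_expansion h F r"
  shows "g = h"
proof -
  define d where "d k = g k - h k" for k
  have zero: "a = (\<lambda>_. 0)" if zs: "\<And>x. norm x < r \<Longrightarrow> (\<lambda>n. a n * x ^ n) sums 0" for a :: "nat \<Rightarrow> complex"
  proof (rule ccontr)
    assume "a \<noteq> (\<lambda>_. 0)"
    then obtain m where m: "a m \<noteq> 0" by auto
    have "a 0 = 0" using zs[of 0] r powser_sums_zero_iff[of a 0] by auto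
    hence "m > 0" using m by (cases m) auto
    show False
    proof (rule powser_0_nonzero[of r 0 a "\<lambda>_. 0" m])
      fix s :: real
      assume s: "0 < s" and z: "\<And>z. z \<in> cball (0::complex) s - {0} \<Longrightarrow> (0::complex) \<noteq> 0"
      have "complex_of_real s \<in> cball 0 s - {0}" using s by auto
      from z[OF this] show False by simp
    qed (use zs r m \<open>m > 0\<close> in auto)
  qed
  have nn0: "e (i, j) = 0" if "e \<in> convergent_series" "i < 0 \<or> j < 0" for e i j
  proof (rule ccontr)
    assume "e (i, j) \<noteq> 0"
    hence "0 \<le> i \<and> 0 \<le> j" using that(1) by (auto simp: convergent_series_def supp_def)
    thus False using that(2) by auto
  qed
  have nn: "d (i, j) = 0" if "i < 0 \<or> j < 0" for i j
    unfolding d_def using nn0[OF g(1) that] nn0[OF g(2) that] by simp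
  let ?h = "\<lambda>(i, j). (int i, int j)"
  have D: "((\<lambda>(i, j). d (int i, int j) * (x ^ i * y ^ j)) has_sum 0) (UNIV \<times> UNIV)"
    if "norm x < r" "norm y < r" for x y
  proof -
    have "((\<lambda>k. g k * monom_at k x y + - (h k * monom_at k x y)) has_sum (F (x, y) + - F (x, y))) UNIV"
      using eg that unfolding is_expansion_def by (intro has_sum_add has_sum_uminusI) auto
    hence "((\<lambda>k. d k * monom_at k x y) has_sum 0) UNIV" by (simp add: d_def algebra_simps)
    also have "?this \<longleftrightarrow> ((\<lambda>k. d k * monom_at k x y) has_sum 0) ({0..} \<times> {0..})"
    proof (rule has_sum_cong_neutral)
      fix k :: "int \<times> int" assume k: "k \<in> UNIV - {0..} \<times> {0..}"
      show "d k * monom_at k x y = 0" using k nn[of "fst k" "snd k"] by (cases k) auto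
    qed auto
    also have "\<dots> \<longleftrightarrow> ((\<lambda>k. d (?h k) * monom_at (?h k) x y) has_sum 0) (UNIV :: (nat \<times> nat) set)"
      by (rule sym, rule has_sum_reindex_bij_betw, rule bij_betwI[of _ _ _ "\<lambda>(i, j). (nat i, nat j)"]) auto
    also have "(\<lambda>k. d (?h k) * monom_at (?h k) x y) = (\<lambda>(i, j). d (int i, int j) * (x ^ i * y ^ j))"
      by (auto simp: fun_eq_iff monom_at_def)
    finally show ?thesis by simp
  qed
  define b where "b y i = (\<Sum>\<^sub>\<infinity>j. d (int i, int j) * y ^ j)" for y i
  have bs: "((\<lambda>j. d (int i, int j) * y ^ j) has_sum b y i) UNIV" if "norm y < r" for y i
  proof -
    define x where "x = complex_of_real (r / 2)"
    have x: "norm x < r" "x \<noteq> 0" using r by (auto simp: x_def)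
    have "(\<lambda>j. d (int i, int j) * (x ^ i * y ^ j)) summable_on UNIV"
      using summable_on_SigmaD1[OF has_sum_imp_summable[OF D[OF x(1) that]], of i] by simp
    from summable_on_cmult_right[OF this, of "1 / x ^ i"] x
    show ?thesis by (simp add: b_def mult_ac)
  qed
  have b0: "b y = (\<lambda>_. 0)" if y: "norm y < r" for y
  proof (rule zero)
    fix x :: complex assume x: "norm x < r"
    have "((\<lambda>i. b y i * x ^ i) has_sum 0) UNIV"
    proof (rule has_sum_SigmaD[OF D[OF x y]])
      show "((\<lambda>j. case (i, j) of (i, j) \<Rightarrow> d (int i, int j) * (x ^ i * y ^ j)) has_sum b y i * x ^ i) UNIV" for i
        using has_sum_cmult_left[OF bs[OF y, of i], of "x ^ i"] by (simp add: mult_ac)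
    qed
    thus "(\<lambda>i. b y i * x ^ i) sums 0" by (rule has_sum_imp_sums)
  qed
  have "(\<lambda>j. d (int i, int j)) = (\<lambda>_. 0)" for i
  proof (intro zero has_sum_imp_sums)
    fix y :: complex assume "norm y < r"
    with bs[OF this, of i] b0[OF this] show "((\<lambda>j. d (int i, int j) * y ^ j) has_sum 0) UNIV" by simp
  qed
  hence dn: "d (int i, int j) = 0" for i j by (rule fun_cong)
  have "d (i, j) = 0" for i j
    using dn[of "nat i" "nat j"] by (cases "i < 0 \<or> j < 0") (auto simp: nn)
  thus ?thesis by (auto simp: d_def fun_eq_iff)
qed

theorem germs_eq_convergent_series: "germs = convergent_series"
proof
  show "germs \<subseteq> convergent_series"
  proof
    fix g assume "g \<in> germs"
    then obtain F \<rho> where nn: "\<forall>(i, j) \<in> supp g. 0 \<le> i \<and> 0 \<le> j"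
      and \<rho>: "\<rho> > 0" and e: "is_expansion g F \<rho>"
      unfolding germs_def by auto
    have "(\<lambda>k. g k * monom_at k x y) summable_on UNIV" if "norm x < \<rho>" "norm y < \<rho>" for x y
      using e that unfolding is_expansion_def by (intro has_sum_imp_summable[of _ _ "F (x, y)"]) auto
    with nn \<rho> show "g \<in> convergent_series" unfolding convergent_series_def by blast
  qed
  show "convergent_series \<subseteq> germs"
  proof
    fix g assume g: "g \<in> convergent_series"
    hence "\<forall>(i, j) \<in> supp g. 0 \<le> i \<and> 0 \<le> j" unfolding convergent_series_def by blast
    with convergent_series_imp_holomorphic2[OF g] show "g \<in> germs" unfolding germs_def by blast
  qed
qed

theorem holomorphic2_imp_germ:
  assumes "\<rho> > 0" "holomorphic2_on F (polydisc \<rho>)"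
  shows "\<exists>g\<in>germs. \<exists>r>0. is_expansion g F r"
  using holomorphic2_imp_convergent_series[OF assms] by (simp add: germs_eq_convergent_series)

theorem expansion_unique:
  assumes "g \<in> germs" "h \<in> germs" "r > 0" "is_expansion g F r" "is_expansion h F r"
  shows "g = h"
  using convergent_expansion_unique[of g h r F] assms by (simp add: germs_eq_convergent_series)

text \<open>The localization of the ring of germs at \<open>x\<close> and \<open>y\<close>: series \<open>h\<close> for which
  \<open>x\<^sup>m y\<^sup>m h\<close> is a germ for some \<open>m\<close>.\<close>

definition laurent_germs :: "lseries set" where
  "laurent_germs = {h. \<exists>m. (\<lambda>(i, j). h (i - int m, j - int m)) \<in> germs}"

text \<open>The product of Laurent series; for factors in \<^term>\<open>laurent_germs\<close> each of the sums is finite.\<close>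

definition ls_mult :: "lseries \<Rightarrow> lseries \<Rightarrow> lseries" where
  "ls_mult g h k = (\<Sum>p | g p \<noteq> 0 \<and> h (k - p) \<noteq> 0. g p * h (k - p))"


section \<open>Newton diagrams\<close>

definition newton_polygon :: "lseries \<Rightarrow> (real \<times> real) set" where
  "newton_polygon g =
     convex hull (\<Union>(i, j) \<in> supp g. {(p, q). real_of_int i \<le> p \<and> real_of_int j \<le> q})"

definition newton_diagram :: "lseries \<Rightarrow> (real \<times> real) set" where
  "newton_diagram g = \<Union>{F. F face_of newton_polygon g \<and> compact F}"

definition is_newton_diagram :: "(real \<times> real) set \<Rightarrow> bool" where
  "is_newton_diagram \<Gamma> \<longleftrightarrow> (\<exists>g \<in> germs. supp g \<noteq> {} \<and> newton_diagram g = \<Gamma>)"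

definition newton_edges :: "(real \<times> real) set \<Rightarrow> (real \<times> real) set set" where
  "newton_edges \<Gamma> = {\<gamma>. \<exists>g \<in> germs. supp g \<noteq> {} \<and> newton_diagram g = \<Gamma> \<and>
     \<gamma> edge_of newton_polygon g \<and> compact \<gamma>}"

text \<open>\<open>l = (l\<^sub>1, l\<^sub>2)\<close> gives the reduced equation \<open>l\<^sub>1 k\<^sub>x + l\<^sub>2 k\<^sub>y = c\<close> of the line containing \<open>\<gamma>\<close>.\<close>

definition reduced_equation :: "(real \<times> real) set \<Rightarrow> int \<times> int \<Rightarrow> bool" where
  "reduced_equation \<gamma> l \<longleftrightarrow> 0 < fst l \<and> 0 < snd l \<and> coprime (fst l) (snd l) \<and>
     (\<exists>c::int. \<forall>(p, q) \<in> \<gamma>. real_of_int (fst l) * p + real_of_int (snd l) * q = real_of_int c)"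


section \<open>Order functions and the filtration\<close>

text \<open>The minimum defining \<open>u\<^sub>i\<close> is written as an infimum in \<^typ>\<open>ereal\<close>: it is attained for
  nonzero elements of \<^term>\<open>laurent_germs\<close>, and it is \<open>\<infinity>\<close> for the zero series.\<close>

definition u_order :: "int \<times> int \<Rightarrow> lseries \<Rightarrow> ereal" where
  "u_order l g = (INF k \<in> supp g. ereal (real_of_int (fst l * fst k + snd l * snd k)))"

definition v_order :: "int \<times> int \<Rightarrow> lseries \<Rightarrow> lseries \<Rightarrow> ereal" where
  "v_order l f g = (SUP h \<in> laurent_germs. u_order l (\<lambda>k. g k + ls_mult h f k))"

definition J_ideal :: "('r::finite \<Rightarrow> int \<times> int) \<Rightarrow> lseries \<Rightarrow> int ^ 'r \<Rightarrow> lseries set" where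
  "J_ideal l f v = {g \<in> germs. \<forall>i. ereal (real_of_int (v $ i)) \<le> v_order (l i) f g}"

text \<open>For subspaces \<open>W \<subseteq> V\<close> the cosets of the elements of \<open>B\<close> form a basis of \<open>V / W\<close>
  (and are pairwise distinct).\<close>

definition quotient_basis :: "lseries set \<Rightarrow> lseries set \<Rightarrow> lseries set \<Rightarrow> bool" where
  "quotient_basis V W B \<longleftrightarrow> finite B \<and> B \<subseteq> V \<and>
     (\<forall>c. (\<lambda>k. \<Sum>b\<in>B. c b * b k) \<in> W \<longrightarrow> (\<forall>b\<in>B. c b = 0)) \<and>
     (\<forall>g\<in>V. \<exists>c. (\<lambda>k. g k - (\<Sum>b\<in>B. c b * b k)) \<in> W)"

definition quotient_dim :: "lseries set \<Rightarrow> lseries set \<Rightarrow> nat" where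
  "quotient_dim V W = (THE n. \<exists>B. quotient_basis V W B \<and> card B = n)"


section \<open>Poincare series\<close>

text \<open>Series in \<open>t\<^sub>1, \<dots>, t\<^sub>r\<close>, possibly infinite in all directions, are integer-valued functions on
  the exponents \<open>\<int>\<^sup>r\<close>; they form a module over the Laurent polynomials, which are the finitely
  supported functions \<^typ>\<open>(int ^ 'r) \<Rightarrow>\<^sub>0 int\<close> with the convolution product.\<close>

definition laurent_poly_times ::
    "((int ^ 'r) \<Rightarrow>\<^sub>0 int) \<Rightarrow> (int ^ 'r \<Rightarrow> int) \<Rightarrow> (int ^ 'r \<Rightarrow> int)" where
  "laurent_poly_times q A v = (\<Sum>w \<in> Poly_Mapping.keys q. Poly_Mapping.lookup q w * A (v - w))"

definition t_var :: "'r::finite \<Rightarrow> (int ^ 'r) \<Rightarrow>\<^sub>0 int" where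
  "t_var i = Poly_Mapping.single (axis i 1) 1"

definition hilbert_series :: "('r::finite \<Rightarrow> int \<times> int) \<Rightarrow> lseries \<Rightarrow> int ^ 'r \<Rightarrow> int" where
  "hilbert_series l f v = int (quotient_dim (J_ideal l f v) (J_ideal l f (v + 1)))"

text \<open>The quotient by \<open>t\<^sub>1 \<cdots> t\<^sub>r - 1\<close>, which is invertible in \<open>\<int>[[t\<^sub>1, \<dots>, t\<^sub>r]]\<close>: the unique power series
  whose product with \<open>t\<^sub>1 \<cdots> t\<^sub>r - 1\<close> is the numerator (\<open>poincare_series_well_defined\<close> below).\<close>

definition poincare_series :: "('r::finite \<Rightarrow> int \<times> int) \<Rightarrow> lseries \<Rightarrow> int ^ 'r \<Rightarrow> int" where
  "poincare_series l f = (THE P. (\<forall>v. \<not> 0 \<le> v \<longrightarrow> P v = 0) \<and>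
     laurent_poly_times ((\<Prod>i\<in>UNIV. t_var i) - 1) P =
     laurent_poly_times (\<Prod>i\<in>UNIV. t_var i - 1) (hilbert_series l f))"


lemma laurent_poly_times_superset:
  assumes "finite S" "Poly_Mapping.keys q \<subseteq> S"
  shows "laurent_poly_times q A v = (\<Sum>w\<in>S. Poly_Mapping.lookup q w * A (v - w))"
  unfolding laurent_poly_times_def
  by (rule sum.mono_neutral_left) (use assms in \<open>auto simp: in_keys_iff\<close>)

lemma laurent_poly_times_diff:
  "laurent_poly_times (p - q) A v = laurent_poly_times p A v - laurent_poly_times q A v"
proof -
  let ?S = "Poly_Mapping.keys p \<union> Poly_Mapping.keys q"
  have "Poly_Mapping.keys (p - q) \<subseteq> ?S" by (auto simp: in_keys_iff lookup_minus)
  thus ?thesis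
    by (simp add: laurent_poly_times_superset[of ?S] lookup_minus algebra_simps sum_subtractf)
qed

lemma laurent_poly_times_monomial:
  fixes q :: "(int ^ 'r::finite) \<Rightarrow>\<^sub>0 int"
  shows "laurent_poly_times (Poly_Mapping.single a 1 * q) A v = laurent_poly_times q A (v - a)"
proof -
  let ?p = "Poly_Mapping.single a 1 * q"
  have l: "Poly_Mapping.lookup ?p (a + w) = Poly_Mapping.lookup q w" for w
  proof -
    have "Poly_Mapping.lookup ?p (a + w) =
        (\<Sum>l. (1 when a = l) * (\<Sum>k. Poly_Mapping.lookup q k when a + w = l + k))"
      by (simp only: lookup_mult lookup_single)
    also have "\<dots> = (\<Sum>l. (\<Sum>k. Poly_Mapping.lookup q k when a + w = l + k) when a = l)"
      by (intro Sum_any.cong) (auto simp: when_def)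
    also have "\<dots> = (\<Sum>k. Poly_Mapping.lookup q k when w = k)" by simp
    also have "\<dots> = Poly_Mapping.lookup q w" by simp
    finally show ?thesis .
  qed
  have "Poly_Mapping.keys ?p \<subseteq> (+) a ` Poly_Mapping.keys q"
  proof
    fix k assume "k \<in> Poly_Mapping.keys ?p"
    thus "k \<in> (+) a ` Poly_Mapping.keys q"
      using l[of "k - a"] by (intro image_eqI[of _ _ "k - a"]) (auto simp: in_keys_iff)
  qed
  hence "laurent_poly_times ?p A v =
      (\<Sum>k\<in>(+) a ` Poly_Mapping.keys q. Poly_Mapping.lookup ?p k * A (v - k))"
    by (intro laurent_poly_times_superset) auto
  also have "\<dots> = laurent_poly_times q A (v - a)"
    by (simp add: sum.reindex laurent_poly_times_def l diff_diff_eq)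
  finally show ?thesis .
qed

lemma laurent_poly_times_1: "laurent_poly_times 1 A v = A v"
  by (simp add: laurent_poly_times_def)

lemma prod_t_var: "(\<Prod>i\<in>UNIV. t_var i) = Poly_Mapping.single (1 :: int ^ 'r::finite) 1"
proof -
  have "(\<Prod>i\<in>S. t_var i) = Poly_Mapping.single (\<Sum>i\<in>S. axis i 1 :: int ^ 'r) 1" if "finite S" for S
    using that by induction (auto simp: t_var_def mult_single)
  moreover have "(\<Sum>i\<in>UNIV. axis i 1 :: int ^ 'r) = 1"
    by (simp add: vec_eq_iff axis_def)
  ultimately show ?thesis by simp
qed

lemma u_order_nonneg:
  assumes "g \<in> germs" "0 < fst l" "0 < snd l"
  shows "0 \<le> u_order l g"
  using assms unfolding u_order_def germs_def by (fastforce intro!: INF_greatest)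

lemma v_order_nonneg:
  assumes "g \<in> germs" "0 < fst l" "0 < snd l"
  shows "0 \<le> v_order l f g"
proof -
  have "(\<lambda>_. 0) \<in> laurent_germs"
    by (auto simp: laurent_germs_def germs_eq_convergent_series convergent_series_def supp_def
        intro!: exI[of _ 1])
  hence "u_order l (\<lambda>k. g k + ls_mult (\<lambda>_. 0) f k) \<le> v_order l f g"
    unfolding v_order_def by (rule SUP_upper)
  moreover have "u_order l (\<lambda>k. g k + ls_mult (\<lambda>_. 0) f k) = u_order l g"
    by (simp add: ls_mult_def)
  ultimately show ?thesis using u_order_nonneg[OF assms] by simp
qed

lemma poincare_series_well_defined:
  fixes l :: "'r::finite \<Rightarrow> int \<times> int"
  assumes l: "\<And>i. 0 < fst (l i) \<and> 0 < snd (l i)"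
  shows "\<exists>!P. (\<forall>v. \<not> 0 \<le> v \<longrightarrow> P v = 0) \<and>
     laurent_poly_times ((\<Prod>i\<in>UNIV. t_var i) - 1) P =
     laurent_poly_times (\<Prod>i\<in>UNIV. t_var i - 1) (hilbert_series l f)"
proof -
  define N where "N = laurent_poly_times (\<Prod>i\<in>UNIV. t_var i - 1) (hilbert_series l f)"
  have den: "laurent_poly_times ((\<Prod>i\<in>UNIV. t_var i) - 1) P v = P (v - 1) - P v"
    for P and v :: "int ^ 'r"
    using laurent_poly_times_monomial[of 1 1 P v]
    by (simp add: prod_t_var laurent_poly_times_diff laurent_poly_times_1)
  have J: "J_ideal l f v = J_ideal l f w" if vw: "\<And>i. max 0 (v $ i) = max 0 (w $ i)"
    for v w :: "int ^ 'r"
  proof -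
    have "ereal (real_of_int (v $ i)) \<le> v_order (l i) f g \<longleftrightarrow>
          ereal (real_of_int (w $ i)) \<le> v_order (l i) f g" if g: "g \<in> germs" for g i
    proof (cases "0 < v $ i \<or> 0 < w $ i")
      case True
      hence "v $ i = w $ i" using vw[of i] by linarith
      thus ?thesis by simp
    next
      case False
      moreover have "0 \<le> v_order (l i) f g" using v_order_nonneg[OF g] l by blast
      ultimately have "ereal (real_of_int (v $ i)) \<le> v_order (l i) f g"
        "ereal (real_of_int (w $ i)) \<le> v_order (l i) f g"
        by (auto intro: order_trans[of _ 0])
      thus ?thesis by simp
    qed
    thus ?thesis by (auto simp: J_ideal_def)
  qed
  have H: "hilbert_series l f (v - axis i 1) = hilbert_series l f v" if "v $ i < 0" for v :: "int ^ 'r" and i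
  proof -
    have "J_ideal l f (v - axis i 1) = J_ideal l f v" using that by (intro J) (auto simp: axis_def)
    moreover have "J_ideal l f (v - axis i 1 + 1) = J_ideal l f (v + 1)"
      using that by (intro J) (auto simp: axis_def)
    ultimately show ?thesis by (simp add: hilbert_series_def)
  qed
  have K: "0 \<le> w" if "w \<in> Poly_Mapping.keys (\<Prod>i\<in>S. t_var i - 1)" "finite S" for w :: "int ^ 'r" and S
    using that(2,1)
  proof (induction S arbitrary: w)
    case (insert i S)
    then obtain a b where w: "w = a + b" "a \<in> Poly_Mapping.keys (t_var i - 1)"
        "b \<in> Poly_Mapping.keys (\<Prod>i\<in>S. t_var i - 1)"
      using keys_mult[of "t_var i - 1" "\<Prod>i\<in>S. t_var i - 1"] by auto
    have "a = axis i 1 \<or> a = 0"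
      using w(2) by (auto simp: in_keys_iff lookup_minus t_var_def lookup_single lookup_one when_def split: if_splits)
    hence "0 \<le> a" by (auto simp: less_eq_vec_def axis_def)
    thus ?case using insert.IH[OF w(3)] by (auto simp: w(1) less_eq_vec_def)
  qed (auto simp: less_eq_vec_def)
  have N0: "N v = 0" if v: "\<not> 0 \<le> v" for v :: "int ^ 'r"
  proof -
    obtain i where i: "v $ i < 0" using v by (auto simp: less_eq_vec_def not_le)
    define R where "R = (\<Prod>j\<in>UNIV - {i}. t_var j - 1 :: (int ^ 'r) \<Rightarrow>\<^sub>0 int)"
    have "(\<Prod>i\<in>UNIV. t_var i - 1) = t_var i * R - R"
      unfolding R_def by (subst prod.remove[of _ i]) (auto simp: algebra_simps)
    hence "N v = laurent_poly_times R (hilbert_series l f) (v - axis i 1) - laurent_poly_times R (hilbert_series l f) v"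
      by (simp add: N_def laurent_poly_times_diff t_var_def laurent_poly_times_monomial)
    also have "laurent_poly_times R (hilbert_series l f) (v - axis i 1) = laurent_poly_times R (hilbert_series l f) v"
      unfolding laurent_poly_times_def
    proof (rule sum.cong[OF refl])
      fix w assume "w \<in> Poly_Mapping.keys R"
      hence "0 \<le> w" unfolding R_def by (rule K) auto
      hence "(v - w) $ i < 0" using i by (auto simp: less_eq_vec_def) (smt (verit))
      from H[OF this]
      show "Poly_Mapping.lookup R w * hilbert_series l f (v - axis i 1 - w) =
            Poly_Mapping.lookup R w * hilbert_series l f (v - w)"
        by (simp add: algebra_simps)
    qed
    finally show ?thesis by simp
  qed
  define m where "m v = nat (1 + Min (range (\<lambda>i. v $ i)))" for v :: "int ^ 'r"
  have Mn: "0 \<le> v \<longleftrightarrow> 0 \<le> Min (range (\<lambda>i. v $ i))" for v :: "int ^ 'r"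
    by (subst Min_ge_iff) (auto simp: less_eq_vec_def)
  have m0: "m v = 0 \<longleftrightarrow> \<not> 0 \<le> v" for v
    unfolding m_def Mn[of v] by linarith
  have "Min (range (\<lambda>i. (v - 1) $ i)) = Min (range (\<lambda>i. v $ i)) - 1" for v :: "int ^ 'r"
  proof -
    have "range (\<lambda>i. (v - 1) $ i) = (\<lambda>z. z - 1) ` range (\<lambda>i. v $ i)" by auto
    moreover have "mono (\<lambda>z. z - 1 :: int)" by (auto intro: monoI)
    ultimately show ?thesis using mono_Min_commute[of "\<lambda>z. z - 1" "range (\<lambda>i. v $ i)"] by simp
  qed
  hence mS: "m v = Suc (m (v - 1))" if "0 \<le> v" for v
    using that[unfolded Mn] unfolding m_def by (simp only:)
  define P where "P v = - (\<Sum>k<m v. N (v - of_nat k))" for v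
  have P0: "\<not> 0 \<le> v \<Longrightarrow> P v = 0" for v using m0[of v] by (simp add: P_def)
  have P1: "P (v - 1) - P v = N v" for v
  proof (cases "0 \<le> v")
    case True
    show ?thesis unfolding P_def mS[OF True] sum.lessThan_Suc_shift by (simp add: algebra_simps)
  next
    case False
    hence "\<not> 0 \<le> v - 1" by (auto simp: less_eq_vec_def) (smt (verit))
    with False show ?thesis by (simp add: P0 N0)
  qed
  show ?thesis
  proof (rule ex1I[of _ P])
    show "(\<forall>v. \<not> 0 \<le> v \<longrightarrow> P v = 0) \<and>
     laurent_poly_times ((\<Prod>i\<in>UNIV. t_var i) - 1) P =
     laurent_poly_times (\<Prod>i\<in>UNIV. t_var i - 1) (hilbert_series l f)"
      using P0 P1 den by (auto simp: N_def[symmetric])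
  next
    fix Q assume Q: "(\<forall>v. \<not> 0 \<le> v \<longrightarrow> Q v = 0) \<and>
     laurent_poly_times ((\<Prod>i\<in>UNIV. t_var i) - 1) Q =
     laurent_poly_times (\<Prod>i\<in>UNIV. t_var i - 1) (hilbert_series l f)"
    hence Q1: "Q (v - 1) - Q v = N v" for v using den[of Q v] by (simp add: N_def)
    have "Q v = P v" for v
    proof (induction "m v" arbitrary: v)
      case 0
      thus ?case using Q P0 m0[of v] by simp
    next
      case (Suc n)
      hence "0 \<le> v" using m0[of v] by auto
      hence "Q (v - 1) = P (v - 1)" using mS[of v] Suc by auto
      thus ?case using Q1[of v] P1[of v] by simp
    qed
    thus "Q = P" by auto
  qed
qed

end

theory Submission
  imports Defs
begin

text \<open>
  Whether \<open>v''\<^sub>i(g) \<ge> d\<close> only depends on Laurent polynomials \<open>h\<close> with \<open>u\<^sub>i(g + h f) \<ge> d\<close>.  Modulo a high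
  power of the \<open>i\<close>-th filtration, a Laurent multiple of \<open>f\<close> is a polynomial \<open>F\<^sub>i\<close> whose Newton diagram is
  the edge \<open>i\<close> moved to the coordinate axes; with respect to every other edge its initial form is a
  monomial.  Raising one \<open>v\<^sub>i\<close> by one, let \<open>N\<close> be the set of exponents on the line \<open>\<ell>\<^sub>i = v\<^sub>i\<close> that occur
  in \<open>\<ell>\<^sub>i\<close>-initial forms of germs \<open>g\<close> with \<open>v''\<^sub>j(g) \<ge> v\<^sub>j\<close> for \<open>j \<noteq> i\<close>.  Following the faces of the Newton
  polygon of such a \<open>g\<close> from the \<open>i\<close>-th face to both axes, one sees that these are exactly the initial
  exponents of the products \<open>x\<^sup>m \<Prod>\<^bsub>k\<in>S\<^esub> F\<^sub>k\<close>, and that they form an interval described by \<open>\<Gamma>\<close> alone.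
  Hence \<open>J(v) / J(v + e\<^sub>i)\<close> is spanned by an interval of monomials modulo the \<open>i\<close>-th initial form
  of \<open>f\<close>, and its dimension is the smaller of the length of that interval and the length of the edge.
  So already the Hilbert series depends only on \<open>\<Gamma>\<close>.
\<close>

text \<open>The orders at different edges use unrelated multipliers \<open>h\<close>, yet all of
  them are imposed on one germ with nonnegative exponents; this coupling is the obstacle. Products
  of the polynomials \<open>F\<^sub>k\<close> resolve it: \<open>F\<^sub>k\<close> meets condition
  \<open>k\<close> to any prescribed order, whereas for every other edge it behaves like a monomial.
  Each condition is thus met either by a factor or by a weight inequality, and the set
  \<open>S\<close> records the choice. Conversely, if the \<open>k\<close>-th face of
  \<open>g\<close> lies below level \<open>v\<^sub>k\<close>, its initial form is a multiple of the
  edge polynomial of \<open>f\<close>, so the face is at least as long as edge \<open>k\<close>;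
  convexity then relates the consecutive faces.

  The edge polynomials of two germs with the same diagram may differ in their inner coefficients.
  The end coefficients are nonzero in both cases, and division with remainder inside an interval of
  exponents only divides by these. The passage from \<open>v\<close> to \<open>v + 1\<close> is
  split into steps that raise one level each, and the bases of these steps stack.\<close>

declare split_paired_All [simp del] split_paired_Ex [simp del]

section \<open>Laurent polynomials acting on series\<close>

type_synonym lpoly = "(int \<times> int) \<Rightarrow>\<^sub>0 complex"

text \<open>Multiplication by a Laurent polynomial. The sum is finite for every coefficient family,
  whatever its support.\<close>

definition act :: "lpoly \<Rightarrow> lseries \<Rightarrow> lseries" where
  "act q g k = (\<Sum>w\<in>Poly_Mapping.keys q. Poly_Mapping.lookup q w * g (k - w))"

lemma act_superset:
  assumes "finite S" "Poly_Mapping.keys q \<subseteq> S"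
  shows "act q g k = (\<Sum>w\<in>S. Poly_Mapping.lookup q w * g (k - w))"
  unfolding act_def by (rule sum.mono_neutral_left) (use assms in \<open>auto simp: in_keys_iff\<close>)

lemma act_0 [simp]: "act 0 g k = 0"
  by (simp add: act_def)

lemma act_single [simp]: "act (Poly_Mapping.single w c) g k = c * g (k - w)"
  by (subst act_superset[of "{w}"]) (auto split: if_splits)

lemma act_add: "act (p + q) g k = act p g k + act q g k"
proof -
  let ?S = "Poly_Mapping.keys p \<union> Poly_Mapping.keys q"
  have "Poly_Mapping.keys (p + q) \<subseteq> ?S" by (rule Poly_Mapping.keys_add)
  thus ?thesis
    by (simp add: act_superset[of ?S] lookup_add algebra_simps sum.distrib)
qed

lemma act_add_right: "act q (\<lambda>k. g k + h k) = (\<lambda>k. act q g k + act q h k)"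
  by (simp add: fun_eq_iff act_def algebra_simps sum.distrib)

lemma act_cmult_right: "act q (\<lambda>k. c * g k) = (\<lambda>k. c * act q g k)"
  by (simp add: fun_eq_iff act_def sum_distrib_left algebra_simps)

lemma act_single_0: "act (Poly_Mapping.single 0 c) g = (\<lambda>k. c * g k)"
  by (simp add: fun_eq_iff)

lemma act_lookup: "act p (Poly_Mapping.lookup q) = Poly_Mapping.lookup (p * q)"
proof
  fix k
  have fin: "finite {a. Poly_Mapping.lookup p a * (\<Sum>b. Poly_Mapping.lookup q b when k = a + b) \<noteq> 0}"
    by (rule finite_subset[of _ "Poly_Mapping.keys p"]) (auto simp: in_keys_iff)
  have inner: "(\<Sum>b. Poly_Mapping.lookup q b when k = a + b) = Poly_Mapping.lookup q (k - a)" for a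
  proof -
    have "(\<Sum>b. Poly_Mapping.lookup q b when k = a + b) = (\<Sum>b. Poly_Mapping.lookup q b when k - a = b)"
      by (intro Sum_any.cong when_cong) (auto simp: diff_eq_eq add.commute)
    thus ?thesis by simp
  qed
  have "Poly_Mapping.lookup (p * q) k =
      (\<Sum>a. Poly_Mapping.lookup p a * (\<Sum>b. Poly_Mapping.lookup q b when k = a + b))"
    by (simp add: lookup_mult)
  also have "\<dots> = (\<Sum>a. Poly_Mapping.lookup p a * Poly_Mapping.lookup q (k - a))"
    by (simp only: inner)
  also have "\<dots> = act p (Poly_Mapping.lookup q) k"
    unfolding act_def by (rule Sum_any.expand_superset) (auto simp: in_keys_iff)
  finally show "act p (Poly_Mapping.lookup q) k = Poly_Mapping.lookup (p * q) k" by simp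
qed

lemma act_mult: "act (p * q) g = act p (act q g)"
proof
  fix k
  let ?P = "Poly_Mapping.keys p" and ?Q = "Poly_Mapping.keys q"
  let ?S = "(\<lambda>(a, b). a + b) ` (?P \<times> ?Q)"
  let ?p = "Poly_Mapping.lookup p" and ?q = "Poly_Mapping.lookup q"
  have "Poly_Mapping.keys (p * q) \<subseteq> ?S" using Poly_Mapping.keys_mult[of p q] by force
  hence S: "finite ?S" "Poly_Mapping.keys (p * q) \<subseteq> ?S" by auto
  have "act (p * q) g k = (\<Sum>w\<in>?S. (\<Sum>a\<in>?P. ?p a * ?q (w - a)) * g (k - w))"
    by (subst act_superset[OF S]) (simp add: act_lookup[symmetric] act_def)
  also have "\<dots> = (\<Sum>a\<in>?P. \<Sum>w\<in>?S. ?p a * ?q (w - a) * g (k - w))"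
    by (simp add: sum_distrib_right) (rule sum.swap)
  also have "\<dots> = (\<Sum>a\<in>?P. ?p a * act q g (k - a))"
  proof (rule sum.cong[OF refl])
    fix a assume a: "a \<in> ?P"
    have "(\<Sum>w\<in>?S. ?p a * ?q (w - a) * g (k - w)) = (\<Sum>w\<in>(+) a ` ?Q. ?p a * ?q (w - a) * g (k - w))"
    proof (rule sum.mono_neutral_right)
      show "\<forall>w\<in>?S - (+) a ` ?Q. ?p a * ?q (w - a) * g (k - w) = 0"
      proof
        fix w assume w: "w \<in> ?S - (+) a ` ?Q"
        have "w - a \<notin> ?Q" using w by (auto simp: image_iff)
        thus "?p a * ?q (w - a) * g (k - w) = 0" by (simp add: in_keys_iff)
      qed
    qed (use S a in auto)
    also have "\<dots> = ?p a * act q g (k - a)"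
      by (simp add: sum.reindex act_def sum_distrib_left diff_diff_eq mult.assoc)
    finally show "(\<Sum>w\<in>?S. ?p a * ?q (w - a) * g (k - w)) = ?p a * act q g (k - a)" .
  qed
  finally show "act (p * q) g k = act p (act q g) k" by (simp add: act_def[of p])
qed


definition restrict_series :: "(int \<times> int) set \<Rightarrow> lseries \<Rightarrow> lpoly" where
  "restrict_series X g = (\<Sum>w\<in>X. Poly_Mapping.single w (g w))"

lemma lookup_restrict_series:
  "finite X \<Longrightarrow> Poly_Mapping.lookup (restrict_series X g) k = (if k \<in> X then g k else 0)"
  by (auto simp: restrict_series_def lookup_sum lookup_single when_def)


section \<open>Weights\<close>

definition wt :: "int \<times> int \<Rightarrow> int \<times> int \<Rightarrow> int" where
  "wt l k = fst l * fst k + snd l * snd k"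

lemma wt_add [simp]: "wt l (k + m) = wt l k + wt l m"
  and wt_diff [simp]: "wt l (k - m) = wt l k - wt l m"
  and wt_0 [simp]: "wt l 0 = 0"
  by (simp_all add: wt_def algebra_simps)

lemma wt_sum: "wt l (\<Sum>x\<in>A. h x) = (\<Sum>x\<in>A. wt l (h x))"
  by (induction A rule: infinite_finite_induct) auto

lemma wt_eq_iff:
  assumes "0 < snd l" "wt l k = wt l m" "fst k = fst m"
  shows "k = m"
  using assms by (auto simp: wt_def prod_eq_iff)

lemma wt_nonneg: "0 < fst l \<Longrightarrow> 0 < snd l \<Longrightarrow> 0 \<le> fst k \<Longrightarrow> 0 \<le> snd k \<Longrightarrow> 0 \<le> wt l k"
  by (simp add: wt_def)

text \<open>Both entries of \<open>l\<close> are positive, so once the corner \<open>(c, c)\<close>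
  is moved to the origin the weight bounds each coordinate. All truncations to polynomials rest on
  this.\<close>

lemma finite_wt_le:
  assumes l: "0 < fst l" "0 < snd l"
  shows "finite {k. c \<le> fst k \<and> c \<le> snd k \<and> wt l k \<le> d}"
proof -
  let ?D = "d - c * fst l - c * snd l"
  have "{k. c \<le> fst k \<and> c \<le> snd k \<and> wt l k \<le> d} \<subseteq> {c..c + ?D} \<times> {c..c + ?D}"
  proof
    fix k assume "k \<in> {k. c \<le> fst k \<and> c \<le> snd k \<and> wt l k \<le> d}"
    then obtain x y where k: "k = (c + x, c + y)" "0 \<le> x" "0 \<le> y" "wt l k \<le> d"
      by (cases k) (auto intro: that[of "fst k - c" "snd k - c"])
    have *: "fst l * x + snd l * y \<le> ?D" using k by (simp add: wt_def algebra_simps)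
    have "x \<le> fst l * x" "y \<le> snd l * y" using l k by (simp_all add: mult_le_cancel_right1)
    moreover have "0 \<le> fst l * x" "0 \<le> snd l * y" using l k by simp_all
    ultimately have "x \<le> ?D" "y \<le> ?D" using * by linarith+
    thus "k \<in> {c..c + ?D} \<times> {c..c + ?D}" using k by auto
  qed
  thus ?thesis by (rule finite_subset) auto
qed

definition ord_ge :: "int \<times> int \<Rightarrow> int \<Rightarrow> lseries \<Rightarrow> bool" where
  "ord_ge l d g \<longleftrightarrow> (\<forall>k. wt l k < d \<longrightarrow> g k = 0)"

lemma ord_geD: "ord_ge l d g \<Longrightarrow> wt l k < d \<Longrightarrow> g k = 0"
  by (simp add: ord_ge_def)

lemma ord_ge_mono: "ord_ge l d g \<Longrightarrow> e \<le> d \<Longrightarrow> ord_ge l e g"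
  by (auto simp: ord_ge_def)

lemma ord_ge_act:
  assumes "ord_ge l e (Poly_Mapping.lookup q)" "ord_ge l d g"
  shows "ord_ge l (e + d) (act q g)"
  unfolding ord_ge_def act_def
proof (intro allI impI sum.neutral ballI)
  fix k w assume k: "wt l k < e + d" and w: "w \<in> Poly_Mapping.keys q"
  have "e \<le> wt l w" using ord_geD[OF assms(1), of w] w by (auto simp: in_keys_iff not_less[symmetric])
  hence "g (k - w) = 0" using k by (intro ord_geD[OF assms(2)]) simp
  thus "Poly_Mapping.lookup q w * g (k - w) = 0" by simp
qed

definition nonneg_supp :: "lseries \<Rightarrow> bool" where
  "nonneg_supp g \<longleftrightarrow> (\<forall>k. g k \<noteq> 0 \<longrightarrow> 0 \<le> fst k \<and> 0 \<le> snd k)"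

lemma nonneg_suppD: "nonneg_supp g \<Longrightarrow> g k \<noteq> 0 \<Longrightarrow> 0 \<le> fst k \<and> 0 \<le> snd k"
  by (auto simp: nonneg_supp_def)

lemma nonneg_supp_germs: "g \<in> germs \<Longrightarrow> nonneg_supp g"
  unfolding germs_def supp_def nonneg_supp_def by auto

lemma nonneg_supp_ord_ge: "nonneg_supp g \<Longrightarrow> 0 < fst l \<Longrightarrow> 0 < snd l \<Longrightarrow> ord_ge l 0 g"
  unfolding ord_ge_def by (metis nonneg_suppD wt_nonneg not_less)

lemma nonneg_supp_act:
  assumes "nonneg_supp (Poly_Mapping.lookup q)" "nonneg_supp g"
  shows "nonneg_supp (act q g)"
  unfolding nonneg_supp_def
proof (intro allI impI)
  fix k assume "act q g k \<noteq> 0"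
  then obtain w where "Poly_Mapping.lookup q w * g (k - w) \<noteq> 0"
    unfolding act_def by (meson sum.neutral)
  thus "0 \<le> fst k \<and> 0 \<le> snd k"
    using nonneg_suppD[OF assms(1), of w] nonneg_suppD[OF assms(2), of "k - w"] by auto
qed

lemma finite_supp_germs:
  assumes "nonneg_supp g" "finite {k. g k \<noteq> 0}"
  shows "g \<in> germs"
proof -
  have "(\<lambda>k. g k * monom_at k x y) summable_on UNIV" for x y
  proof -
    have "(\<lambda>k. g k * monom_at k x y) summable_on {k. g k \<noteq> 0}"
      using assms(2) by (rule summable_on_finite)
    thus ?thesis by (rule summable_on_cong_neutral[THEN iffD1, rotated -1]) auto
  qed
  thus ?thesis using assms(1)
    by (auto simp: germs_eq_convergent_series convergent_series_def nonneg_supp_def supp_def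
        intro!: exI[of _ 1])
qed

lemma lookup_germs: "nonneg_supp (Poly_Mapping.lookup q) \<Longrightarrow> Poly_Mapping.lookup q \<in> germs"
  by (rule finite_supp_germs) auto

lemma germs_lincomb:
  assumes "g \<in> germs" "h \<in> germs"
  shows "(\<lambda>k. g k + c * h k) \<in> germs"
proof -
  obtain r where r: "r > 0"
    "\<And>x y. norm x < r \<Longrightarrow> norm y < r \<Longrightarrow> (\<lambda>k. g k * monom_at k x y) summable_on UNIV"
    using assms(1) unfolding germs_eq_convergent_series convergent_series_def by blast
  obtain s where s: "s > 0"
    "\<And>x y. norm x < s \<Longrightarrow> norm y < s \<Longrightarrow> (\<lambda>k. h k * monom_at k x y) summable_on UNIV"
    using assms(2) unfolding germs_eq_convergent_series convergent_series_def by blast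
  have "(\<lambda>k. (g k + c * h k) * monom_at k x y) summable_on UNIV"
    if "norm x < min r s" "norm y < min r s" for x y
  proof -
    have "(\<lambda>k. g k * monom_at k x y + c * (h k * monom_at k x y)) summable_on UNIV"
      using that by (intro summable_on_add summable_on_cmult_right r s) auto
    thus ?thesis by (simp add: algebra_simps)
  qed
  moreover have "nonneg_supp (\<lambda>k. g k + c * h k)"
    using assms[THEN nonneg_supp_germs] unfolding nonneg_supp_def by (metis add_0 mult_zero_right)
  ultimately show ?thesis
    using r(1) s(1) unfolding germs_eq_convergent_series convergent_series_def nonneg_supp_def supp_def
    by (auto intro!: exI[of _ "min r s"])
qed

lemma laurent_germs_bdd:
  assumes "h \<in> laurent_germs"
  obtains m :: int where "\<And>k. h k \<noteq> 0 \<Longrightarrow> - m \<le> fst k \<and> - m \<le> snd k"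
proof -
  obtain m where m: "(\<lambda>(i, j). h (i - int m, j - int m)) \<in> germs"
    using assms by (auto simp: laurent_germs_def)
  have "- int m \<le> fst k \<and> - int m \<le> snd k" if "h k \<noteq> 0" for k
    using nonneg_suppD[OF nonneg_supp_germs[OF m], of "k + (int m, int m)"] that by (cases k) auto
  thus thesis by (rule that)
qed

lemma lookup_laurent_germs: "Poly_Mapping.lookup q \<in> laurent_germs"
proof -
  let ?q = "Poly_Mapping.lookup q"
  define m where "m = nat (Max ((\<lambda>k. max (- fst k) (- snd k)) ` insert 0 (Poly_Mapping.keys q)))"
  have m: "- int m \<le> fst k \<and> - int m \<le> snd k" if "?q k \<noteq> 0" for k
  proof -
    have "max (- fst k) (- snd k) \<le> Max ((\<lambda>k. max (- fst k) (- snd k)) ` insert 0 (Poly_Mapping.keys q))"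
      using that by (intro Max_ge) (auto simp: in_keys_iff)
    thus ?thesis unfolding m_def by linarith
  qed
  have "(\<lambda>(i, j). ?q (i - int m, j - int m)) \<in> germs"
  proof (rule finite_supp_germs)
    show "nonneg_supp (\<lambda>(i, j). ?q (i - int m, j - int m))"
      using m by (force simp: nonneg_supp_def)
    have "{k. (\<lambda>(i, j). ?q (i - int m, j - int m)) k \<noteq> 0} \<subseteq> (\<lambda>k. k + (int m, int m)) ` Poly_Mapping.keys q"
      by (force simp: in_keys_iff image_iff)
    thus "finite {k. (\<lambda>(i, j). ?q (i - int m, j - int m)) k \<noteq> 0}"
      by (rule finite_subset) auto
  qed
  thus ?thesis by (auto simp: laurent_germs_def)
qed

lemma ls_mult_lookup: "ls_mult (Poly_Mapping.lookup q) f = act q f"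
  unfolding ls_mult_def act_def
  by (intro ext sum.mono_neutral_left) (auto simp: in_keys_iff)


section \<open>The order functions through Laurent polynomials\<close>

text \<open>The condition that the order of \<open>g\<close> is at least \<open>d\<close>, with the
  supremum over all \<open>h\<close> replaced by the existence of one Laurent polynomial.\<close>

definition in_filt :: "int \<times> int \<Rightarrow> lseries \<Rightarrow> int \<Rightarrow> lseries \<Rightarrow> bool" where
  "in_filt l f d g \<longleftrightarrow> (\<exists>q. ord_ge l d (\<lambda>k. g k + act q f k))"

lemma le_u_order_iff: "ereal (real_of_int d) \<le> u_order l g \<longleftrightarrow> ord_ge l d g"
proof -
  have "ereal (real_of_int d) \<le> u_order l g \<longleftrightarrow> (\<forall>k. g k \<noteq> 0 \<longrightarrow> d \<le> wt l k)"
    unfolding u_order_def le_INF_iff supp_def wt_def ereal_less_eq of_int_le_iff by simp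
  thus ?thesis by (metis ord_ge_def not_less)
qed

text \<open>The values of \<open>u_order\<close> are integers or infinite, so a supremum of at least
  \<open>d\<close> is witnessed by a single \<open>h\<close>. Since \<open>f\<close> has only
  nonnegative weights, the terms of \<open>h\<close> of weight above \<open>d\<close> do not reach
  the weights below \<open>d\<close>, and only finitely many other terms exist.\<close>

lemma le_v_order_iff:
  assumes f: "f \<in> germs" and l: "0 < fst l" "0 < snd l"
  shows "ereal (real_of_int d) \<le> v_order l f g \<longleftrightarrow> in_filt l f d g"
proof
  assume "in_filt l f d g"
  then obtain q where q: "ord_ge l d (\<lambda>k. g k + ls_mult (Poly_Mapping.lookup q) f k)"
    unfolding in_filt_def ls_mult_lookup by blast
  have "u_order l (\<lambda>k. g k + ls_mult (Poly_Mapping.lookup q) f k) \<le> v_order l f g"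
    unfolding v_order_def by (rule SUP_upper) (rule lookup_laurent_germs)
  thus "ereal (real_of_int d) \<le> v_order l f g"
    using q unfolding le_u_order_iff[symmetric] by (rule order_trans[rotated])
next
  assume "ereal (real_of_int d) \<le> v_order l f g"
  \<comment> \<open>A strict bound passes from the supremum to one \<open>h\<close>; integrality of
    the weights later closes the gap of one half.\<close>
  hence "ereal (real_of_int d - 1 / 2) < v_order l f g" by (rule less_le_trans[rotated]) simp
  then obtain h where h: "h \<in> laurent_germs"
    "ereal (real_of_int d - 1 / 2) < u_order l (\<lambda>k. g k + ls_mult h f k)"
    unfolding v_order_def less_SUP_iff by blast
  have *: "g k + ls_mult h f k = 0" if "wt l k < d" for k
  proof (rule ccontr)
    assume "g k + ls_mult h f k \<noteq> 0"
    hence "u_order l (\<lambda>k. g k + ls_mult h f k) \<le> ereal (real_of_int (wt l k))"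
      unfolding u_order_def wt_def by (intro INF_lower) (simp add: supp_def)
    with h(2) have "ereal (real_of_int d - 1 / 2) < ereal (real_of_int (wt l k))" by (rule less_le_trans)
    hence "real_of_int d - 1 / 2 < real_of_int (wt l k)" by simp
    thus False using that by linarith
  qed
  obtain m where m: "\<And>k. h k \<noteq> 0 \<Longrightarrow> - m \<le> fst k \<and> - m \<le> snd k"
    using laurent_germs_bdd[OF h(1)] by blast
  define X where "X = {k. - m \<le> fst k \<and> - m \<le> snd k \<and> wt l k \<le> d}"
  have X: "finite X" unfolding X_def by (rule finite_wt_le[OF l])
  define q where "q = restrict_series X h"
  have q: "Poly_Mapping.lookup q k = (if k \<in> X then h k else 0)" for k
    using X by (simp add: q_def lookup_restrict_series)
  have "ls_mult h f k = act q f k" if k: "wt l k < d" for k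
  proof -
    have P: "p \<in> X" if "h p \<noteq> 0" "f (k - p) \<noteq> 0" for p
    proof -
      have "0 \<le> wt l (k - p)"
        using nonneg_suppD[OF nonneg_supp_germs[OF f] that(2)] l by (intro wt_nonneg) auto
      thus ?thesis using m[OF that(1)] k by (simp add: X_def)
    qed
    have "ls_mult h f k = (\<Sum>p\<in>X. h p * f (k - p))"
      unfolding ls_mult_def by (rule sum.mono_neutral_left) (use X P in auto)
    also have "\<dots> = act q f k"
      by (subst act_superset[OF X]) (auto simp: q in_keys_iff split: if_splits)
    finally show ?thesis .
  qed
  hence "ord_ge l d (\<lambda>k. g k + act q f k)"
    using * by (simp add: ord_ge_def)
  thus "in_filt l f d g" unfolding in_filt_def by blast
qed

lemma in_filt_mono: "in_filt l f d g \<Longrightarrow> e \<le> d \<Longrightarrow> in_filt l f e g"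
  unfolding in_filt_def using ord_ge_mono by blast

lemma in_filt_of_ord_ge: "ord_ge l d g \<Longrightarrow> in_filt l f d g"
  unfolding in_filt_def by (rule exI[of _ 0]) simp

lemma in_filt_lincomb:
  assumes "in_filt l f d g" "in_filt l f d h"
  shows "in_filt l f d (\<lambda>k. g k + c * h k)"
proof -
  obtain q p where q: "ord_ge l d (\<lambda>k. g k + act q f k)" and p: "ord_ge l d (\<lambda>k. h k + act p f k)"
    using assms unfolding in_filt_def by blast
  let ?q = "q + Poly_Mapping.single 0 c * p"
  have "g k + c * h k + act ?q f k = (g k + act q f k) + c * (h k + act p f k)" for k
    by (simp add: act_add mult.commute[of _ p] act_mult act_single_0 act_cmult_right algebra_simps)
  hence "ord_ge l d (\<lambda>k. g k + c * h k + act ?q f k)"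
    using q p by (simp only: ord_ge_def) simp
  thus ?thesis unfolding in_filt_def by blast
qed

lemma in_filt_act:
  assumes g: "in_filt l f d g" and q: "nonneg_supp (Poly_Mapping.lookup q)" and l: "0 < fst l" "0 < snd l"
  shows "in_filt l f d (act q g)"
proof -
  obtain p where p: "ord_ge l d (\<lambda>k. g k + act p f k)" using g unfolding in_filt_def by blast
  have "ord_ge l (0 + d) (act q (\<lambda>k. g k + act p f k))"
    by (rule ord_ge_act[OF nonneg_supp_ord_ge[OF q l] p])
  thus ?thesis unfolding in_filt_def by (intro exI[of _ "q * p"]) (simp add: act_add_right act_mult)
qed

text \<open>Monomials are units among the Laurent polynomials, so the shift is absorbed by the
  multiplier. This is what allows an edge of \<open>f\<close> to be moved to the coordinate
  axes.\<close>

lemma in_filt_shift: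
  "in_filt l (act (Poly_Mapping.single w 1) f) d g \<longleftrightarrow> in_filt l f d g"
proof
  assume "in_filt l (act (Poly_Mapping.single w 1) f) d g"
  thus "in_filt l f d g" unfolding in_filt_def act_mult[symmetric] by blast
next
  assume "in_filt l f d g"
  then obtain q where q: "ord_ge l d (\<lambda>k. g k + act q f k)" unfolding in_filt_def by blast
  have "q * Poly_Mapping.single (- w) 1 * Poly_Mapping.single w 1 = q"
    by (simp add: mult.assoc mult_single)
  hence "act q f = act (q * Poly_Mapping.single (- w) 1) (act (Poly_Mapping.single w 1) f)"
    by (simp add: act_mult[symmetric])
  thus "in_filt l (act (Poly_Mapping.single w 1) f) d g" using q unfolding in_filt_def by metis
qed

section \<open>Chains of faces\<close>

text \<open>Here \<open>m\<close> is an exponent on the face of edge \<open>i\<close>,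
  \<open>A\<close> consists of the edges on one side of \<open>i\<close>, and \<open>S\<close> of
  those among them whose factor is used. Seen from \<open>i\<close>, factor \<open>k\<close>
  contributes the point \<open>P k\<close>, seen from \<open>j\<close> the point
  \<open>c j k\<close>; the sum of differences turns the weight of \<open>m\<close> into the
  \<open>j\<close>-th order of the product. The coordinate \<eta> is the distance from the axis on
  that side, and it must stay nonnegative when the points \<open>P k\<close> are taken off
  \<open>m\<close>.\<close>

definition chain_cond ::
    "(int \<times> int \<Rightarrow> int) \<Rightarrow> ('r \<Rightarrow> int \<times> int \<Rightarrow> int) \<Rightarrow> ('r \<Rightarrow> int \<times> int) \<Rightarrow> ('r \<Rightarrow> 'r \<Rightarrow> int \<times> int) \<Rightarrow>
     ('r \<Rightarrow> int) \<Rightarrow> 'r set \<Rightarrow> int \<times> int \<Rightarrow> bool" where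
  "chain_cond \<eta> u P c v A m \<longleftrightarrow> (\<exists>S\<subseteq>A. (\<Sum>k\<in>S. \<eta> (P k)) \<le> \<eta> m \<and>
     (\<forall>j\<in>A - S. v j \<le> u j m + (\<Sum>k\<in>S. u j (c j k) - u j (P k))))"

lemma chain_cond_mono:
  assumes "chain_cond \<eta> u P c v A m" "\<eta> m \<le> \<eta> m'"
    and "\<And>j. j \<in> A \<Longrightarrow> v' j - v j \<le> u j m' - u j m"
  shows "chain_cond \<eta> u P c v' A m'"
proof -
  obtain S where S: "S \<subseteq> A" "(\<Sum>k\<in>S. \<eta> (P k)) \<le> \<eta> m"
    "\<And>j. j \<in> A - S \<Longrightarrow> v j \<le> u j m + (\<Sum>k\<in>S. u j (c j k) - u j (P k))"
    using assms(1) unfolding chain_cond_def by blast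
  have "v' j \<le> u j m' + (\<Sum>k\<in>S. u j (c j k) - u j (P k))" if "j \<in> A - S" for j
    using S(3)[OF that] assms(3)[of j] that by auto
  thus ?thesis using S(1,2) assms(2) unfolding chain_cond_def by (intro exI[of _ S]) auto
qed

text \<open>A walk along the faces away from \<open>i\<close>, with \<open>L k\<close> the near and
  \<open>R k\<close> the far end of face \<open>k\<close>. In the first alternative of
  \<open>face\<close> the level of the face suffices for \<open>v k\<close>; in the second one the
  face has room for the whole edge, and \<open>k\<close> is put into \<open>S\<close>.\<close>

lemma chain_cond_of_faces:
  fixes \<sigma> :: "'r \<Rightarrow> real"
  assumes "finite A" "inj_on \<sigma> A"
    and R0: "\<And>k. k \<in> A \<Longrightarrow> 0 \<le> \<eta> (R k)"
    and order: "\<And>k j. k \<in> A \<Longrightarrow> j \<in> A \<Longrightarrow> \<sigma> k < \<sigma> j \<Longrightarrow> \<eta> (L j) \<le> \<eta> (R k)"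
      "\<And>k j j'. k \<in> A \<Longrightarrow> j \<in> A \<Longrightarrow> j' \<in> A \<Longrightarrow> \<sigma> k < \<sigma> j \<Longrightarrow> \<sigma> j \<le> \<sigma> j' \<Longrightarrow> u j' (L j) \<le> u j' (R k)"
    and c: "\<And>k j. k \<in> A \<Longrightarrow> j \<in> A \<Longrightarrow> \<sigma> j < \<sigma> k \<Longrightarrow> c j k = P k"
      "\<And>k j. k \<in> A \<Longrightarrow> j \<in> A \<Longrightarrow> \<sigma> k < \<sigma> j \<Longrightarrow> c j k = Q k"
    and face: "\<And>k. k \<in> A \<Longrightarrow>
      (v k \<le> u k (L k) \<and> \<eta> (R k) \<le> \<eta> (L k) \<and> (\<forall>j\<in>A. \<sigma> k < \<sigma> j \<longrightarrow> u j (R k) \<le> u j (L k))) \<or>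
      (\<eta> (P k) + \<eta> (R k) \<le> \<eta> (L k) \<and>
        (\<forall>j\<in>A. \<sigma> k < \<sigma> j \<longrightarrow> u j (R k) \<le> u j (L k) - u j (P k) + u j (Q k)))"
    and m: "0 \<le> \<eta> m" "\<And>k. k \<in> A \<Longrightarrow> \<eta> (L k) \<le> \<eta> m"
      "\<And>k j. k \<in> A \<Longrightarrow> j \<in> A \<Longrightarrow> \<sigma> k \<le> \<sigma> j \<Longrightarrow> u j (L k) \<le> u j m"
  shows "chain_cond \<eta> u P c v A m"
  using assms
proof (induction "card A" arbitrary: A m)
  case 0
  thus ?case by (auto simp: chain_cond_def)
next
  case (Suc n)
  hence "A \<noteq> {}" by auto
  then obtain k where k: "k \<in> A" and kmin: "\<And>j. j \<in> A \<Longrightarrow> \<sigma> k \<le> \<sigma> j"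
    using Suc.prems(1) by (metis arg_min_if_finite(1) arg_min_least)
  define A' where "A' = A - {k}"
  have less: "\<sigma> k < \<sigma> j" if "j \<in> A'" for j
    using kmin[of j] that inj_onD[OF Suc.prems(2), of k j] k by (force simp: A'_def less_le)
  have sub: "j \<in> A" if "j \<in> A'" for j using that by (simp add: A'_def)
  \<comment> \<open>The walk continues from the far end of the nearest face, which takes over the
    role of \<open>m\<close>.\<close>
  have "chain_cond \<eta> u P c v A' (R k)"
  proof (rule Suc.hyps)
    show "n = card A'" using Suc.hyps(2) Suc.prems(1) k by (simp add: A'_def)
    show "inj_on \<sigma> A'" using Suc.prems(2) by (simp add: A'_def inj_on_diff)
    fix j assume j: "j \<in> A'"
    show "(v j \<le> u j (L j) \<and> \<eta> (R j) \<le> \<eta> (L j) \<and> (\<forall>j'\<in>A'. \<sigma> j < \<sigma> j' \<longrightarrow> u j' (R j) \<le> u j' (L j))) \<or>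
      (\<eta> (P j) + \<eta> (R j) \<le> \<eta> (L j) \<and>
        (\<forall>j'\<in>A'. \<sigma> j < \<sigma> j' \<longrightarrow> u j' (R j) \<le> u j' (L j) - u j' (P j) + u j' (Q j)))"
      using Suc.prems(8)[OF sub[OF j]] sub by blast
    show "0 \<le> \<eta> (R j)" using Suc.prems(3)[OF sub[OF j]] .
    show "\<eta> (L j) \<le> \<eta> (R k)" by (rule Suc.prems(4)[OF k sub[OF j] less[OF j]])
    fix j' assume j': "j' \<in> A'"
    show "\<sigma> j < \<sigma> j' \<Longrightarrow> \<eta> (L j') \<le> \<eta> (R j)" by (rule Suc.prems(4)[OF sub[OF j] sub[OF j']])
    show "\<sigma> j' < \<sigma> j \<Longrightarrow> c j' j = P j" by (rule Suc.prems(6)[OF sub[OF j] sub[OF j']])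
    show "\<sigma> j < \<sigma> j' \<Longrightarrow> c j' j = Q j" by (rule Suc.prems(7)[OF sub[OF j] sub[OF j']])
    show "\<sigma> j \<le> \<sigma> j' \<Longrightarrow> u j' (L j) \<le> u j' (R k)"
      by (rule Suc.prems(5)[OF k sub[OF j] sub[OF j'] less[OF j]])
    fix j'' assume j'': "j'' \<in> A'"
    show "\<sigma> j < \<sigma> j' \<Longrightarrow> \<sigma> j' \<le> \<sigma> j'' \<Longrightarrow> u j'' (L j') \<le> u j'' (R j)"
      by (rule Suc.prems(5)[OF sub[OF j] sub[OF j'] sub[OF j'']])
  qed (use Suc.prems(1) Suc.prems(3)[OF k] in \<open>auto simp: A'_def\<close>)
  then obtain S where S: "S \<subseteq> A'" "(\<Sum>j\<in>S. \<eta> (P j)) \<le> \<eta> (R k)"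
    "\<And>j. j \<in> A' - S \<Longrightarrow> v j \<le> u j (R k) + (\<Sum>i\<in>S. u j (c j i) - u j (P i))"
    unfolding chain_cond_def by blast
  have kS: "k \<notin> S" and finS: "finite S" using S(1) Suc.prems(1) by (auto simp: A'_def intro: finite_subset)
  from Suc.prems(8)[OF k] show ?case
  proof (elim disjE conjE)
    assume *: "v k \<le> u k (L k)" "\<eta> (R k) \<le> \<eta> (L k)" "\<forall>j\<in>A. \<sigma> k < \<sigma> j \<longrightarrow> u j (R k) \<le> u j (L k)"
    have "v j \<le> u j m + (\<Sum>i\<in>S. u j (c j i) - u j (P i))" if j: "j \<in> A - S" for j
    proof (cases "j = k")
      case True
      \<comment> \<open>All members of \<open>S\<close> lie beyond \<open>k\<close>, so
        \<open>k\<close> sees them at the same points as the start of the walk does.\<close>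
      have "(\<Sum>i\<in>S. u k (c k i) - u k (P i)) = 0"
        using S(1) sub less k Suc.prems(6) by (intro sum.neutral) auto
      moreover have "u k (L k) \<le> u k m" using Suc.prems(11)[OF k k] by simp
      ultimately show ?thesis using *(1) True by simp
    next
      case False
      hence j': "j \<in> A' - S" using j by (simp add: A'_def)
      have "u j (R k) \<le> u j m"
        using *(3) j less[of j] j' Suc.prems(11)[OF k, of j] by fastforce
      thus ?thesis using S(3)[OF j'] by simp
    qed
    moreover have "(\<Sum>j\<in>S. \<eta> (P j)) \<le> \<eta> m" using S(2) *(2) Suc.prems(10)[OF k] by simp
    ultimately show ?thesis
      using S(1) sub unfolding chain_cond_def by (intro exI[of _ S]) auto
  next
    assume *: "\<eta> (P k) + \<eta> (R k) \<le> \<eta> (L k)"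
      "\<forall>j\<in>A. \<sigma> k < \<sigma> j \<longrightarrow> u j (R k) \<le> u j (L k) - u j (P k) + u j (Q k)"
    \<comment> \<open>Every \<open>j\<close> beyond \<open>k\<close> sees factor \<open>k\<close> at
      its other end \<open>Q k\<close>; the new summand pays exactly for the passage from
      \<open>L k\<close> to \<open>R k\<close>.\<close>
    have "v j \<le> u j m + (\<Sum>i\<in>insert k S. u j (c j i) - u j (P i))" if j: "j \<in> A - insert k S" for j
    proof -
      have j': "j \<in> A' - S" using j by (simp add: A'_def)
      have "c j k = Q k" using Suc.prems(7)[OF k, of j] less[of j] j j' by auto
      moreover have "u j (R k) \<le> u j (L k) - u j (P k) + u j (Q k)" "u j (L k) \<le> u j m"
        using *(2) j j' less[of j] Suc.prems(11)[OF k, of j] by auto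
      ultimately show ?thesis using S(3)[OF j'] kS finS by simp
    qed
    moreover have "(\<Sum>j\<in>insert k S. \<eta> (P j)) \<le> \<eta> m"
      using S(2) *(1) Suc.prems(10)[OF k] kS finS by simp
    ultimately show ?thesis
      using S(1) sub k unfolding chain_cond_def by (intro exI[of _ "insert k S"]) auto
  qed
qed

section \<open>Admissible exponents and the interval they form\<close>

text \<open>The reciprocal of the steepness of the level lines of \<open>l\<close>: larger values
  belong to flatter edges, which lie further to the right on a Newton diagram.\<close>

definition slope :: "int \<times> int \<Rightarrow> real" where
  "slope l = real_of_int (snd l) / real_of_int (fst l)"

lemma slope_less_iff:
  assumes "0 < fst l" "0 < fst l'"
  shows "slope l < slope l' \<longleftrightarrow> snd l * fst l' < snd l' * fst l"
proof -
  have "slope l < slope l' \<longleftrightarrow>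
      real_of_int (snd l) * real_of_int (fst l') < real_of_int (snd l') * real_of_int (fst l)"
    using assms by (simp add: slope_def field_simps)
  also have "\<dots> \<longleftrightarrow> snd l * fst l' < snd l' * fst l"
    by (metis of_int_less_iff of_int_mult)
  finally show ?thesis .
qed

lemma slope_le_iff:
  assumes "0 < fst l" "0 < fst l'"
  shows "slope l \<le> slope l' \<longleftrightarrow> snd l * fst l' \<le> snd l' * fst l"
  using slope_less_iff[OF assms(2,1)] by (auto simp: not_less[symmetric] mult.commute)

text \<open>The point where a polynomial with Newton diagram the segment from \<open>(0, b k)\<close> to \<open>(a k, 0)\<close>
  attains its \<open>l j\<close>-minimum, for \<open>j \<noteq> k\<close>.\<close>

definition corner :: "('r \<Rightarrow> int \<times> int) \<Rightarrow> ('r \<Rightarrow> int) \<Rightarrow> ('r \<Rightarrow> int) \<Rightarrow> 'r \<Rightarrow> 'r \<Rightarrow> int \<times> int" where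
  "corner l a b j k = (if slope (l k) < slope (l j) then (a k, 0) else (0, b k))"

text \<open>The edges to the right of \<open>i\<close> lead down to the horizontal axis, so height
  is the limited resource: seen from \<open>i\<close>, factor \<open>k\<close> sits at its upper end
  \<open>(0, b k)\<close> and uses up \<open>b k\<close>. On the left the same happens with widths
  and the lower ends \<open>(a k, 0)\<close>.\<close>

definition right_cond :: "('r \<Rightarrow> int \<times> int) \<Rightarrow> ('r \<Rightarrow> int) \<Rightarrow> ('r \<Rightarrow> int) \<Rightarrow> 'r \<Rightarrow> ('r \<Rightarrow> int) \<Rightarrow> int \<times> int \<Rightarrow> bool" where
  "right_cond l a b i v =
     chain_cond snd (\<lambda>j. wt (l j)) (\<lambda>k. (0, b k)) (corner l a b) v {k. slope (l i) < slope (l k)}"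

definition left_cond :: "('r \<Rightarrow> int \<times> int) \<Rightarrow> ('r \<Rightarrow> int) \<Rightarrow> ('r \<Rightarrow> int) \<Rightarrow> 'r \<Rightarrow> ('r \<Rightarrow> int) \<Rightarrow> int \<times> int \<Rightarrow> bool" where
  "left_cond l a b i v =
     chain_cond fst (\<lambda>j. wt (l j)) (\<lambda>k. (a k, 0)) (corner l a b) v {k. slope (l k) < slope (l i)}"

text \<open>The exponents that occur in the \<open>l i\<close>-initial forms of the germs \<open>g\<close> with \<open>v''\<^sub>j(g) \<ge> v j\<close> for all
  \<open>j \<noteq> i\<close>.\<close>

definition admissible :: "('r \<Rightarrow> int \<times> int) \<Rightarrow> ('r \<Rightarrow> int) \<Rightarrow> ('r \<Rightarrow> int) \<Rightarrow> 'r \<Rightarrow> ('r \<Rightarrow> int) \<Rightarrow> int \<times> int \<Rightarrow> bool" where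
  "admissible l a b i v m \<longleftrightarrow> left_cond l a b i v m \<and> right_cond l a b i v m"

text \<open>On a level line of \<open>l\<close> the first coordinate of the difference
  \<open>(p, q)\<close> can be eliminated. What remains of the \<open>l'\<close>-weight is a
  determinant times \<open>q\<close>, and the sign of the determinant is the order of the
  slopes.\<close>

lemma wt_le_of_slope:
  assumes l: "0 < fst l" "0 < snd l" "0 < fst l'" "0 < snd l'"
    and m: "wt l m = wt l m'" "fst m' \<le> fst m"
  shows "slope l \<le> slope l' \<Longrightarrow> snd m \<le> snd m' \<and> wt l' m \<le> wt l' m'"
    and "slope l' \<le> slope l \<Longrightarrow> wt l' m' \<le> wt l' m"
proof -
  obtain p q where pq: "m = m' + (p, q)" "0 \<le> p"
    using m(2) by (cases m; cases m') (auto intro: that[of "fst m - fst m'" "snd m - snd m'"])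
  have e: "fst l * p + snd l * q = 0" using m(1) by (simp add: pq wt_def algebra_simps)
  have "snd l * q \<le> 0" using e l(1) pq(2) by (smt (verit) mult_nonneg_nonneg)
  hence q: "q \<le> 0" using l(2) by (simp add: mult_le_0_iff)
  have *: "fst l * wt l' (p, q) = (snd l' * fst l - snd l * fst l') * q"
  proof -
    have "fst l * wt l' (p, q) = fst l' * (fst l * p) + fst l * snd l' * q" by (simp add: wt_def algebra_simps)
    also have "fst l * p = - (snd l * q)" using e by simp
    finally show ?thesis by (simp add: algebra_simps)
  qed
  show "snd m \<le> snd m' \<and> wt l' m \<le> wt l' m'" if "slope l \<le> slope l'"
  proof -
    have "0 \<le> snd l' * fst l - snd l * fst l'" using that slope_le_iff[of l l'] l by simp
    hence "fst l * wt l' (p, q) \<le> 0" using * q by (simp add: mult_nonneg_nonpos)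
    hence "wt l' (p, q) \<le> 0" using l(1) by (simp add: mult_le_0_iff)
    thus ?thesis using q by (simp add: pq)
  qed
  show "wt l' m' \<le> wt l' m" if "slope l' \<le> slope l"
  proof -
    have "snd l' * fst l - snd l * fst l' \<le> 0" using that slope_le_iff[of l' l] l by (simp add: mult.commute)
    hence "0 \<le> fst l * wt l' (p, q)" using * q by (simp add: mult_nonpos_nonpos)
    hence "0 \<le> wt l' (p, q)" using l(1) by (simp add: zero_le_mult_iff)
    thus ?thesis by (simp add: pq)
  qed
qed

text \<open>Moving left on the level line of \<open>l i\<close> raises the height and the weights
  for all edges on the right. Together with the mirror statement for the left side this makes the
  admissible exponents of a level line an interval.\<close>

lemma right_cond_mono:
  assumes l: "\<And>j. 0 < fst (l j) \<and> 0 < snd (l j)"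
    and "right_cond l a b i v m" "wt (l i) m = wt (l i) m'" "fst m' \<le> fst m"
  shows "right_cond l a b i v m'"
proof -
  have *: "snd m \<le> snd m' \<and> wt (l j) m \<le> wt (l j) m'" if "slope (l i) \<le> slope (l j)" for j
    using wt_le_of_slope(1)[OF _ _ _ _ assms(3,4) that] l[of i] l[of j] by blast
  show ?thesis using assms(2) unfolding right_cond_def
    by (rule chain_cond_mono) (use * in \<open>auto dest: less_imp_le\<close>)
qed

lemma left_cond_mono:
  assumes l: "\<And>j. 0 < fst (l j) \<and> 0 < snd (l j)"
    and "left_cond l a b i v m" "wt (l i) m = wt (l i) m'" "fst m \<le> fst m'"
  shows "left_cond l a b i v m'"
proof -
  have *: "wt (l j) m \<le> wt (l j) m'" if "slope (l j) \<le> slope (l i)" for j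
    using wt_le_of_slope(2)[OF _ _ _ _ assms(3)[symmetric] assms(4) that] l[of i] l[of j] by blast
  show ?thesis using assms(2) unfolding left_cond_def
    by (rule chain_cond_mono) (use * assms(4) in \<open>auto dest: less_imp_le\<close>)
qed

lemma admissible_between:
  assumes l: "\<And>j. 0 < fst (l j) \<and> 0 < snd (l j)"
    and "admissible l a b i v m" "admissible l a b i v m''"
    and "wt (l i) m = wt (l i) m'" "wt (l i) m'' = wt (l i) m'" "fst m \<le> fst m'" "fst m' \<le> fst m''"
  shows "admissible l a b i v m'"
  using assms unfolding admissible_def by (metis left_cond_mono right_cond_mono)

lemma admissible_nonneg:
  assumes ab: "\<And>k. 0 \<le> a k \<and> 0 \<le> b k" and "admissible l a b i v m"
  shows "0 \<le> fst m \<and> 0 \<le> snd m"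
proof -
  have "0 \<le> fst m"
    using assms unfolding admissible_def left_cond_def chain_cond_def
    by (auto intro: order_trans[OF sum_nonneg])
  moreover have "0 \<le> snd m"
    using assms unfolding admissible_def right_cond_def chain_cond_def
    by (auto intro: order_trans[OF sum_nonneg])
  ultimately show ?thesis ..
qed

lemma fst_sum: "fst (\<Sum>x\<in>A. h x) = (\<Sum>x\<in>A. fst (h x))"
  and snd_sum: "snd (\<Sum>x\<in>A. h x) = (\<Sum>x\<in>A. snd (h x))"
  by (induction A rule: infinite_finite_induct) auto

text \<open>The choices \<open>T\<close> on the left and \<open>U\<close> on the right are merged.
  An edge \<open>j\<close> sees the factors on the opposite side of \<open>i\<close> at the same
  corners as \<open>i\<close> does, so these leave the inequality for \<open>j\<close>
  unchanged.\<close>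

lemma admissibleE:
  fixes l :: "'r::finite \<Rightarrow> int \<times> int"
  assumes inj: "inj (\<lambda>k. slope (l k))" and "admissible l a b i v m"
  obtains S m' where "i \<notin> S" "0 \<le> fst m'" "0 \<le> snd m'" "m = m' + (\<Sum>k\<in>S. corner l a b i k)"
    "\<And>j. j \<noteq> i \<Longrightarrow> j \<notin> S \<Longrightarrow> v j \<le> wt (l j) m' + (\<Sum>k\<in>S. wt (l j) (corner l a b j k))"
proof -
  let ?c = "corner l a b"
  obtain T where T: "T \<subseteq> {k. slope (l k) < slope (l i)}" "(\<Sum>k\<in>T. a k) \<le> fst m"
    "\<And>j. slope (l j) < slope (l i) \<Longrightarrow> j \<notin> T \<Longrightarrow>
       v j \<le> wt (l j) m + (\<Sum>k\<in>T. wt (l j) (?c j k) - wt (l j) (a k, 0))"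
    using assms(2) unfolding admissible_def left_cond_def chain_cond_def by auto
  obtain U where U: "U \<subseteq> {k. slope (l i) < slope (l k)}" "(\<Sum>k\<in>U. b k) \<le> snd m"
    "\<And>j. slope (l i) < slope (l j) \<Longrightarrow> j \<notin> U \<Longrightarrow>
       v j \<le> wt (l j) m + (\<Sum>k\<in>U. wt (l j) (?c j k) - wt (l j) (0, b k))"
    using assms(2) unfolding admissible_def right_cond_def chain_cond_def by auto
  have disj: "T \<inter> U = {}" using T(1) U(1) by fastforce
  have split: "(\<Sum>k\<in>T \<union> U. h k) = (\<Sum>k\<in>T. h k) + (\<Sum>k\<in>U. h k)" for h :: "'r \<Rightarrow> 'b::comm_monoid_add"
    by (rule sum.union_disjoint) (use disj in auto)
  have cT: "?c j k = (a k, 0)" if "k \<in> T" "slope (l i) \<le> slope (l j)" for j k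
    using that T(1) by (fastforce simp: corner_def)
  have cU: "?c j k = (0, b k)" if "k \<in> U" "slope (l j) \<le> slope (l i)" for j k
    using that U(1) by (fastforce simp: corner_def)
  have sT: "(\<Sum>k\<in>T. h (?c j k)) = (\<Sum>k\<in>T. h (a k, 0))" if "slope (l i) \<le> slope (l j)"
    for j and h :: "int \<times> int \<Rightarrow> 'b::comm_monoid_add"
    using cT that by (intro sum.cong) auto
  have sU: "(\<Sum>k\<in>U. h (?c j k)) = (\<Sum>k\<in>U. h (0, b k))" if "slope (l j) \<le> slope (l i)"
    for j and h :: "int \<times> int \<Rightarrow> 'b::comm_monoid_add"
    using cU that by (intro sum.cong) auto
  define m' where "m' = m - (\<Sum>k\<in>T \<union> U. ?c i k)"
  have m': "m = m' + (\<Sum>k\<in>T. (a k, 0)) + (\<Sum>k\<in>U. (0, b k))"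
    using sT[of i "\<lambda>x. x"] sU[of i "\<lambda>x. x"] by (simp add: m'_def split)
  show thesis
  proof (rule that[of "T \<union> U" m'])
    show "i \<notin> T \<union> U" using T(1) U(1) by auto
    show "0 \<le> fst m'" "0 \<le> snd m'"
      using m' T(2) U(2) by (simp_all add: fst_sum snd_sum)
    show "m = m' + (\<Sum>k\<in>T \<union> U. ?c i k)" by (simp add: m'_def)
    fix j assume j: "j \<noteq> i" "j \<notin> T \<union> U"
    have wtm: "wt (l j) m = wt (l j) m' + (\<Sum>k\<in>T. wt (l j) (a k, 0)) + (\<Sum>k\<in>U. wt (l j) (0, b k))"
      by (subst m') (simp add: wt_sum)
    have "slope (l j) \<noteq> slope (l i)" using j(1) injD[OF inj] by metis
    thus "v j \<le> wt (l j) m' + (\<Sum>k\<in>T \<union> U. wt (l j) (?c j k))"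
    proof (cases "slope (l j) < slope (l i)")
      case True
      have "v j \<le> wt (l j) m + (\<Sum>k\<in>T. wt (l j) (?c j k) - wt (l j) (a k, 0))"
        using T(3) True j by simp
      thus ?thesis using sU[of j "wt (l j)"] True by (simp add: wtm split sum_subtractf)
    next
      case False
      hence *: "slope (l i) < slope (l j)" using \<open>slope (l j) \<noteq> slope (l i)\<close> by simp
      have "v j \<le> wt (l j) m + (\<Sum>k\<in>U. wt (l j) (?c j k) - wt (l j) (0, b k))"
        using U(3) * j by simp
      thus ?thesis using sT[of j "wt (l j)"] * by (simp add: wtm split sum_subtractf)
    qed
  qed
qed

text \<open>Edges left of \<open>i\<close> see factor \<open>i\<close> at \<open>(0, b i)\<close>,
  edges right of it at \<open>(a i, 0)\<close>. Each hypothesis thus supplies the condition of one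
  side, and the added point does not change the coordinate measured there.\<close>

lemma admissible_shift:
  fixes l :: "'r::finite \<Rightarrow> int \<times> int"
  assumes "admissible l a b i v (m + (0, b i))" "admissible l a b i v (m + (a i, 0))"
  shows "admissible l a b i (\<lambda>j. v j - wt (l j) (corner l a b j i)) m"
proof -
  have "left_cond l a b i v (m + (0, b i))" "right_cond l a b i v (m + (a i, 0))"
    using assms by (simp_all add: admissible_def)
  thus ?thesis unfolding admissible_def left_cond_def right_cond_def
    by (auto elim!: chain_cond_mono simp: corner_def)
qed

section \<open>Initial forms and the factors of a germ\<close>

lemma int_min_exists:
  fixes h :: "'a \<Rightarrow> int"
  assumes "finite X" "X \<noteq> {}"
  shows "\<exists>m\<in>X. \<forall>k\<in>X. h m \<le> h k"
  using arg_min_if_finite(1)[OF assms, of h] arg_min_least[OF assms, of _ h] by blast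

lemma lex_min_exists:
  fixes X :: "(int \<times> int) set"
  assumes "finite X" "X \<noteq> {}"
  obtains \<alpha> where "\<alpha> \<in> X" "\<And>k. k \<in> X \<Longrightarrow> wt l \<alpha> \<le> wt l k" "\<And>k. k \<in> X \<Longrightarrow> wt l k = wt l \<alpha> \<Longrightarrow> fst \<alpha> \<le> fst k"
proof -
  obtain m where m: "m \<in> X" "\<And>k. k \<in> X \<Longrightarrow> wt l m \<le> wt l k"
    using int_min_exists[OF assms, of "wt l"] by blast
  let ?Y = "{k \<in> X. wt l k = wt l m}"
  have Y: "finite ?Y" "?Y \<noteq> {}" using assms m by auto
  obtain \<alpha> where \<alpha>: "\<alpha> \<in> ?Y" "\<And>k. k \<in> ?Y \<Longrightarrow> fst \<alpha> \<le> fst k"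
    using int_min_exists[OF Y, of fst] by blast
  show thesis using that[of \<alpha>] \<alpha> m by auto
qed

lemma lex_max_exists:
  fixes X :: "(int \<times> int) set"
  assumes "finite X" "X \<noteq> {}"
  obtains \<beta> where "\<beta> \<in> X" "\<And>k. k \<in> X \<Longrightarrow> wt l \<beta> \<le> wt l k" "\<And>k. k \<in> X \<Longrightarrow> wt l k = wt l \<beta> \<Longrightarrow> fst k \<le> fst \<beta>"
proof -
  obtain m where m: "m \<in> X" "\<And>k. k \<in> X \<Longrightarrow> wt l m \<le> wt l k"
    using int_min_exists[OF assms, of "wt l"] by blast
  let ?Y = "{k \<in> X. wt l k = wt l m}"
  have Y: "finite ?Y" "?Y \<noteq> {}" using assms m by auto
  obtain \<beta> where \<beta>: "\<beta> \<in> ?Y" "\<And>k. k \<in> ?Y \<Longrightarrow> - fst \<beta> \<le> - fst k"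
    using int_min_exists[OF Y, of "\<lambda>k. - fst k"] by blast
  show thesis using that[of \<beta>] \<beta> m by auto
qed

lemma face_ends:
  assumes g: "nonneg_supp g" "g k0 \<noteq> 0" and l: "0 < fst l" "0 < snd l"
  obtains L R where "g L \<noteq> 0" "g R \<noteq> 0" "wt l L = wt l R" "\<And>k. g k \<noteq> 0 \<Longrightarrow> wt l L \<le> wt l k"
    "\<And>k. g k \<noteq> 0 \<Longrightarrow> wt l k = wt l L \<Longrightarrow> fst L \<le> fst k \<and> fst k \<le> fst R"
proof -
  \<comment> \<open>Cutting off at the weight of one known exponent leaves a finite set that still
    contains the whole minimal face.\<close>
  let ?X = "{k. g k \<noteq> 0 \<and> wt l k \<le> wt l k0}"
  have "finite ?X"
    by (rule finite_subset[OF _ finite_wt_le[OF l, of 0 "wt l k0"]]) (use nonneg_suppD[OF g(1)] in auto)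
  moreover have "?X \<noteq> {}" using g(2) by auto
  ultimately have X: "finite ?X" "?X \<noteq> {}" .
  obtain L where L: "L \<in> ?X" "\<And>k. k \<in> ?X \<Longrightarrow> wt l L \<le> wt l k"
      "\<And>k. k \<in> ?X \<Longrightarrow> wt l k = wt l L \<Longrightarrow> fst L \<le> fst k"
    by (rule lex_min_exists[OF X, of l]) blast
  obtain R where R: "R \<in> ?X" "\<And>k. k \<in> ?X \<Longrightarrow> wt l R \<le> wt l k"
      "\<And>k. k \<in> ?X \<Longrightarrow> wt l k = wt l R \<Longrightarrow> fst k \<le> fst R"
    by (rule lex_max_exists[OF X, of l]) blast
  have LR: "wt l L = wt l R" using L(2)[OF R(1)] R(2)[OF L(1)] by simp
  show thesis
  proof (rule that[of L R])
    show "wt l L \<le> wt l k" if "g k \<noteq> 0" for k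
      using that L by (cases "wt l k \<le> wt l k0") auto
    show "fst L \<le> fst k \<and> fst k \<le> fst R" if "g k \<noteq> 0" "wt l k = wt l L" for k
      using that L(1,3) R(3) LR by auto
  qed (use L R LR in auto)
qed

section \<open>Monomial initial forms and their products\<close>

text \<open>The \<open>l\<close>-initial form of \<open>p\<close> is a monomial with exponent
  \<open>m\<close>. Multiplication by such a \<open>p\<close> only shifts and rescales initial
  forms.\<close>

definition lead :: "int \<times> int \<Rightarrow> lpoly \<Rightarrow> int \<times> int \<Rightarrow> bool" where
  "lead l p m \<longleftrightarrow> Poly_Mapping.lookup p m \<noteq> 0 \<and> (\<forall>k. Poly_Mapping.lookup p k \<noteq> 0 \<longrightarrow> k \<noteq> m \<longrightarrow> wt l m < wt l k)"

lemma act_lead: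
  assumes "lead l p m" "ord_ge l d g" "wt l k = wt l m + d"
  shows "act p g k = Poly_Mapping.lookup p m * g (k - m)"
proof -
  have "Poly_Mapping.lookup p w * g (k - w) = 0" if "w \<in> Poly_Mapping.keys p - {m}" for w
  proof -
    have "wt l m < wt l w" using that assms(1) by (auto simp: lead_def in_keys_iff)
    hence "g (k - w) = 0" using assms(3) by (intro ord_geD[OF assms(2)]) simp
    thus ?thesis by simp
  qed
  hence "act p g k = (\<Sum>w\<in>{m}. Poly_Mapping.lookup p w * g (k - w))"
    unfolding act_def by (intro sum.mono_neutral_right) (use assms(1) in \<open>auto simp: lead_def in_keys_iff\<close>)
  thus ?thesis by simp
qed

lemma lead_ord_ge: "lead l p m \<Longrightarrow> ord_ge l (wt l m) (Poly_Mapping.lookup p)"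
  unfolding lead_def ord_ge_def by (metis less_irrefl not_less_iff_gr_or_eq)

lemma lead_mult:
  assumes "lead l p m" "lead l q n"
  shows "lead l (p * q) (m + n)"
  unfolding lead_def
proof (intro conjI allI impI)
  note O = lead_ord_ge[OF assms(2)]
  have "Poly_Mapping.lookup (p * q) (m + n) = Poly_Mapping.lookup p m * Poly_Mapping.lookup q n"
    unfolding act_lookup[symmetric] by (subst act_lead[OF assms(1) O]) auto
  thus "Poly_Mapping.lookup (p * q) (m + n) \<noteq> 0" using assms by (simp add: lead_def)
  fix k assume k: "Poly_Mapping.lookup (p * q) k \<noteq> 0" "k \<noteq> m + n"
  have "ord_ge l (wt l m + wt l n) (Poly_Mapping.lookup (p * q))"
    unfolding act_lookup[symmetric] by (rule ord_ge_act[OF lead_ord_ge[OF assms(1)] O])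
  hence "wt l m + wt l n \<le> wt l k" using k(1) by (meson ord_geD not_less)
  moreover have "wt l k \<noteq> wt l m + wt l n"
  proof
    assume e: "wt l k = wt l m + wt l n"
    have "Poly_Mapping.lookup q (k - m) \<noteq> 0"
      using k(1) unfolding act_lookup[symmetric] by (subst (asm) act_lead[OF assms(1) O e]) auto
    moreover have "k - m \<noteq> n" using k(2) by auto
    ultimately have "wt l n < wt l (k - m)" using assms(2) unfolding lead_def by blast
    thus False using e by simp
  qed
  ultimately show "wt l (m + n) < wt l k" by simp
qed

lemma lead_single: "c \<noteq> 0 \<Longrightarrow> lead l (Poly_Mapping.single m c) m"
  by (auto simp: lead_def lookup_single when_def split: if_splits)

lemma lead_prod: "finite S \<Longrightarrow> (\<And>k. k \<in> S \<Longrightarrow> lead l (F k) (n k)) \<Longrightarrow> lead l (\<Prod>k\<in>S. F k) (\<Sum>k\<in>S. n k)"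
proof (induction S rule: finite_induct)
  case empty
  show ?case by (auto simp: lead_def lookup_one when_def)
qed (auto intro!: lead_mult)

lemma ord_ge_mult:
  "ord_ge l d (Poly_Mapping.lookup p) \<Longrightarrow> ord_ge l e (Poly_Mapping.lookup q) \<Longrightarrow> ord_ge l (d + e) (Poly_Mapping.lookup (p * q))"
  unfolding act_lookup[symmetric] by (rule ord_ge_act)

lemma ord_ge_prod:
  "finite S \<Longrightarrow> (\<And>k. k \<in> S \<Longrightarrow> ord_ge l (d k) (Poly_Mapping.lookup (F k))) \<Longrightarrow>
   ord_ge l (\<Sum>k\<in>S. d k) (Poly_Mapping.lookup (\<Prod>k\<in>S. F k))"
proof (induction S rule: finite_induct)
  case empty
  show ?case by (auto simp: ord_ge_def lookup_one when_def)
qed (auto intro!: ord_ge_mult)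

lemma nonneg_supp_mult:
  "nonneg_supp (Poly_Mapping.lookup p) \<Longrightarrow> nonneg_supp (Poly_Mapping.lookup q) \<Longrightarrow> nonneg_supp (Poly_Mapping.lookup (p * q))"
  unfolding act_lookup[symmetric] by (rule nonneg_supp_act)

lemma nonneg_supp_single: "0 \<le> fst m \<Longrightarrow> 0 \<le> snd m \<Longrightarrow> nonneg_supp (Poly_Mapping.lookup (Poly_Mapping.single m c))"
  by (auto simp: nonneg_supp_def lookup_single when_def split: if_splits)

lemma nonneg_supp_prod:
  "finite S \<Longrightarrow> (\<And>k. k \<in> S \<Longrightarrow> nonneg_supp (Poly_Mapping.lookup (F k))) \<Longrightarrow>
   nonneg_supp (Poly_Mapping.lookup (\<Prod>k\<in>S. F k))"
proof (induction S rule: finite_induct)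
  case empty
  show ?case by (auto simp: nonneg_supp_def lookup_one when_def)
qed (auto intro!: nonneg_supp_mult)

lemma in_filt_mult:
  assumes "in_filt l f d (Poly_Mapping.lookup q)" "nonneg_supp (Poly_Mapping.lookup p)" "0 < fst l" "0 < snd l"
  shows "in_filt l f d (Poly_Mapping.lookup (p * q))"
  unfolding act_lookup[symmetric] by (rule in_filt_act[OF assms])

lemma act_bounded:
  assumes "nonneg_supp f"
  obtains c :: nat where "\<And>k. act q f k \<noteq> 0 \<Longrightarrow> - int c \<le> fst k \<and> - int c \<le> snd k"
proof -
  obtain m where m: "(\<lambda>(i, j). Poly_Mapping.lookup q (i - int m, j - int m)) \<in> germs"
    using lookup_laurent_germs[of q] by (auto simp: laurent_germs_def)
  have w: "- int m \<le> fst w \<and> - int m \<le> snd w" if "Poly_Mapping.lookup q w \<noteq> 0" for w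
    using nonneg_suppD[OF nonneg_supp_germs[OF m], of "w + (int m, int m)"] that by (cases w) auto
  have "- int m \<le> fst k \<and> - int m \<le> snd k" if k: "act q f k \<noteq> 0" for k
  proof -
    obtain w where "Poly_Mapping.lookup q w * f (k - w) \<noteq> 0" using k unfolding act_def by (meson sum.neutral)
    thus ?thesis using w[of w] nonneg_suppD[OF assms, of "k - w"] by auto
  qed
  thus thesis by (rule that)
qed

text \<open>The \<open>l i\<close>-minimal face of the Newton diagram of \<open>f\<close> is the segment from \<open>A i\<close> to
  \<open>A i + (a i, - b i)\<close>.\<close>

locale newton_germ =
  fixes l :: "'r::finite \<Rightarrow> int \<times> int" and a b :: "'r \<Rightarrow> int" and f :: lseries and A :: "'r \<Rightarrow> int \<times> int"
  assumes l_pos: "\<And>j. 0 < fst (l j) \<and> 0 < snd (l j)"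
    and ab: "\<And>j. 0 \<le> a j \<and> 0 \<le> b j" "\<And>j. fst (l j) * a j = snd (l j) * b j"
    and slope_inj: "inj (\<lambda>k. slope (l k))"
    and f_germ: "f \<in> germs"
    and A_left: "\<And>i. f (A i) \<noteq> 0" and A_right: "\<And>i. f (A i + (a i, - b i)) \<noteq> 0"
    and A_min: "\<And>i k. f k \<noteq> 0 \<Longrightarrow> wt (l i) (A i) \<le> wt (l i) k"
    and A_face: "\<And>i k. f k \<noteq> 0 \<Longrightarrow> wt (l i) k = wt (l i) (A i) \<Longrightarrow> fst (A i) \<le> fst k \<and> fst k \<le> fst (A i) + a i"
begin

definition top_wt :: "'r \<Rightarrow> int" where
  "top_wt i = wt (l i) (0, b i)"

text \<open>Multiplication by a monomial moves the \<open>l i\<close>-minimal face of \<open>f\<close> to the segment from \<open>(0, b i)\<close>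
  to \<open>(a i, 0)\<close>.\<close>

definition ff :: "'r \<Rightarrow> lseries" where
  "ff i = act (Poly_Mapping.single ((0, b i) - A i) 1) f"

lemma ff_apply: "ff i k = f (k - (0, b i) + A i)"
  by (simp add: ff_def algebra_simps)

lemma wt_right: "wt (l i) (a i, 0) = top_wt i"
  using ab(2)[of i] by (simp add: top_wt_def wt_def)

lemma top_wt_eq: "top_wt i = snd (l i) * b i" "top_wt i = fst (l i) * a i"
  using ab(2)[of i] by (simp_all add: top_wt_def wt_def)

lemma ff_ord_ge: "ord_ge (l i) (top_wt i) (ff i)"
proof -
  have "ff i k = 0" if "wt (l i) k < top_wt i" for k
    using A_min[of "k - (0, b i) + A i" i] that by (auto simp: ff_apply top_wt_def)
  thus ?thesis by (simp add: ord_ge_def)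
qed

lemma ff_left: "ff i (0, b i) \<noteq> 0"
  using A_left[of i] by (simp add: ff_apply)

lemma ff_right: "ff i (a i, 0) \<noteq> 0"
proof -
  have "(a i, 0) - (0, b i) + A i = A i + (a i, - b i)" by (simp add: prod_eq_iff)
  thus ?thesis using A_right[of i] by (simp only: ff_apply) simp
qed

lemma ff_face:
  assumes "ff i k \<noteq> 0" "wt (l i) k = top_wt i"
  shows "0 \<le> fst k" "fst k \<le> a i" "0 \<le> snd k"
proof -
  show x: "0 \<le> fst k" "fst k \<le> a i"
    using A_face[of "k - (0, b i) + A i" i] assms by (auto simp: ff_apply top_wt_def)
  have "fst (l i) * fst k \<le> fst (l i) * a i" using x l_pos[of i] by simp
  hence "0 \<le> snd (l i) * snd k" using assms(2) by (simp add: wt_def top_wt_eq(2))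
  thus "0 \<le> snd k" using l_pos[of i] by (simp add: zero_le_mult_iff)
qed

lemma in_filt_ff: "in_filt (l i) (ff i) d g \<longleftrightarrow> in_filt (l i) f d g"
  unfolding ff_def by (rule in_filt_shift)

section \<open>Multiples of the edge polynomial\<close>

text \<open>Among the products of terms only that of the two leftmost terms on the minimal levels
  has this exponent, so nothing cancels.\<close>

lemma act_ff_left_end:
  assumes "\<alpha> \<in> Poly_Mapping.keys q"
    and "\<And>w. w \<in> Poly_Mapping.keys q \<Longrightarrow> wt (l i) \<alpha> \<le> wt (l i) w"
    and "\<And>w. w \<in> Poly_Mapping.keys q \<Longrightarrow> wt (l i) w = wt (l i) \<alpha> \<Longrightarrow> fst \<alpha> \<le> fst w"
  shows "act q (ff i) (\<alpha> + (0, b i)) \<noteq> 0"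
proof -
  have "Poly_Mapping.lookup q w * ff i (\<alpha> + (0, b i) - w) = 0" if w: "w \<in> Poly_Mapping.keys q - {\<alpha>}" for w
  proof (cases "wt (l i) w = wt (l i) \<alpha>")
    case True
    hence "fst \<alpha> < fst w" using assms(3)[of w] w wt_eq_iff[of "l i" \<alpha> w] l_pos[of i] by fastforce
    hence "ff i (\<alpha> + (0, b i) - w) = 0"
      using ff_face(1)[of i "\<alpha> + (0, b i) - w"] True by (auto simp: top_wt_def)
    thus ?thesis by simp
  next
    case False
    hence "wt (l i) \<alpha> < wt (l i) w" using assms(2)[of w] w by simp
    hence "ff i (\<alpha> + (0, b i) - w) = 0" by (intro ord_geD[OF ff_ord_ge]) (simp add: top_wt_def)
    thus ?thesis by simp
  qed
  hence "act q (ff i) (\<alpha> + (0, b i)) =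
      (\<Sum>w\<in>{\<alpha>}. Poly_Mapping.lookup q w * ff i (\<alpha> + (0, b i) - w))"
    unfolding act_def by (intro sum.mono_neutral_right) (use assms(1) in auto)
  thus ?thesis using assms(1) ff_left[of i] by (simp add: in_keys_iff)
qed

lemma act_ff_right_end:
  assumes "\<beta> \<in> Poly_Mapping.keys q"
    and "\<And>w. w \<in> Poly_Mapping.keys q \<Longrightarrow> wt (l i) \<beta> \<le> wt (l i) w"
    and "\<And>w. w \<in> Poly_Mapping.keys q \<Longrightarrow> wt (l i) w = wt (l i) \<beta> \<Longrightarrow> fst w \<le> fst \<beta>"
  shows "act q (ff i) (\<beta> + (a i, 0)) \<noteq> 0"
proof -
  have "Poly_Mapping.lookup q w * ff i (\<beta> + (a i, 0) - w) = 0" if w: "w \<in> Poly_Mapping.keys q - {\<beta>}" for w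
  proof (cases "wt (l i) w = wt (l i) \<beta>")
    case True
    hence "fst w < fst \<beta>" using assms(3)[of w] w wt_eq_iff[of "l i" \<beta> w] l_pos[of i] by fastforce
    hence "ff i (\<beta> + (a i, 0) - w) = 0"
      using ff_face(2)[of i "\<beta> + (a i, 0) - w"] True wt_right[of i] by auto
    thus ?thesis by simp
  next
    case False
    hence "wt (l i) \<beta> < wt (l i) w" using assms(2)[of w] w by simp
    hence "ff i (\<beta> + (a i, 0) - w) = 0" by (intro ord_geD[OF ff_ord_ge]) (simp add: wt_right)
    thus ?thesis by simp
  qed
  hence "act q (ff i) (\<beta> + (a i, 0)) =
      (\<Sum>w\<in>{\<beta>}. Poly_Mapping.lookup q w * ff i (\<beta> + (a i, 0) - w))"
    unfolding act_def by (intro sum.mono_neutral_right) (use assms(1) in auto)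
  thus ?thesis using assms(1) ff_right[of i] by (simp add: in_keys_iff)
qed

text \<open>The lowest terms of a multiplier \<open>p\<close> that lifts \<open>g\<close> to order
  \<open>d\<close> cannot lie below level \<open>e - top_wt i\<close>: their product with the edge
  polynomial has a nonzero left end, where \<open>g\<close> vanishes. Hence on level
  \<open>e\<close> only the terms of \<open>p\<close> of weight exactly \<open>e - top_wt i\<close>
  act, and these form the quotient up to sign.\<close>

lemma face_divisible:
  assumes g: "in_filt (l i) f d g" "ord_ge (l i) e g" "e < d"
  obtains q where "\<And>w. w \<in> Poly_Mapping.keys q \<Longrightarrow> wt (l i) w = e - top_wt i"
    "\<And>k. wt (l i) k = e \<Longrightarrow> g k = act q (ff i) k"
proof -
  obtain p where p: "ord_ge (l i) d (\<lambda>k. g k + act p (ff i) k)"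
    using in_filt_ff[of i d g] g(1) unfolding in_filt_def by auto
  have ge: "e - top_wt i \<le> wt (l i) w" if w: "w \<in> Poly_Mapping.keys p" for w
  proof -
    have "finite (Poly_Mapping.keys p)" "Poly_Mapping.keys p \<noteq> {}" using w by auto
    then obtain \<alpha> where \<alpha>: "\<alpha> \<in> Poly_Mapping.keys p" "\<And>w. w \<in> Poly_Mapping.keys p \<Longrightarrow> wt (l i) \<alpha> \<le> wt (l i) w"
      "\<And>w. w \<in> Poly_Mapping.keys p \<Longrightarrow> wt (l i) w = wt (l i) \<alpha> \<Longrightarrow> fst \<alpha> \<le> fst w"
      by (rule lex_min_exists[of _ "l i"]) blast
    have nz: "act p (ff i) (\<alpha> + (0, b i)) \<noteq> 0" by (rule act_ff_left_end[OF \<alpha>])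
    have "\<not> wt (l i) (\<alpha> + (0, b i)) < e"
    proof
      assume *: "wt (l i) (\<alpha> + (0, b i)) < e"
      have "g (\<alpha> + (0, b i)) = 0" by (rule ord_geD[OF g(2) *])
      moreover have "g (\<alpha> + (0, b i)) + act p (ff i) (\<alpha> + (0, b i)) = 0"
        using ord_geD[OF p] * g(3) by simp
      ultimately show False using nz by simp
    qed
    hence "e - top_wt i \<le> wt (l i) \<alpha>" by (simp add: top_wt_def)
    thus ?thesis using \<alpha>(2)[OF w] by simp
  qed
  define X where "X = {w \<in> Poly_Mapping.keys p. wt (l i) w = e - top_wt i}"
  define q where "q = restrict_series X (\<lambda>w. - Poly_Mapping.lookup p w)"
  have X: "finite X" by (simp add: X_def)
  have q: "Poly_Mapping.lookup q w = (if w \<in> X then - Poly_Mapping.lookup p w else 0)" for w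
    using X by (simp add: q_def lookup_restrict_series)
  show thesis
  proof (rule that[of q])
    show "wt (l i) w = e - top_wt i" if "w \<in> Poly_Mapping.keys q" for w
      using that by (auto simp: in_keys_iff q X_def split: if_splits)
    fix k assume k: "wt (l i) k = e"
    have "act p (ff i) k = (\<Sum>w\<in>X. Poly_Mapping.lookup p w * ff i (k - w))"
      unfolding act_def
    proof (rule sum.mono_neutral_right)
      show "\<forall>w\<in>Poly_Mapping.keys p - X. Poly_Mapping.lookup p w * ff i (k - w) = 0"
      proof
        fix w assume w: "w \<in> Poly_Mapping.keys p - X"
        hence "e - top_wt i < wt (l i) w" using ge[of w] by (auto simp: X_def)
        hence "ff i (k - w) = 0" using k by (intro ord_geD[OF ff_ord_ge]) simp
        thus "Poly_Mapping.lookup p w * ff i (k - w) = 0" by simp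
      qed
    qed (auto simp: X_def)
    also have "\<dots> = - act q (ff i) k"
      by (subst act_superset[OF X]) (auto simp: q sum_negf in_keys_iff split: if_splits)
    finally show "g k = act q (ff i) k" using ord_geD[OF p, of k] k g(3) by simp
  qed
qed

lemma act_ff_ends:
  assumes q: "\<And>w. w \<in> Poly_Mapping.keys q \<Longrightarrow> wt (l i) w = e" and "w \<in> Poly_Mapping.keys q"
  obtains \<alpha> \<beta> where "wt (l i) \<alpha> = e" "wt (l i) \<beta> = e" "fst \<alpha> \<le> fst w" "fst w \<le> fst \<beta>"
    "act q (ff i) (\<alpha> + (0, b i)) \<noteq> 0" "act q (ff i) (\<beta> + (a i, 0)) \<noteq> 0"
proof -
  have ne: "finite (Poly_Mapping.keys q)" "Poly_Mapping.keys q \<noteq> {}" using assms(2) by auto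
  obtain \<alpha> where \<alpha>: "\<alpha> \<in> Poly_Mapping.keys q" "\<And>w. w \<in> Poly_Mapping.keys q \<Longrightarrow> wt (l i) \<alpha> \<le> wt (l i) w"
      "\<And>w. w \<in> Poly_Mapping.keys q \<Longrightarrow> wt (l i) w = wt (l i) \<alpha> \<Longrightarrow> fst \<alpha> \<le> fst w"
    by (rule lex_min_exists[OF ne, of "l i"]) blast
  obtain \<beta> where \<beta>: "\<beta> \<in> Poly_Mapping.keys q" "\<And>w. w \<in> Poly_Mapping.keys q \<Longrightarrow> wt (l i) \<beta> \<le> wt (l i) w"
      "\<And>w. w \<in> Poly_Mapping.keys q \<Longrightarrow> wt (l i) w = wt (l i) \<beta> \<Longrightarrow> fst w \<le> fst \<beta>"
    by (rule lex_max_exists[OF ne, of "l i"]) blast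
  show thesis
    using that[of \<alpha> \<beta>] q \<alpha>(1) \<beta>(1) \<alpha>(3)[OF assms(2)] \<beta>(3)[OF assms(2)] assms(2)
      act_ff_left_end[OF \<alpha>] act_ff_right_end[OF \<beta>] by simp
qed


section \<open>Removing negative exponents on a level line\<close>

text \<open>A term with negative first exponent on a level \<open>V \<ge> top_wt i\<close> has
  height at least \<open>b i\<close>. The multiple of the edge polynomial that cancels it, with its
  left end on this term, therefore adds only terms further right and of nonnegative height. Negative
  heights already present in \<open>E\<close> may survive; the last conjunct says that no new ones
  appear.\<close>

lemma kill_left:
  assumes V: "top_wt i \<le> V" and E: "\<And>k. wt (l i) k = V \<Longrightarrow> E k \<noteq> 0 \<Longrightarrow> - int n \<le> fst k"
  shows "\<exists>q. (\<forall>w\<in>Poly_Mapping.keys q. wt (l i) w = V - top_wt i) \<and>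
    (\<forall>k. wt (l i) k = V \<longrightarrow> E k + act q (ff i) k \<noteq> 0 \<longrightarrow> 0 \<le> fst k \<and> (E k \<noteq> 0 \<or> 0 \<le> snd k))"
  using E
proof (induction n arbitrary: E)
  case 0
  thus ?case by (intro exI[of _ 0]) auto
next
  case (Suc n)
  show ?case
  proof (cases "\<exists>m. wt (l i) m = V \<and> fst m = - int (Suc n) \<and> E m \<noteq> 0")
    case False
    have "- int n \<le> fst k" if "wt (l i) k = V" "E k \<noteq> 0" for k
      using Suc.prems[OF that] False that by (cases "fst k = - int (Suc n)") auto
    thus ?thesis by (rule Suc.IH)
  next
    case True
    then obtain m where m: "wt (l i) m = V" "fst m = - int (Suc n)" "E m \<noteq> 0" by blast
    define p where "p = Poly_Mapping.single (m - (0, b i)) (- E m / ff i (0, b i))"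
    have p: "act p (ff i) k = - E m / ff i (0, b i) * ff i (k - m + (0, b i))" for k
      by (simp add: p_def algebra_simps)
    have pm: "E m + act p (ff i) m = 0" using ff_left[of i] by (simp add: p)
    have "snd (l i) * b i \<le> snd (l i) * snd m"
    proof -
      have "0 \<le> fst (l i) * - fst m" using l_pos[of i] m(2) by (intro mult_nonneg_nonneg) auto
      thus ?thesis using V m(1) by (simp add: top_wt_eq(1) wt_def)
    qed
    hence bm: "b i \<le> snd m" using l_pos[of i] by simp
    have pk: "fst m \<le> fst k" "0 \<le> snd k" if "wt (l i) k = V" "act p (ff i) k \<noteq> 0" for k
    proof -
      have "ff i (k - m + (0, b i)) \<noteq> 0" using that(2) by (auto simp: p)
      moreover have "wt (l i) (k - m + (0, b i)) = top_wt i" using that(1) m(1) by (simp add: top_wt_def)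
      ultimately show "fst m \<le> fst k" "0 \<le> snd k"
        using ff_face(1,3)[of i "k - m + (0, b i)"] bm by auto
    qed
    let ?E = "\<lambda>k. E k + act p (ff i) k"
    have "- int n \<le> fst k" if k: "wt (l i) k = V" "?E k \<noteq> 0" for k
    proof -
      have "fst m \<le> fst k"
        using pk(1)[OF k(1)] Suc.prems[OF k(1)] k(2) m(2) by (cases "act p (ff i) k = 0") auto
      moreover have "fst k \<noteq> fst m"
        using wt_eq_iff[of "l i" k m] l_pos[of i] k m(1) pm by auto
      ultimately show ?thesis using m(2) by simp
    qed
    then obtain q where q: "\<forall>w\<in>Poly_Mapping.keys q. wt (l i) w = V - top_wt i"
      "\<forall>k. wt (l i) k = V \<longrightarrow> ?E k + act q (ff i) k \<noteq> 0 \<longrightarrow> 0 \<le> fst k \<and> (?E k \<noteq> 0 \<or> 0 \<le> snd k)"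
      using Suc.IH[of ?E] by blast
    have "\<forall>w\<in>Poly_Mapping.keys (p + q). wt (l i) w = V - top_wt i"
    proof
      fix w assume "w \<in> Poly_Mapping.keys (p + q)"
      hence "w \<in> Poly_Mapping.keys p \<or> w \<in> Poly_Mapping.keys q" using Poly_Mapping.keys_add[of p q] by auto
      thus "wt (l i) w = V - top_wt i"
        using q(1) m(1) by (auto simp: p_def top_wt_def split: if_splits)
    qed
    moreover have "0 \<le> fst k \<and> (E k \<noteq> 0 \<or> 0 \<le> snd k)"
      if k: "wt (l i) k = V" "E k + act (p + q) (ff i) k \<noteq> 0" for k
    proof -
      have "?E k + act q (ff i) k \<noteq> 0" using k(2) by (simp add: act_add add.assoc)
      hence *: "0 \<le> fst k \<and> (?E k \<noteq> 0 \<or> 0 \<le> snd k)" using q(2) k(1) by blast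
      thus ?thesis using pk(2)[OF k(1)] by (cases "act p (ff i) k = 0") auto
    qed
    ultimately show ?thesis by blast
  qed
qed

text \<open>The mirror image, started after the left side is clean: the right end
  \<open>(a i, 0)\<close> is placed on the term to be cancelled, and first exponents stay
  nonnegative because that term has width at least \<open>a i\<close>.\<close>

lemma kill_right:
  assumes V: "top_wt i \<le> V" and E: "\<And>k. wt (l i) k = V \<Longrightarrow> E k \<noteq> 0 \<Longrightarrow> 0 \<le> fst k \<and> - int n \<le> snd k"
  shows "\<exists>q. (\<forall>w\<in>Poly_Mapping.keys q. wt (l i) w = V - top_wt i) \<and>
    (\<forall>k. wt (l i) k = V \<longrightarrow> E k + act q (ff i) k \<noteq> 0 \<longrightarrow> 0 \<le> fst k \<and> 0 \<le> snd k)"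
  using E
proof (induction n arbitrary: E)
  case 0
  thus ?case by (intro exI[of _ 0]) auto
next
  case (Suc n)
  show ?case
  proof (cases "\<exists>m. wt (l i) m = V \<and> snd m = - int (Suc n) \<and> E m \<noteq> 0")
    case False
    have "0 \<le> fst k \<and> - int n \<le> snd k" if "wt (l i) k = V" "E k \<noteq> 0" for k
      using Suc.prems[OF that] False that by (cases "snd k = - int (Suc n)") auto
    thus ?thesis by (rule Suc.IH)
  next
    case True
    then obtain m where m: "wt (l i) m = V" "snd m = - int (Suc n)" "E m \<noteq> 0" by blast
    define p where "p = Poly_Mapping.single (m - (a i, 0)) (- E m / ff i (a i, 0))"
    have p: "act p (ff i) k = - E m / ff i (a i, 0) * ff i (k - m + (a i, 0))" for k
      by (simp add: p_def algebra_simps)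
    have pm: "E m + act p (ff i) m = 0" using ff_right[of i] by (simp add: p)
    have "fst (l i) * a i \<le> fst (l i) * fst m"
    proof -
      have "0 \<le> snd (l i) * - snd m" using l_pos[of i] m(2) by (intro mult_nonneg_nonneg) auto
      thus ?thesis using V m(1) by (simp add: top_wt_eq(2) wt_def)
    qed
    hence am: "a i \<le> fst m" using l_pos[of i] by simp
    have pk: "snd m \<le> snd k" "0 \<le> fst k" if "wt (l i) k = V" "act p (ff i) k \<noteq> 0" for k
    proof -
      have "ff i (k - m + (a i, 0)) \<noteq> 0" using that(2) by (auto simp: p)
      moreover have "wt (l i) (k - m + (a i, 0)) = top_wt i" using that(1) m(1) wt_right[of i] by simp
      ultimately show "snd m \<le> snd k" "0 \<le> fst k"
        using ff_face(1,3)[of i "k - m + (a i, 0)"] am by auto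
    qed
    let ?E = "\<lambda>k. E k + act p (ff i) k"
    have "0 \<le> fst k \<and> - int n \<le> snd k" if k: "wt (l i) k = V" "?E k \<noteq> 0" for k
    proof -
      have *: "0 \<le> fst k \<and> snd m \<le> snd k"
        using pk[OF k(1)] Suc.prems[OF k(1)] k(2) m(2) by (cases "act p (ff i) k = 0") auto
      moreover have "snd k \<noteq> snd m"
      proof
        assume "snd k = snd m"
        hence "k = m" using k(1) m(1) l_pos[of i] by (auto simp: wt_def prod_eq_iff)
        thus False using k(2) pm by simp
      qed
      ultimately show ?thesis using m(2) by simp
    qed
    then obtain q where q: "\<forall>w\<in>Poly_Mapping.keys q. wt (l i) w = V - top_wt i"
      "\<forall>k. wt (l i) k = V \<longrightarrow> ?E k + act q (ff i) k \<noteq> 0 \<longrightarrow> 0 \<le> fst k \<and> 0 \<le> snd k"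
      using Suc.IH[of ?E] by blast
    have "\<forall>w\<in>Poly_Mapping.keys (p + q). wt (l i) w = V - top_wt i"
    proof
      fix w assume "w \<in> Poly_Mapping.keys (p + q)"
      hence "w \<in> Poly_Mapping.keys p \<or> w \<in> Poly_Mapping.keys q" using Poly_Mapping.keys_add[of p q] by auto
      thus "wt (l i) w = V - top_wt i"
        using q(1) m(1) wt_right[of i] by (auto simp: p_def split: if_splits)
    qed
    moreover have "0 \<le> fst k \<and> 0 \<le> snd k"
      if k: "wt (l i) k = V" "E k + act (p + q) (ff i) k \<noteq> 0" for k
    proof -
      have "?E k + act q (ff i) k \<noteq> 0" using k(2) by (simp add: act_add add.assoc)
      thus ?thesis using q(2) k(1) by blast
    qed
    ultimately show ?thesis by blast
  qed
qed

lemma kill_negative: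
  assumes V: "top_wt i \<le> V" and E: "\<And>k. E k \<noteq> 0 \<Longrightarrow> - int n \<le> fst k \<and> - int n \<le> snd k"
  obtains q where "\<And>w. w \<in> Poly_Mapping.keys q \<Longrightarrow> wt (l i) w = V - top_wt i"
    "\<And>k. wt (l i) k = V \<Longrightarrow> E k + act q (ff i) k \<noteq> 0 \<Longrightarrow> 0 \<le> fst k \<and> 0 \<le> snd k"
proof -
  have "- int n \<le> fst k" if "wt (l i) k = V" "E k \<noteq> 0" for k using E[OF that(2)] by simp
  from kill_left[where E = E, OF V this] obtain p where
    p: "\<forall>w\<in>Poly_Mapping.keys p. wt (l i) w = V - top_wt i"
      "\<forall>k. wt (l i) k = V \<longrightarrow> E k + act p (ff i) k \<noteq> 0 \<longrightarrow> 0 \<le> fst k \<and> (E k \<noteq> 0 \<or> 0 \<le> snd k)"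
    by blast
  have "0 \<le> fst k \<and> - int n \<le> snd k" if "wt (l i) k = V" "E k + act p (ff i) k \<noteq> 0" for k
    using p(2) that E[of k] by fastforce
  from kill_right[where E = "\<lambda>k. E k + act p (ff i) k", OF V this] obtain q where
    q: "\<forall>w\<in>Poly_Mapping.keys q. wt (l i) w = V - top_wt i"
      "\<forall>k. wt (l i) k = V \<longrightarrow> E k + act p (ff i) k + act q (ff i) k \<noteq> 0 \<longrightarrow> 0 \<le> fst k \<and> 0 \<le> snd k"
    by blast
  show thesis
  proof (rule that[of "p + q"])
    show "wt (l i) w = V - top_wt i" if "w \<in> Poly_Mapping.keys (p + q)" for w
      using that p(1) q(1) Poly_Mapping.keys_add[of p q] by auto
    show "0 \<le> fst k \<and> 0 \<le> snd k" if "wt (l i) k = V" "E k + act (p + q) (ff i) k \<noteq> 0" for k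
      using that q(2) by (simp add: act_add add.assoc)
  qed
qed

text \<open>A polynomial approximation of the factor of \<open>f\<close> that belongs to the edge \<open>i\<close>, obtained from
  \<open>ff i\<close> by killing the terms with negative exponents degree by degree.\<close>

lemma factor_exists:
  "\<exists>F. nonneg_supp (Poly_Mapping.lookup F) \<and> ord_ge (l i) (top_wt i) (Poly_Mapping.lookup F) \<and>
     (\<forall>k. wt (l i) k = top_wt i \<longrightarrow> Poly_Mapping.lookup F k = ff i k) \<and> in_filt (l i) f V (Poly_Mapping.lookup F)"
proof -
  have l: "0 < fst (l i)" "0 < snd (l i)" using l_pos[of i] by auto
  let ?M = "top_wt i"
  \<comment> \<open>The offset 1 keeps level \<open>?M\<close> out of all corrections, since
    \<open>F\<close> must agree with \<open>ff i\<close> there.\<close>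
  have "\<exists>F q. nonneg_supp (Poly_Mapping.lookup F) \<and> ord_ge (l i) ?M (Poly_Mapping.lookup F) \<and>
     (\<forall>k. wt (l i) k = ?M \<longrightarrow> Poly_Mapping.lookup F k = ff i k) \<and>
     ord_ge (l i) (?M + 1 + int n) (\<lambda>k. Poly_Mapping.lookup F k + act q (ff i) k)" for n
  proof (induction n)
    case 0
    define X where "X = {k. 0 \<le> fst k \<and> 0 \<le> snd k \<and> wt (l i) k \<le> ?M}"
    have X: "finite X" unfolding X_def by (rule finite_wt_le[OF l])
    define F where "F = restrict_series X (ff i)"
    have F: "Poly_Mapping.lookup F k = (if k \<in> X then ff i k else 0)" for k
      using X by (simp add: F_def lookup_restrict_series)
    have low: "ff i k = 0" if "wt (l i) k < ?M" for k using ff_ord_ge that by (rule ord_geD)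
    have eq: "Poly_Mapping.lookup F k = ff i k" if "wt (l i) k \<le> ?M" for k
    proof (cases "wt (l i) k = ?M \<and> ff i k \<noteq> 0")
      case True
      hence "k \<in> X" using ff_face[of i k] by (simp add: X_def)
      thus ?thesis by (simp add: F)
    next
      case False
      thus ?thesis using low[of k] that by (auto simp: F)
    qed
    have "ord_ge (l i) (?M + 1 + int 0) (\<lambda>k. Poly_Mapping.lookup F k + act (Poly_Mapping.single 0 (- 1)) (ff i) k)"
      using eq by (auto simp: ord_ge_def)
    moreover have "nonneg_supp (Poly_Mapping.lookup F)" by (auto simp: nonneg_supp_def F X_def)
    moreover have "ord_ge (l i) ?M (Poly_Mapping.lookup F)" using low by (auto simp: ord_ge_def F)
    ultimately show ?case using eq by (intro exI[of _ F] exI[of _ "Poly_Mapping.single 0 (- 1)"]) auto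
  next
    case (Suc n)
    define V where "V = ?M + 1 + int n"
    obtain F q where F: "nonneg_supp (Poly_Mapping.lookup F)" "ord_ge (l i) ?M (Poly_Mapping.lookup F)"
      "\<And>k. wt (l i) k = ?M \<Longrightarrow> Poly_Mapping.lookup F k = ff i k"
      and q: "ord_ge (l i) V (\<lambda>k. Poly_Mapping.lookup F k + act q (ff i) k)"
      using Suc.IH unfolding V_def by blast
    define E where "E k = Poly_Mapping.lookup F k + act q (ff i) k" for k
    obtain c where c: "\<And>k. act (q * Poly_Mapping.single ((0, b i) - A i) 1) f k \<noteq> 0 \<Longrightarrow> - int c \<le> fst k \<and> - int c \<le> snd k"
      using act_bounded[OF nonneg_supp_germs[OF f_germ]] by blast
    have "- int c \<le> fst k \<and> - int c \<le> snd k" if "E k \<noteq> 0" for k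
    proof (cases "Poly_Mapping.lookup F k = 0")
      case True
      thus ?thesis using that c[of k] by (simp add: E_def act_mult ff_def)
    next
      case False
      thus ?thesis using nonneg_suppD[OF F(1)] by fastforce
    qed
    moreover have "?M \<le> V" by (simp add: V_def)
    ultimately obtain p where p: "\<And>w. w \<in> Poly_Mapping.keys p \<Longrightarrow> wt (l i) w = V - ?M"
      "\<And>k. wt (l i) k = V \<Longrightarrow> E k + act p (ff i) k \<noteq> 0 \<Longrightarrow> 0 \<le> fst k \<and> 0 \<le> snd k"
      using kill_negative[of i V E c] by blast
    define Y where "Y = {k. 0 \<le> fst k \<and> 0 \<le> snd k \<and> wt (l i) k = V}"
    have Y: "finite Y" unfolding Y_def by (rule finite_subset[OF _ finite_wt_le[OF l, of 0 V]]) auto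
    \<comment> \<open>On level \<open>V\<close> the error now has only nonnegative exponents, so it
      may be subtracted from \<open>F\<close> itself instead of being cancelled by the
      multiplier.\<close>
    define F' where "F' = F - restrict_series Y (\<lambda>k. E k + act p (ff i) k)"
    have F': "Poly_Mapping.lookup F' k = Poly_Mapping.lookup F k - (if k \<in> Y then E k + act p (ff i) k else 0)" for k
      using Y by (simp add: F'_def lookup_minus lookup_restrict_series)
    have "ord_ge (l i) (V - ?M) (Poly_Mapping.lookup p)"
      using p(1) unfolding ord_ge_def by (metis in_keys_iff less_irrefl)
    from ord_ge_act[OF this ff_ord_ge] have ap: "ord_ge (l i) V (act p (ff i))" by simp
    have "Poly_Mapping.lookup F' k + act (q + p) (ff i) k = 0" if k: "wt (l i) k < V + 1" for k
    proof (cases "wt (l i) k = V")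
      case True
      thus ?thesis using p(2)[OF True] by (auto simp: F' E_def act_add Y_def add.assoc)
    next
      case False
      hence k': "wt (l i) k < V" using k by simp
      thus ?thesis using ord_geD[OF q k'] ord_geD[OF ap k'] by (auto simp: F' act_add Y_def)
    qed
    hence "ord_ge (l i) (?M + 1 + int (Suc n)) (\<lambda>k. Poly_Mapping.lookup F' k + act (q + p) (ff i) k)"
      by (simp add: ord_ge_def V_def)
    moreover have "nonneg_supp (Poly_Mapping.lookup F')"
      using nonneg_suppD[OF F(1)] by (auto simp: nonneg_supp_def F' Y_def split: if_splits)
    moreover have "ord_ge (l i) ?M (Poly_Mapping.lookup F')"
      using ord_geD[OF F(2)] by (auto simp: ord_ge_def F' Y_def V_def)
    moreover have "Poly_Mapping.lookup F' k = ff i k" if "wt (l i) k = ?M" for k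
      using F(3)[OF that] that by (auto simp: F' Y_def V_def)
    ultimately show ?case by blast
  qed
  from this[of "nat (V - ?M)"] obtain F q where F: "nonneg_supp (Poly_Mapping.lookup F)" "ord_ge (l i) ?M (Poly_Mapping.lookup F)"
      "\<forall>k. wt (l i) k = ?M \<longrightarrow> Poly_Mapping.lookup F k = ff i k"
      and q: "ord_ge (l i) (?M + 1 + int (nat (V - ?M))) (\<lambda>k. Poly_Mapping.lookup F k + act q (ff i) k)"
    by blast
  have "ord_ge (l i) V (\<lambda>k. Poly_Mapping.lookup F k + act q (ff i) k)"
    by (rule ord_ge_mono[OF q]) linarith
  hence "in_filt (l i) f V (Poly_Mapping.lookup F)" unfolding in_filt_ff[symmetric, of i V] unfolding in_filt_def by blast
  thus ?thesis using F by blast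
qed

end

section \<open>Faces of the Newton polygon of a germ\<close>

text \<open>Think of \<open>x\<close> and \<open>y\<close> as points on the faces of a steeper and a
  flatter edge. Up to a positive factor, a form at least as flat as \<open>l'\<close> is
  \<open>l'\<close> plus a nonnegative multiple of the second coordinate; a form at least as steep
  as \<open>l\<close> is \<open>l\<close> minus such a multiple.\<close>

lemma cross_points:
  assumes l: "0 < fst l" "0 < snd l" "0 < fst l'" "0 < snd l'" and s: "slope l < slope l'"
    and xy: "wt l x \<le> wt l y" "wt l' y \<le> wt l' x"
  shows "snd y \<le> snd x" "fst x \<le> fst y"
    and "\<And>l''. 0 < fst l'' \<Longrightarrow> slope l' \<le> slope l'' \<Longrightarrow> wt l'' y \<le> wt l'' x"
    and "\<And>l''. 0 < fst l'' \<Longrightarrow> slope l'' \<le> slope l \<Longrightarrow> wt l'' x \<le> wt l'' y"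
proof -
  define p where "p = fst x - fst y"
  define q where "q = snd x - snd y"
  have pq: "x = y + (p, q)" by (simp add: p_def q_def prod_eq_iff)
  have 1: "fst l * p + snd l * q \<le> 0" using xy(1) by (simp add: pq wt_def algebra_simps)
  have 2: "0 \<le> fst l' * p + snd l' * q" using xy(2) by (simp add: pq wt_def algebra_simps)
  have D: "0 < snd l' * fst l - snd l * fst l'" using s slope_less_iff[of l l'] l by simp
  have "fst l' * (fst l * p + snd l * q) \<le> 0" using 1 l by (intro mult_nonneg_nonpos) auto
  also have "0 \<le> fst l * (fst l' * p + snd l' * q)" using 2 l by (intro mult_nonneg_nonneg) auto
  finally have "0 \<le> (snd l' * fst l - snd l * fst l') * q" by (simp add: algebra_simps)
  hence q: "0 \<le> q" using D by (simp add: zero_le_mult_iff)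
  have "0 \<le> snd l * q" using l q by simp
  hence "fst l * p \<le> 0" using 1 by simp
  hence p: "p \<le> 0" using l by (simp add: mult_le_0_iff)
  show "snd y \<le> snd x" "fst x \<le> fst y" using p q by (simp_all add: pq)
  show "wt l'' y \<le> wt l'' x" if l'': "0 < fst l''" "slope l' \<le> slope l''" for l''
  proof -
    have "0 \<le> (snd l'' * fst l' - snd l' * fst l'') * q"
      using slope_le_iff[of l' l''] l l'' q by (intro mult_nonneg_nonneg) auto
    also have "\<dots> \<le> (snd l'' * fst l' - snd l' * fst l'') * q + fst l'' * (fst l' * p + snd l' * q)"
      using 2 l'' by simp
    also have "\<dots> = fst l' * wt l'' (p, q)" by (simp add: wt_def algebra_simps)
    finally have "0 \<le> wt l'' (p, q)" using l by (simp add: zero_le_mult_iff)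
    thus ?thesis by (simp add: pq)
  qed
  show "wt l'' x \<le> wt l'' y" if l'': "0 < fst l''" "slope l'' \<le> slope l" for l''
  proof -
    have "fst l * wt l'' (p, q) = (snd l'' * fst l - snd l * fst l'') * q + fst l'' * (fst l * p + snd l * q)"
      by (simp add: wt_def algebra_simps)
    also have "\<dots> \<le> 0 + 0"
      using slope_le_iff[of l'' l] l l'' q 1 by (intro add_mono mult_nonpos_nonneg mult_nonneg_nonpos) auto
    finally have "wt l'' (p, q) \<le> 0" using l by (simp add: mult_le_0_iff)
    thus ?thesis by (simp add: pq)
  qed
qed

context newton_germ
begin

text \<open>Below level \<open>d\<close> the initial form of \<open>g\<close> is a multiple of the
  edge polynomial, and the extreme exponents of a product are the sums of the extreme
  exponents.\<close>

lemma face_width: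
  assumes g: "in_filt (l i) f d g" "g L \<noteq> 0" "wt (l i) L < d"
    and L: "\<And>k. g k \<noteq> 0 \<Longrightarrow> wt (l i) L \<le> wt (l i) k"
    and LR: "\<And>k. g k \<noteq> 0 \<Longrightarrow> wt (l i) k = wt (l i) L \<Longrightarrow> fst L \<le> fst k \<and> fst k \<le> fst R"
  shows "fst L + a i \<le> fst R"
proof -
  have "ord_ge (l i) (wt (l i) L) g" using L by (force simp: ord_ge_def)
  then obtain q where q: "\<And>w. w \<in> Poly_Mapping.keys q \<Longrightarrow> wt (l i) w = wt (l i) L - top_wt i"
    "\<And>k. wt (l i) k = wt (l i) L \<Longrightarrow> g k = act q (ff i) k"
    using face_divisible[OF g(1) _ g(3)] by blast
  have "q \<noteq> 0" using q(2)[of L] g(2) by auto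
  then obtain w where w: "w \<in> Poly_Mapping.keys q" by (metis all_not_in_conv keys_eq_empty)
  obtain \<alpha> \<beta> where ab: "wt (l i) \<alpha> = wt (l i) L - top_wt i" "wt (l i) \<beta> = wt (l i) L - top_wt i"
    "fst \<alpha> \<le> fst w" "fst w \<le> fst \<beta>"
    "act q (ff i) (\<alpha> + (0, b i)) \<noteq> 0" "act q (ff i) (\<beta> + (a i, 0)) \<noteq> 0"
    using act_ff_ends[OF q(1) w] by blast
  have "wt (l i) (\<alpha> + (0, b i)) = wt (l i) L" "wt (l i) (\<beta> + (a i, 0)) = wt (l i) L"
    using ab(1,2) wt_right[of i] by (simp_all add: top_wt_def)
  hence "fst L \<le> fst \<alpha>" "fst \<beta> + a i \<le> fst R"
    using LR[of "\<alpha> + (0, b i)"] LR[of "\<beta> + (a i, 0)"] q(2) ab(5,6) by auto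
  thus ?thesis using ab(3,4) by simp
qed

text \<open>This bounds the initial exponents from above; \<open>admissible_element\<close> shows
  that all admissible ones occur. For each edge \<open>k\<close>, either the \<open>k\<close>-th
  face of \<open>g\<close> lies on a level of at least \<open>v k\<close>, or it is as wide as edge
  \<open>k\<close>. This is the dichotomy asked for by \<open>chain_cond_of_faces\<close>; the
  remaining hypotheses express convexity through \<open>cross_points\<close>.\<close>

lemma face_admissible:
  assumes g: "nonneg_supp g" "\<And>j. j \<noteq> i \<Longrightarrow> in_filt (l j) f (v j) g" "ord_ge (l i) (wt (l i) m) g" "g m \<noteq> 0"
  shows "admissible l a b i v m"
proof -
  have "\<exists>L R. g L \<noteq> 0 \<and> g R \<noteq> 0 \<and> wt (l j) L = wt (l j) R \<and> (\<forall>k. g k \<noteq> 0 \<longrightarrow> wt (l j) L \<le> wt (l j) k) \<and>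
    (\<forall>k. g k \<noteq> 0 \<longrightarrow> wt (l j) k = wt (l j) L \<longrightarrow> fst L \<le> fst k \<and> fst k \<le> fst R)" for j
  proof -
    have "0 < fst (l j)" "0 < snd (l j)" using l_pos[of j] by auto
    from face_ends[OF g(1,4) this] show ?thesis by metis
  qed
  then obtain L R where LR: "\<And>j. g (L j) \<noteq> 0" "\<And>j. g (R j) \<noteq> 0" "\<And>j. wt (l j) (L j) = wt (l j) (R j)"
    "\<And>j k. g k \<noteq> 0 \<Longrightarrow> wt (l j) (L j) \<le> wt (l j) k"
    "\<And>j k. g k \<noteq> 0 \<Longrightarrow> wt (l j) k = wt (l j) (L j) \<Longrightarrow> fst (L j) \<le> fst k \<and> fst k \<le> fst (R j)"
    by metis
  have R_min: "wt (l j) (R j) \<le> wt (l j) k" if "g k \<noteq> 0" for j k using LR(3,4) that by metis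
  have m_min: "wt (l i) m \<le> wt (l i) k" if "g k \<noteq> 0" for k using g(3) that unfolding ord_ge_def by force
  have mins: "wt (l k) (R k) \<le> wt (l k) (L j)" "wt (l k) (R k) \<le> wt (l k) m"
    "wt (l k) (L k) \<le> wt (l k) (R j)" "wt (l k) (L k) \<le> wt (l k) m"
    "wt (l i) m \<le> wt (l i) (L k)" "wt (l i) m \<le> wt (l i) (R k)" for k j
    by (rule R_min LR(4) m_min LR(1,2) g(4))+
  have L_le_R: "fst (L j) \<le> fst (R j)" for j using LR(5)[OF LR(2)] LR(3) by metis
  have m0: "0 \<le> fst m" "0 \<le> snd m" using nonneg_suppD[OF g(1,4)] by auto
  have L0: "0 \<le> fst (L j)" "0 \<le> snd (R j)" for j using nonneg_suppD[OF g(1)] LR(1,2) by blast+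
  note cross = cross_points[OF l_pos[THEN conjunct1] l_pos[THEN conjunct2] l_pos[THEN conjunct1] l_pos[THEN conjunct2]]
  have line: "slope (l k) \<le> slope (l j) \<Longrightarrow> snd x \<le> snd y \<and> wt (l j) x \<le> wt (l j) y"
    "slope (l j) \<le> slope (l k) \<Longrightarrow> wt (l j) y \<le> wt (l j) x"
    if "wt (l k) x = wt (l k) y" "fst y \<le> fst x" for k j x y
    using wt_le_of_slope[OF _ _ _ _ that, of "l j"] l_pos[of k] l_pos[of j] by blast+
  have l1: "0 < fst (l j)" for j using l_pos by blast
  have inj: "inj_on (\<lambda>k. slope (l k)) X" "inj_on (\<lambda>k. - slope (l k)) X" for X
    using slope_inj by (auto simp: inj_on_def)
  have width: "v k \<le> wt (l k) (L k) \<or> fst (L k) + a k \<le> fst (R k)" if "k \<noteq> i" for k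
  proof (cases "v k \<le> wt (l k) (L k)")
    case False
    hence "wt (l k) (L k) < v k" by simp
    have "fst (L k) + a k \<le> fst (R k)"
    proof (rule face_width)
      show "in_filt (l k) f (v k) g" by (rule g(2)[OF that])
      show "g (L k) \<noteq> 0" by (rule LR(1))
      show "wt (l k) (L k) < v k" by fact
      show "wt (l k) (L k) \<le> wt (l k) x" if "g x \<noteq> 0" for x using that by (rule LR(4))
      show "fst (L k) \<le> fst x \<and> fst x \<le> fst (R k)" if "g x \<noteq> 0" "wt (l k) x = wt (l k) (L k)" for x
        using that by (rule LR(5))
    qed
    thus ?thesis ..
  qed simp
  \<comment> \<open>Cuts one copy of edge \<open>k\<close> out of the face. The remaining ends stay
    on one level line, and by \<open>width\<close> in the right order, so that \<open>line\<close>
    applies to them.\<close>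
  have shifted: "wt (l k) (R k - (a k, 0)) = wt (l k) (L k - (0, b k))" for k
    using LR(3)[of k] wt_right[of k] by (simp add: top_wt_def)
  have "right_cond l a b i v m"
    unfolding right_cond_def
  proof (rule chain_cond_of_faces[where \<sigma> = "\<lambda>k. slope (l k)" and L = L and R = R and Q = "\<lambda>k. (a k, 0)"])
    fix k j assume k: "k \<in> {k. slope (l i) < slope (l k)}"
    hence ki: "slope (l i) < slope (l k)" by simp
    show "0 \<le> snd (R k)" by (rule L0)
    show "slope (l k) < slope (l j) \<Longrightarrow> snd (L j) \<le> snd (R k)"
      by (rule cross(1)[OF _ mins(1) mins(3)])
    show "slope (l j) < slope (l k) \<Longrightarrow> corner l a b j k = (0, b k)"
      "slope (l k) < slope (l j) \<Longrightarrow> corner l a b j k = (a k, 0)" by (simp_all add: corner_def)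
    show "snd (L k) \<le> snd m" by (rule cross(1)[OF ki mins(5) mins(4)])
    show "slope (l k) \<le> slope (l j) \<Longrightarrow> wt (l j) (L k) \<le> wt (l j) m"
      by (rule cross(3)[OF ki mins(5) mins(4) l1])
    show "slope (l k) < slope (l j) \<Longrightarrow> slope (l j) \<le> slope (l j') \<Longrightarrow> wt (l j') (L j) \<le> wt (l j') (R k)" for j'
      by (rule cross(3)[OF _ mins(1) mins(3) l1])
    have "k \<noteq> i" using ki by auto
    from width[OF this] show "(v k \<le> wt (l k) (L k) \<and> snd (R k) \<le> snd (L k) \<and>
        (\<forall>j\<in>{k. slope (l i) < slope (l k)}. slope (l k) < slope (l j) \<longrightarrow> wt (l j) (R k) \<le> wt (l j) (L k))) \<or>
      (snd (0, b k) + snd (R k) \<le> snd (L k) \<and> (\<forall>j\<in>{k. slope (l i) < slope (l k)}. slope (l k) < slope (l j) \<longrightarrow>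
        wt (l j) (R k) \<le> wt (l j) (L k) - wt (l j) (0, b k) + wt (l j) (a k, 0)))"
    proof (elim disjE)
      assume "v k \<le> wt (l k) (L k)"
      thus ?thesis using line(1)[OF LR(3)[symmetric] L_le_R, of k] line(1)[OF LR(3)[symmetric] L_le_R, of k k] by (simp add: less_imp_le)
    next
      assume "fst (L k) + a k \<le> fst (R k)"
      hence *: "fst (L k - (0, b k)) \<le> fst (R k - (a k, 0))" by simp
      have "wt (l j) (R k) \<le> wt (l j) (L k) - wt (l j) (0, b k) + wt (l j) (a k, 0)"
        if "slope (l k) < slope (l j)" for j
        using line(1)[OF shifted *, of j] that by simp
      moreover have "b k + snd (R k) \<le> snd (L k)" using line(1)[OF shifted *, of k] by simp
      ultimately show ?thesis by simp
    qed
  qed (use m0 inj in auto)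
  moreover have "left_cond l a b i v m"
    unfolding left_cond_def
  \<comment> \<open>The walk to the left: the order of the edges is reversed and the two ends of
    each face change roles.\<close>
  proof (rule chain_cond_of_faces[where \<sigma> = "\<lambda>k. - slope (l k)" and L = R and R = L and Q = "\<lambda>k. (0, b k)"])
    fix k j assume k: "k \<in> {k. slope (l k) < slope (l i)}"
    hence ki: "slope (l k) < slope (l i)" by simp
    show "0 \<le> fst (L k)" by (rule L0)
    show "- slope (l k) < - slope (l j) \<Longrightarrow> fst (R j) \<le> fst (L k)"
      by (rule cross(2)[OF _ mins(1) mins(3)]) simp
    show "- slope (l j) < - slope (l k) \<Longrightarrow> corner l a b j k = (a k, 0)"
      "- slope (l k) < - slope (l j) \<Longrightarrow> corner l a b j k = (0, b k)" by (simp_all add: corner_def)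
    show "fst (R k) \<le> fst m" by (rule cross(2)[OF ki mins(2) mins(6)])
    show "- slope (l k) \<le> - slope (l j) \<Longrightarrow> wt (l j) (R k) \<le> wt (l j) m"
      by (rule cross(4)[OF ki mins(2) mins(6) l1]) simp
    show "- slope (l k) < - slope (l j) \<Longrightarrow> - slope (l j) \<le> - slope (l j') \<Longrightarrow> wt (l j') (R j) \<le> wt (l j') (L k)" for j'
      by (rule cross(4)[OF _ mins(1) mins(3) l1]) simp_all
    have "k \<noteq> i" using ki by auto
    from width[OF this] show "(v k \<le> wt (l k) (R k) \<and> fst (L k) \<le> fst (R k) \<and>
        (\<forall>j\<in>{k. slope (l k) < slope (l i)}. - slope (l k) < - slope (l j) \<longrightarrow> wt (l j) (L k) \<le> wt (l j) (R k))) \<or>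
      (fst (a k, 0) + fst (L k) \<le> fst (R k) \<and> (\<forall>j\<in>{k. slope (l k) < slope (l i)}. - slope (l k) < - slope (l j) \<longrightarrow>
        wt (l j) (L k) \<le> wt (l j) (R k) - wt (l j) (a k, 0) + wt (l j) (0, b k)))"
    proof (elim disjE)
      assume "v k \<le> wt (l k) (L k)"
      thus ?thesis using line(2)[OF LR(3)[symmetric] L_le_R, of _ k] L_le_R[of k] LR(3)[of k] by (simp add: less_imp_le)
    next
      assume *: "fst (L k) + a k \<le> fst (R k)"
      hence **: "fst (L k - (0, b k)) \<le> fst (R k - (a k, 0))" by simp
      have "wt (l j) (L k) \<le> wt (l j) (R k) - wt (l j) (a k, 0) + wt (l j) (0, b k)"
        if "slope (l j) < slope (l k)" for j
        using line(2)[OF shifted **, of j] that by simp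
      thus ?thesis using * by simp
    qed
  qed (use m0 inj in auto)
  ultimately show ?thesis by (simp add: admissible_def)
qed

text \<open>Up to a positive factor, the \<open>l j\<close>-weight above that of the corner is a
  positive combination of the excess over the segment and the distance from one axis. Both terms
  vanish only at the corner.\<close>

lemma corner_min:
  assumes k: "0 \<le> fst k" "0 \<le> snd k" "top_wt i \<le> wt (l i) k" and "j \<noteq> i"
  shows "wt (l j) (corner l a b j i) \<le> wt (l j) k"
    and "wt (l j) k = wt (l j) (corner l a b j i) \<Longrightarrow> k = corner l a b j i"
proof -
  have l: "0 < fst (l i)" "0 < snd (l i)" "0 < fst (l j)" "0 < snd (l j)" using l_pos by auto
  obtain x y where xy: "k = (x, y)" by (cases k)
  have k': "0 \<le> x" "0 \<le> y" "top_wt i \<le> fst (l i) * x + snd (l i) * y" using k by (simp_all add: xy wt_def)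
  have "wt (l j) (corner l a b j i) \<le> wt (l j) k \<and>
      (wt (l j) k = wt (l j) (corner l a b j i) \<longrightarrow> k = corner l a b j i)"
  proof (cases "slope (l i) < slope (l j)")
    case True
    let ?D = "snd (l j) * fst (l i) - snd (l i) * fst (l j)"
    have c: "corner l a b j i = (a i, 0)" using True by (simp add: corner_def)
    have D: "0 < ?D" using True slope_less_iff[of "l i" "l j"] l by simp
    have e: "fst (l i) * (wt (l j) k - wt (l j) (a i, 0)) =
        fst (l j) * (fst (l i) * x + snd (l i) * y - top_wt i) + ?D * y"
      by (simp add: xy wt_def top_wt_eq(2) algebra_simps)
    have p: "0 \<le> fst (l j) * (fst (l i) * x + snd (l i) * y - top_wt i)" "0 \<le> ?D * y" using k' l D by simp_all
    have "0 \<le> fst (l i) * (wt (l j) k - wt (l j) (a i, 0))" using e p by simp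
    hence 1: "wt (l j) (a i, 0) \<le> wt (l j) k" using l by (simp add: zero_le_mult_iff)
    have "k = (a i, 0)" if "wt (l j) k = wt (l j) (a i, 0)"
    proof -
      have "fst (l i) * (wt (l j) k - wt (l j) (a i, 0)) = 0" using that by simp
      hence "?D * y = 0" using e p by linarith
      hence "y = 0" using D by simp
      thus ?thesis using that l by (simp add: xy wt_def)
    qed
    thus ?thesis using 1 c by simp
  next
    case False
    hence s: "slope (l j) < slope (l i)" using injD[OF slope_inj, of i j] assms(4) by force
    let ?D = "fst (l j) * snd (l i) - fst (l i) * snd (l j)"
    have c: "corner l a b j i = (0, b i)" using False by (simp add: corner_def)
    have D: "0 < ?D" using s slope_less_iff[of "l j" "l i"] l by (simp add: mult.commute)
    have e: "snd (l i) * (wt (l j) k - wt (l j) (0, b i)) =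
        snd (l j) * (fst (l i) * x + snd (l i) * y - top_wt i) + ?D * x"
      by (simp add: xy wt_def top_wt_eq(1) algebra_simps)
    have p: "0 \<le> snd (l j) * (fst (l i) * x + snd (l i) * y - top_wt i)" "0 \<le> ?D * x" using k' l D by simp_all
    have "0 \<le> snd (l i) * (wt (l j) k - wt (l j) (0, b i))" using e p by simp
    hence 1: "wt (l j) (0, b i) \<le> wt (l j) k" using l by (simp add: zero_le_mult_iff)
    have "k = (0, b i)" if "wt (l j) k = wt (l j) (0, b i)"
    proof -
      have "snd (l i) * (wt (l j) k - wt (l j) (0, b i)) = 0" using that by simp
      hence "?D * x = 0" using e p by linarith
      hence "x = 0" using D by simp
      thus ?thesis using that l by (simp add: xy wt_def)
    qed
    thus ?thesis using 1 c by simp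
  qed
  thus "wt (l j) (corner l a b j i) \<le> wt (l j) k"
    "wt (l j) k = wt (l j) (corner l a b j i) \<Longrightarrow> k = corner l a b j i" by auto
qed

section \<open>Germs with prescribed initial forms\<close>

definition factor :: "int \<Rightarrow> 'r \<Rightarrow> lpoly" where
  "factor V i = (SOME F. nonneg_supp (Poly_Mapping.lookup F) \<and> ord_ge (l i) (top_wt i) (Poly_Mapping.lookup F) \<and>
     (\<forall>k. wt (l i) k = top_wt i \<longrightarrow> Poly_Mapping.lookup F k = ff i k) \<and> in_filt (l i) f V (Poly_Mapping.lookup F))"

lemma factor:
  shows "nonneg_supp (Poly_Mapping.lookup (factor V i))"
    and "ord_ge (l i) (top_wt i) (Poly_Mapping.lookup (factor V i))"
    and "\<And>k. wt (l i) k = top_wt i \<Longrightarrow> Poly_Mapping.lookup (factor V i) k = ff i k"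
    and "in_filt (l i) f V (Poly_Mapping.lookup (factor V i))"
  using someI_ex[OF factor_exists[of i V]] unfolding factor_def[symmetric] by blast+

text \<open>All exponents of the factor are nonnegative and lie on or above its segment, whose two
  ends occur; \<open>corner_min\<close> singles out one of them. This makes the factors of different
  edges independent of each other.\<close>

lemma factor_lead:
  assumes "j \<noteq> i"
  shows "lead (l j) (factor V i) (corner l a b j i)"
proof -
  let ?c = "corner l a b j i"
  have "wt (l i) ?c = top_wt i" "ff i ?c \<noteq> 0"
    using ff_left ff_right wt_right by (auto simp: corner_def top_wt_def)
  hence "Poly_Mapping.lookup (factor V i) ?c \<noteq> 0" by (simp add: factor(3))
  moreover have "wt (l j) ?c < wt (l j) k" if k: "Poly_Mapping.lookup (factor V i) k \<noteq> 0" "k \<noteq> ?c" for k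
  proof -
    have "0 \<le> fst k" "0 \<le> snd k" using nonneg_suppD[OF factor(1) k(1)] by auto
    moreover have "top_wt i \<le> wt (l i) k" using factor(2)[of i V] k(1) by (meson ord_geD not_less)
    ultimately have "wt (l j) ?c \<le> wt (l j) k" "wt (l j) k \<noteq> wt (l j) ?c"
      using corner_min[of k i j] assms k(2) by blast+
    thus ?thesis by simp
  qed
  ultimately show ?thesis by (simp add: lead_def)
qed

text \<open>The witness is a monomial times the factors of the edges in \<open>S\<close>. An edge in
  \<open>S\<close> is served by its own factor, up to the freely chosen order \<open>V\<close>; any
  other edge is served by the weight inequality from \<open>admissibleE\<close>.\<close>

lemma admissible_element:
  assumes "admissible l a b i v m"
  obtains P where "nonneg_supp (Poly_Mapping.lookup P)" "lead (l i) P m" "Poly_Mapping.lookup P m = 1"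
    "\<And>j. j \<noteq> i \<Longrightarrow> in_filt (l j) f V (Poly_Mapping.lookup P) \<or> ord_ge (l j) (v j) (Poly_Mapping.lookup P)"
proof -
  obtain S m' where S: "i \<notin> S" "0 \<le> fst m'" "0 \<le> snd m'" "m = m' + (\<Sum>k\<in>S. corner l a b i k)"
    "\<And>j. j \<noteq> i \<Longrightarrow> j \<notin> S \<Longrightarrow> v j \<le> wt (l j) m' + (\<Sum>k\<in>S. wt (l j) (corner l a b j k))"
    by (rule admissibleE[OF slope_inj assms]) blast
  define n where "n = (\<Sum>k\<in>S. corner l a b i k)"
  define F where "F = (\<Prod>k\<in>S. factor V k)"
  have F: "lead (l i) F n" unfolding F_def n_def
    by (rule lead_prod) (use S(1) in \<open>auto intro!: factor_lead\<close>)
  have F_nn: "nonneg_supp (Poly_Mapping.lookup F)" unfolding F_def by (rule nonneg_supp_prod) (auto intro: factor)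
  define c where "c = 1 / Poly_Mapping.lookup F n"
  have c: "c \<noteq> 0" using F by (simp add: c_def lead_def)
  define P where "P = Poly_Mapping.single m' c * F"
  have nn: "nonneg_supp (Poly_Mapping.lookup (Poly_Mapping.single m' c))" by (rule nonneg_supp_single[OF S(2,3)])
  show thesis
  proof (rule that[of P])
    show "nonneg_supp (Poly_Mapping.lookup P)" unfolding P_def by (rule nonneg_supp_mult[OF nn F_nn])
    show "lead (l i) P m" unfolding P_def S(4) n_def[symmetric] by (rule lead_mult[OF lead_single[OF c] F])
    show "Poly_Mapping.lookup P m = 1"
      using F unfolding P_def S(4) n_def[symmetric] act_lookup[symmetric] by (simp add: c_def lead_def)
    fix j assume j: "j \<noteq> i"
    show "in_filt (l j) f V (Poly_Mapping.lookup P) \<or> ord_ge (l j) (v j) (Poly_Mapping.lookup P)"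
    proof (cases "j \<in> S")
      case True
      have "P = (Poly_Mapping.single m' c * (\<Prod>k\<in>S - {j}. factor V k)) * factor V j"
        unfolding P_def F_def by (subst prod.remove[of S j]) (use True in \<open>auto simp: mult_ac\<close>)
      moreover have "in_filt (l j) f V (Poly_Mapping.lookup (Poly_Mapping.single m' c * (\<Prod>k\<in>S - {j}. factor V k) * factor V j))"
        by (rule in_filt_mult[OF factor(4)])
          (use l_pos[of j] in \<open>auto intro!: nonneg_supp_mult nn nonneg_supp_prod factor\<close>)
      ultimately show ?thesis by simp
    next
      case False
      have "ord_ge (l j) (wt (l j) m' + (\<Sum>k\<in>S. wt (l j) (corner l a b j k))) (Poly_Mapping.lookup P)"
        unfolding P_def F_def
      proof (rule ord_ge_mult[OF lead_ord_ge[OF lead_single[OF c]] ord_ge_prod])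
        fix k assume "k \<in> S"
        hence "j \<noteq> k" using False by auto
        thus "ord_ge (l j) (wt (l j) (corner l a b j k)) (Poly_Mapping.lookup (factor V k))"
          by (intro lead_ord_ge factor_lead)
      qed simp
      thus ?thesis using ord_ge_mono S(5)[OF j False] by blast
    qed
  qed
qed

text \<open>Supplies the elements used for cancellation: the \<open>l i\<close>-initial form is a
  monomial multiple of the edge polynomial, while the order at \<open>i\<close> is as high as
  desired. With \<open>d = v i + 1\<close> subtracting such an element does not change the class in
  the quotient.\<close>

lemma face_element:
  assumes m: "admissible l a b i v (m + (0, b i))" "admissible l a b i v (m + (a i, 0))"
  obtains G where "nonneg_supp (Poly_Mapping.lookup G)" "in_filt (l i) f d (Poly_Mapping.lookup G)"
    "\<And>j. j \<noteq> i \<Longrightarrow> in_filt (l j) f (v j) (Poly_Mapping.lookup G)"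
    "ord_ge (l i) (wt (l i) m + top_wt i) (Poly_Mapping.lookup G)"
    "\<And>k. wt (l i) k = wt (l i) m + top_wt i \<Longrightarrow> Poly_Mapping.lookup G k = ff i (k - m)"
proof -
  \<comment> \<open>One truncation order that suffices for edge \<open>i\<close> and for all other
    edges at once.\<close>
  define V where "V = Max (insert d (range v))"
  have V: "d \<le> V" "v j \<le> V" for j unfolding V_def by (intro Max_ge; simp)+
  obtain P where P: "nonneg_supp (Poly_Mapping.lookup P)" "lead (l i) P m" "Poly_Mapping.lookup P m = 1"
    "\<And>j. j \<noteq> i \<Longrightarrow> in_filt (l j) f V (Poly_Mapping.lookup P) \<or>
       ord_ge (l j) (v j - wt (l j) (corner l a b j i)) (Poly_Mapping.lookup P)"
    by (rule admissible_element[OF admissible_shift[OF m], of V]) blast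
  let ?F = "factor V i"
  show thesis
  proof (rule that[of "P * ?F"])
    show "nonneg_supp (Poly_Mapping.lookup (P * ?F))" by (rule nonneg_supp_mult[OF P(1) factor(1)])
    show "in_filt (l i) f d (Poly_Mapping.lookup (P * ?F))"
      by (rule in_filt_mono[OF in_filt_mult[OF factor(4) P(1)] V(1)]) (use l_pos in auto)
    show "ord_ge (l i) (wt (l i) m + top_wt i) (Poly_Mapping.lookup (P * ?F))"
      by (rule ord_ge_mult[OF lead_ord_ge[OF P(2)] factor(2)])
    show "Poly_Mapping.lookup (P * ?F) k = ff i (k - m)" if k: "wt (l i) k = wt (l i) m + top_wt i" for k
      unfolding act_lookup[symmetric] act_lead[OF P(2) factor(2) k] using P(3) k by (simp add: factor(3))
    fix j assume j: "j \<noteq> i"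
    from P(4)[OF j] show "in_filt (l j) f (v j) (Poly_Mapping.lookup (P * ?F))"
    proof
      assume *: "in_filt (l j) f V (Poly_Mapping.lookup P)"
      have "in_filt (l j) f V (Poly_Mapping.lookup (?F * P))"
        by (rule in_filt_mult[OF * factor(1)]) (use l_pos in auto)
      thus ?thesis using in_filt_mono[OF _ V(2)] by (simp add: mult.commute)
    next
      assume "ord_ge (l j) (v j - wt (l j) (corner l a b j i)) (Poly_Mapping.lookup P)"
      from ord_ge_mult[OF this lead_ord_ge[OF factor_lead[OF j]], of V]
      show ?thesis by (intro in_filt_of_ord_ge) simp
    qed
  qed
qed

end

section \<open>Dimensions of quotients\<close>

definition lin_closed :: "lseries set \<Rightarrow> bool" where
  "lin_closed V \<longleftrightarrow> (\<lambda>_. 0) \<in> V \<and> (\<forall>g\<in>V. \<forall>h\<in>V. \<forall>c. (\<lambda>k. g k + c * h k) \<in> V)"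

lemma lin_closedD: "lin_closed V \<Longrightarrow> g \<in> V \<Longrightarrow> h \<in> V \<Longrightarrow> (\<lambda>k. g k + c * h k) \<in> V"
  by (simp add: lin_closed_def)

lemma lin_closed_diff: "lin_closed V \<Longrightarrow> g \<in> V \<Longrightarrow> h \<in> V \<Longrightarrow> (\<lambda>k. g k - h k) \<in> V"
  using lin_closedD[of V g h "- 1"] by simp

lemma lin_closed_sum:
  assumes V: "lin_closed V" and "finite B" "\<And>b. b \<in> B \<Longrightarrow> h b \<in> V"
  shows "(\<lambda>k. \<Sum>b\<in>B. c b * h b k) \<in> V"
  using assms(2,3)
proof (induction B rule: finite_induct)
  case (insert b B)
  have "(\<lambda>k. (\<Sum>b\<in>B. c b * h b k) + c b * h b k) \<in> V"
    using insert by (intro lin_closedD[OF V]) auto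
  thus ?case using insert.hyps by (simp add: add.commute)
qed (use V in \<open>simp add: lin_closed_def\<close>)

text \<open>A homogeneous system with more unknowns than equations, treated by Gaussian elimination:
  equation \<open>y\<close> is solved for a pivot unknown \<open>p\<close>, and \<open>c'\<close>
  holds the coefficients of the reduced system.\<close>

lemma nontrivial_relation:
  fixes c :: "'a \<Rightarrow> 'b \<Rightarrow> complex"
  assumes "finite B" "finite B'" "card B < card B'"
  shows "\<exists>d. (\<exists>x\<in>B'. d x \<noteq> 0) \<and> (\<forall>b\<in>B. (\<Sum>x\<in>B'. d x * c x b) = 0)"
  using assms
proof (induction B arbitrary: B' c rule: finite_induct)
  case empty
  hence "B' \<noteq> {}" by auto
  thus ?case by (intro exI[of _ "\<lambda>_. 1"]) auto
next
  case (insert y B)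
  show ?case
  proof (cases "\<forall>x\<in>B'. c x y = 0")
    case True
    have "card B < card B'" using insert by simp
    from insert.IH[OF insert.prems(1) this, of c] show ?thesis using True by auto
  next
    case False
    then obtain p where p: "p \<in> B'" "c p y \<noteq> 0" by blast
    let ?B = "B' - {p}"
    define c' where "c' x b = c x b - c x y / c p y * c p b" for x b
    have "card B < card ?B" using insert p by simp
    then obtain d where d: "\<exists>x\<in>?B. d x \<noteq> 0" "\<forall>b\<in>B. (\<Sum>x\<in>?B. d x * c' x b) = 0"
      using insert.IH[of ?B c'] insert.prems(1) by auto
    define e where "e x = (if x = p then - (\<Sum>x\<in>?B. d x * (c x y / c p y)) else d x)" for x
    have e: "(\<Sum>x\<in>B'. e x * c x b) = (\<Sum>x\<in>?B. d x * c' x b)" for b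
    proof -
      have "(\<Sum>x\<in>B'. e x * c x b) = e p * c p b + (\<Sum>x\<in>?B. e x * c x b)"
        by (rule sum.remove) (use insert.prems(1) p in auto)
      also have "(\<Sum>x\<in>?B. e x * c x b) = (\<Sum>x\<in>?B. d x * c x b)"
        by (rule sum.cong) (auto simp: e_def)
      also have "e p * c p b + \<dots> = (\<Sum>x\<in>?B. d x * c x b - d x * (c x y / c p y) * c p b)"
        by (simp add: e_def sum_subtractf sum_distrib_right)
      also have "\<dots> = (\<Sum>x\<in>?B. d x * c' x b)"
        by (intro sum.cong refl) (simp add: c'_def algebra_simps)
      finally show ?thesis .
    qed
    have "(\<Sum>x\<in>?B. d x * c' x y) = 0" using p by (intro sum.neutral) (simp add: c'_def)
    hence "\<forall>b\<in>insert y B. (\<Sum>x\<in>B'. e x * c x b) = 0" using d(2) by (simp add: e)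
    moreover have "\<exists>x\<in>B'. e x \<noteq> 0" using d(1) by (auto simp: e_def)
    ultimately show ?thesis by blast
  qed
qed

text \<open>If \<open>B'\<close> were larger, writing its elements through \<open>B\<close> modulo
  \<open>W\<close> would give a system with a nontrivial solution, that is, a relation inside
  \<open>B'\<close> modulo \<open>W\<close>.\<close>

lemma quotient_basis_card_le:
  assumes W: "lin_closed W" and B: "quotient_basis V W B" and B': "quotient_basis V W B'"
  shows "card B' \<le> card B"
proof (rule ccontr)
  assume "\<not> card B' \<le> card B"
  hence lt: "card B < card B'" by simp
  have fin: "finite B" "finite B'" using B B' by (auto simp: quotient_basis_def)
  have "\<forall>x\<in>B'. \<exists>c. (\<lambda>k. x k - (\<Sum>b\<in>B. c b * b k)) \<in> W"
    using B B' unfolding quotient_basis_def by blast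
  from bchoice[OF this] obtain c where c: "\<forall>x\<in>B'. (\<lambda>k. x k - (\<Sum>b\<in>B. c x b * b k)) \<in> W" ..
  obtain d where d: "\<exists>x\<in>B'. d x \<noteq> 0" "\<And>b. b \<in> B \<Longrightarrow> (\<Sum>x\<in>B'. d x * c x b) = 0"
    using nontrivial_relation[OF fin lt, of c] by blast
  have "(\<lambda>k. \<Sum>x\<in>B'. d x * (x k - (\<Sum>b\<in>B. c x b * b k))) \<in> W"
    by (rule lin_closed_sum[OF W fin(2), where h = "\<lambda>x k. x k - (\<Sum>b\<in>B. c x b * b k)"]) (use c in blast)
  moreover have "(\<Sum>x\<in>B'. d x * (x k - (\<Sum>b\<in>B. c x b * b k))) = (\<Sum>x\<in>B'. d x * x k)" for k
  proof -
    have "(\<Sum>x\<in>B'. d x * (\<Sum>b\<in>B. c x b * b k)) = (\<Sum>x\<in>B'. \<Sum>b\<in>B. d x * c x b * b k)"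
      by (simp add: sum_distrib_left mult.assoc)
    also have "\<dots> = (\<Sum>b\<in>B. \<Sum>x\<in>B'. d x * c x b * b k)" by (rule sum.swap)
    also have "\<dots> = 0" using d(2) by (intro sum.neutral) (simp flip: sum_distrib_right)
    finally show ?thesis by (simp add: algebra_simps sum_subtractf)
  qed
  ultimately have "(\<lambda>k. \<Sum>x\<in>B'. d x * x k) \<in> W" by simp
  hence "\<forall>x\<in>B'. d x = 0" using B' unfolding quotient_basis_def by blast
  thus False using d(1) by blast
qed

lemma quotient_dim_eq:
  assumes "lin_closed W" "quotient_basis V W B"
  shows "quotient_dim V W = card B"
  unfolding quotient_dim_def
  using assms quotient_basis_card_le[OF assms(1)] by (intro the_equality) (auto intro: le_antisym)

text \<open>Since \<open>C\<close> lies in \<open>V\<close> and \<open>B\<close> is independent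
  modulo \<open>V\<close>, the two sets are disjoint; hence the cardinalities add.\<close>

lemma quotient_basis_trans:
  assumes V: "lin_closed V" "V \<subseteq> U" "W \<subseteq> V" "lin_closed W"
    and B: "quotient_basis U V B" and C: "quotient_basis V W C"
  shows "quotient_basis U W (B \<union> C) \<and> card (B \<union> C) = card B + card C"
proof -
  have fin: "finite B" "finite C" and sub: "B \<subseteq> U" "C \<subseteq> V"
    and indB: "\<And>c. (\<lambda>k. \<Sum>b\<in>B. c b * b k) \<in> V \<Longrightarrow> \<forall>b\<in>B. c b = 0"
    and indC: "\<And>c. (\<lambda>k. \<Sum>b\<in>C. c b * b k) \<in> W \<Longrightarrow> \<forall>b\<in>C. c b = 0"
    using B C unfolding quotient_basis_def by auto
  have disj: "B \<inter> C = {}"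
  proof (rule ccontr)
    assume "B \<inter> C \<noteq> {}"
    then obtain x where x: "x \<in> B" "x \<in> C" by blast
    have "(\<Sum>b\<in>B. (if b = x then 1 else 0) * b k) = x k" for k
    proof -
      have "(\<Sum>b\<in>B. (if b = x then 1 else 0) * b k) = (\<Sum>b\<in>B. if b = x then b k else 0)"
        by (rule sum.cong) auto
      thus ?thesis using fin(1) x(1) by simp
    qed
    hence "(\<lambda>k. \<Sum>b\<in>B. (if b = x then 1 else 0) * b k) \<in> V" using x(2) sub(2) by auto
    from indB[OF this] x(1) show False by auto
  qed
  have split: "(\<Sum>b\<in>B \<union> C. h b) = (\<Sum>b\<in>B. h b) + (\<Sum>b\<in>C. h b)" for h :: "lseries \<Rightarrow> complex"
    by (rule sum.union_disjoint[OF fin disj])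
  have "\<forall>b\<in>B \<union> C. c b = 0" if "(\<lambda>k. \<Sum>b\<in>B \<union> C. c b * b k) \<in> W" for c
  proof -
    have s: "(\<lambda>k. (\<Sum>b\<in>B. c b * b k) + (\<Sum>b\<in>C. c b * b k)) \<in> W" using that by (simp add: split)
    have C_V: "(\<lambda>k. \<Sum>b\<in>C. c b * b k) \<in> V"
      using sub(2) by (intro lin_closed_sum[OF V(1) fin(2), where h = "\<lambda>b. b"]) auto
    have "(\<lambda>k. (\<Sum>b\<in>B. c b * b k) + (\<Sum>b\<in>C. c b * b k)) \<in> V" using s V(3) by blast
    from lin_closed_diff[OF V(1) this C_V] have *: "\<forall>b\<in>B. c b = 0" by (intro indB) simp
    hence "(\<lambda>k. \<Sum>b\<in>C. c b * b k) \<in> W" using s by simp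
    from indC[OF this] * show ?thesis by blast
  qed
  moreover have "\<exists>c. (\<lambda>k. g k - (\<Sum>b\<in>B \<union> C. c b * b k)) \<in> W" if g: "g \<in> U" for g
  proof -
    obtain c where c: "(\<lambda>k. g k - (\<Sum>b\<in>B. c b * b k)) \<in> V" using B g unfolding quotient_basis_def by blast
    obtain d where d: "(\<lambda>k. g k - (\<Sum>b\<in>B. c b * b k) - (\<Sum>b\<in>C. d b * b k)) \<in> W"
      using C[unfolded quotient_basis_def, THEN conjunct2, THEN conjunct2, THEN conjunct2, THEN bspec, OF c] by blast
    let ?e = "\<lambda>b. if b \<in> B then c b else d b"
    have "(\<Sum>b\<in>B \<union> C. ?e b * b k) = (\<Sum>b\<in>B. c b * b k) + (\<Sum>b\<in>C. d b * b k)" for k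
      unfolding split using disj by (intro arg_cong2[of _ _ _ _ "(+)"] sum.cong) auto
    hence "(\<lambda>k. g k - (\<Sum>b\<in>B \<union> C. ?e b * b k)) \<in> W" using d by (simp add: diff_diff_eq)
    thus ?thesis by (rule exI[of _ ?e])
  qed
  ultimately have "quotient_basis U W (B \<union> C)"
    using fin sub V(2) unfolding quotient_basis_def by blast
  thus ?thesis using fin disj by (simp add: card_Un_disjoint)
qed

section \<open>Normal forms for raising one level\<close>

definition filt_space :: "('r \<Rightarrow> int \<times> int) \<Rightarrow> lseries \<Rightarrow> ('r \<Rightarrow> int) \<Rightarrow> lseries set" where
  "filt_space l f v = {g \<in> germs. \<forall>j. in_filt (l j) f (v j) g}"

lemma lin_closed_filt_space: "lin_closed (filt_space l f v)"
proof -
  have "(\<lambda>_. 0) \<in> germs" by (rule finite_supp_germs) (auto simp: nonneg_supp_def)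
  moreover have "in_filt (l j) f (v j) (\<lambda>_. 0)" for j by (rule in_filt_of_ord_ge) (simp add: ord_ge_def)
  ultimately show ?thesis unfolding lin_closed_def filt_space_def
    using germs_lincomb in_filt_lincomb by auto
qed

lemma filt_space_mono: "(\<And>j. v j \<le> w j) \<Longrightarrow> filt_space l f w \<subseteq> filt_space l f v"
  unfolding filt_space_def using in_filt_mono by blast

text \<open>The possible remainders of division by the edge polynomial within the interval of
  admissible exponents: \<open>m\<close> is reducible exactly when its translate by one edge to the
  upper left is admissible too. No germ enters this definition, which is why the dimensions depend
  on the diagram only.\<close>

definition face_monomials ::
    "('r \<Rightarrow> int \<times> int) \<Rightarrow> ('r \<Rightarrow> int) \<Rightarrow> ('r \<Rightarrow> int) \<Rightarrow> 'r \<Rightarrow> ('r \<Rightarrow> int) \<Rightarrow> (int \<times> int) set" where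
  "face_monomials l a b i v =
     {m. admissible l a b i v m \<and> wt (l i) m = v i \<and> \<not> admissible l a b i v (m - (a i, - b i))}"

context newton_germ
begin

lemma finite_face_monomials: "finite (face_monomials l a b i v)"
proof (rule finite_subset)
  show "face_monomials l a b i v \<subseteq> {k. 0 \<le> fst k \<and> 0 \<le> snd k \<and> wt (l i) k \<le> v i}"
    using admissible_nonneg[of a b l i v, OF ab(1)] by (auto simp: face_monomials_def)
  show "finite {k. 0 \<le> fst k \<and> 0 \<le> snd k \<and> wt (l i) k \<le> v i}"
    using l_pos[of i] by (intro finite_wt_le) auto
qed

text \<open>Below level \<open>v i\<close> the initial form of \<open>g\<close> is a multiple of the
  edge polynomial. Each term of the quotient polynomial is realised by an element of the smaller
  space, and subtracting their combination removes the initial form.\<close>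

lemma raise_order:
  assumes g: "g \<in> filt_space l f v" "ord_ge (l i) e g" "e < v i"
  obtains g' where "g' \<in> filt_space l f v" "(\<lambda>k. g k - g' k) \<in> filt_space l f (v(i := v i + 1))"
    "ord_ge (l i) (e + 1) g'"
proof -
  let ?W = "filt_space l f (v(i := v i + 1))"
  have WV: "?W \<subseteq> filt_space l f v" by (rule filt_space_mono) auto
  have gf: "in_filt (l j) f (v j) g" for j using g(1) by (simp add: filt_space_def)
  have nn: "nonneg_supp g" using g(1) nonneg_supp_germs by (auto simp: filt_space_def)
  obtain q where q: "\<And>w. w \<in> Poly_Mapping.keys q \<Longrightarrow> wt (l i) w = e - top_wt i"
    "\<And>k. wt (l i) k = e \<Longrightarrow> g k = act q (ff i) k"
    using face_divisible[OF gf[of i] g(2,3)] by blast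
  have adm_face: "admissible l a b i v m" if "g m \<noteq> 0" "wt (l i) m = e" for m
    using face_admissible[of g i v m] nn gf g(2) that by auto
  have "\<exists>G. Poly_Mapping.lookup G \<in> ?W \<and> ord_ge (l i) e (Poly_Mapping.lookup G) \<and>
      (\<forall>k. wt (l i) k = e \<longrightarrow> Poly_Mapping.lookup G k = ff i (k - w))" if w: "w \<in> Poly_Mapping.keys q" for w
  proof -
    obtain \<alpha> \<beta> where ab': "wt (l i) \<alpha> = e - top_wt i" "wt (l i) \<beta> = e - top_wt i"
      "fst \<alpha> \<le> fst w" "fst w \<le> fst \<beta>"
      "act q (ff i) (\<alpha> + (0, b i)) \<noteq> 0" "act q (ff i) (\<beta> + (a i, 0)) \<noteq> 0"
      using act_ff_ends[OF q(1) w] by blast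
    have wt': "wt (l i) (\<alpha> + (0, b i)) = e" "wt (l i) (\<beta> + (a i, 0)) = e"
      "wt (l i) (w + (0, b i)) = e" "wt (l i) (w + (a i, 0)) = e"
      using ab'(1,2) wt_right[of i] q(1)[OF w] by (simp_all add: top_wt_def)
    have adm: "admissible l a b i v (\<alpha> + (0, b i))" "admissible l a b i v (\<beta> + (a i, 0))"
      using adm_face q(2) wt' ab'(5,6) by auto
    have a0: "0 \<le> a i" using ab(1) by simp
    \<comment> \<open>Each exponent \<open>w\<close> of the quotient polynomial lies between its
      ends \<alpha> and \<beta>, so both translates lie between two exponents of \<open>g\<close>,
      and the interval property applies.\<close>
    have "admissible l a b i v (w + (0, b i))" "admissible l a b i v (w + (a i, 0))"
      by (rule admissible_between[OF l_pos adm]; use wt' ab'(3,4) a0 in simp)+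
    then obtain G where G: "nonneg_supp (Poly_Mapping.lookup G)" "in_filt (l i) f (v i + 1) (Poly_Mapping.lookup G)"
      "\<And>j. j \<noteq> i \<Longrightarrow> in_filt (l j) f (v j) (Poly_Mapping.lookup G)"
      "ord_ge (l i) (wt (l i) w + top_wt i) (Poly_Mapping.lookup G)"
      "\<And>k. wt (l i) k = wt (l i) w + top_wt i \<Longrightarrow> Poly_Mapping.lookup G k = ff i (k - w)"
      using face_element[where d = "v i + 1"] by blast
    have "Poly_Mapping.lookup G \<in> ?W" using G(1-3) lookup_germs by (auto simp: filt_space_def)
    moreover have "wt (l i) w + top_wt i = e" using q(1)[OF w] by simp
    ultimately show ?thesis using G(4,5) by auto
  qed
  then obtain G where G: "\<And>w. w \<in> Poly_Mapping.keys q \<Longrightarrow> Poly_Mapping.lookup (G w) \<in> ?W"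
    "\<And>w. w \<in> Poly_Mapping.keys q \<Longrightarrow> ord_ge (l i) e (Poly_Mapping.lookup (G w))"
    "\<And>w k. w \<in> Poly_Mapping.keys q \<Longrightarrow> wt (l i) k = e \<Longrightarrow> Poly_Mapping.lookup (G w) k = ff i (k - w)"
    by metis
  define h where "h k = (\<Sum>w\<in>Poly_Mapping.keys q. Poly_Mapping.lookup q w * Poly_Mapping.lookup (G w) k)" for k
  have h: "h \<in> ?W" unfolding h_def by (rule lin_closed_sum[OF lin_closed_filt_space]) (use G(1) in auto)
  show thesis
  proof (rule that[of "\<lambda>k. g k - h k"])
    show "(\<lambda>k. g k - h k) \<in> filt_space l f v"
      using h WV by (intro lin_closed_diff[OF lin_closed_filt_space g(1)]) auto
    show "(\<lambda>k. g k - (g k - h k)) \<in> ?W" using h by simp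
    show "ord_ge (l i) (e + 1) (\<lambda>k. g k - h k)"
      unfolding ord_ge_def
    proof (intro allI impI)
      fix k assume k: "wt (l i) k < e + 1"
      show "g k - h k = 0"
      proof (cases "wt (l i) k = e")
        case True
        have "h k = act q (ff i) k" unfolding h_def act_def by (intro sum.cong refl) (use G(3) True in simp)
        thus ?thesis using q(2)[OF True] by simp
      next
        case False
        hence k': "wt (l i) k < e" using k by simp
        have "h k = 0" unfolding h_def by (intro sum.neutral) (use ord_geD[OF G(2) k'] in simp)
        thus ?thesis using ord_geD[OF g(2) k'] by simp
      qed
    qed
  qed
qed

lemma raise_order_max:
  assumes g: "g \<in> filt_space l f v"
  obtains g' where "g' \<in> filt_space l f v" "(\<lambda>k. g k - g' k) \<in> filt_space l f (v(i := v i + 1))"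
    "ord_ge (l i) (v i) g'"
proof -
  let ?W = "filt_space l f (v(i := v i + 1))"
  \<comment> \<open>The bound with \<open>max\<close> covers a negative \<open>v i\<close>: there
    \<open>n = 0\<close> is the only case and \<open>g\<close> itself serves.\<close>
  have *: "\<exists>g'\<in>filt_space l f v. (\<lambda>k. g k - g' k) \<in> ?W \<and> ord_ge (l i) (int n) g'" if "int n \<le> max 0 (v i)" for n
    using that
  proof (induction n)
    case 0
    have "g \<in> germs" using g by (simp add: filt_space_def)
    hence "ord_ge (l i) 0 g" using l_pos[of i] by (intro nonneg_supp_ord_ge nonneg_supp_germs) auto
    moreover have "(\<lambda>k. g k - g k) \<in> ?W"
      using lin_closed_filt_space unfolding lin_closed_def diff_self by blast
    ultimately show ?case using g unfolding of_nat_0 by blast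
  next
    case (Suc n)
    have "int n \<le> max 0 (v i)" using Suc.prems by simp
    from Suc.IH[OF this] obtain g1 where
      g1: "g1 \<in> filt_space l f v" "(\<lambda>k. g k - g1 k) \<in> ?W" "ord_ge (l i) (int n) g1" by blast
    have "int n < v i" using Suc.prems by simp
    from raise_order[OF g1(1,3) this] obtain g2 where
      g2: "g2 \<in> filt_space l f v" "(\<lambda>k. g1 k - g2 k) \<in> ?W" "ord_ge (l i) (int n + 1) g2" by blast
    have "(\<lambda>k. (g k - g1 k) + 1 * (g1 k - g2 k)) \<in> ?W" by (rule lin_closedD[OF lin_closed_filt_space g1(2) g2(2)])
    hence "(\<lambda>k. g k - g2 k) \<in> ?W" by simp
    moreover have "ord_ge (l i) (int (Suc n)) g2" by (rule ord_ge_mono[OF g2(3)]) simp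
    ultimately show ?case using g2(1) by blast
  qed
  have "int (nat (v i)) \<le> max 0 (v i)" by simp
  from *[OF this] obtain g' where g': "g' \<in> filt_space l f v" "(\<lambda>k. g k - g' k) \<in> ?W"
    "ord_ge (l i) (int (nat (v i))) g'" by blast
  have "ord_ge (l i) (v i) g'" by (rule ord_ge_mono[OF g'(3)]) simp
  thus thesis using that g' by blast
qed

text \<open>Division with remainder from right to left. The right end of a shifted edge polynomial
  cancels the rightmost reducible term, and its other terms lie further left; \<open>n\<close>
  bounds the first exponents of the reducible terms.\<close>

lemma reduce_face:
  assumes "g \<in> filt_space l f v" "ord_ge (l i) (v i) g"
  shows "\<exists>g'\<in>filt_space l f v. (\<lambda>k. g k - g' k) \<in> filt_space l f (v(i := v i + 1)) \<and> ord_ge (l i) (v i) g' \<and>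
    (\<forall>k. wt (l i) k = v i \<longrightarrow> g' k \<noteq> 0 \<longrightarrow> k \<in> face_monomials l a b i v)"
proof -
  let ?W = "filt_space l f (v(i := v i + 1))"
  let ?X = "face_monomials l a b i v"
  have WV: "?W \<subseteq> filt_space l f v" by (rule filt_space_mono) auto
  have adm: "admissible l a b i v m"
    if "g \<in> filt_space l f v" "ord_ge (l i) (v i) g" "g m \<noteq> 0" "wt (l i) m = v i" for g m
    using face_admissible[of g i v m] that nonneg_supp_germs by (auto simp: filt_space_def)
  have "\<exists>g'\<in>filt_space l f v. (\<lambda>k. g k - g' k) \<in> ?W \<and> ord_ge (l i) (v i) g' \<and>
      (\<forall>k. wt (l i) k = v i \<longrightarrow> g' k \<noteq> 0 \<longrightarrow> k \<in> ?X)"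
    if "g \<in> filt_space l f v" "ord_ge (l i) (v i) g"
      "\<forall>k. wt (l i) k = v i \<longrightarrow> g k \<noteq> 0 \<longrightarrow> k \<notin> ?X \<longrightarrow> fst k < int n" for g n
    using that
  proof (induction n arbitrary: g)
    case 0
    have "k \<in> ?X" if "wt (l i) k = v i" "g k \<noteq> 0" for k
      using 0 that nonneg_suppD[OF nonneg_supp_germs, of g k] by (fastforce simp: filt_space_def)
    moreover have "(\<lambda>k. g k - g k) \<in> ?W"
      using lin_closed_filt_space unfolding lin_closed_def diff_self by blast
    ultimately show ?case using 0(1,2) by blast
  next
    case (Suc n)
    show ?case
    proof (cases "\<exists>m. wt (l i) m = v i \<and> g m \<noteq> 0 \<and> m \<notin> ?X \<and> fst m = int n")
      case False
      have "\<forall>k. wt (l i) k = v i \<longrightarrow> g k \<noteq> 0 \<longrightarrow> k \<notin> ?X \<longrightarrow> fst k < int n"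
        using Suc.prems(3) False by force
      thus ?thesis using Suc.IH Suc.prems by blast
    next
      case True
      then obtain m where m: "wt (l i) m = v i" "g m \<noteq> 0" "m \<notin> ?X" "fst m = int n" by blast
      let ?m = "m - (a i, 0)"
      have "admissible l a b i v m" by (rule adm[OF Suc.prems(1,2) m(2,1)])
      moreover from this have "admissible l a b i v (m - (a i, - b i))"
        using m(1,3) by (simp add: face_monomials_def)
      moreover have "m - (a i, - b i) = ?m + (0, b i)" "m = ?m + (a i, 0)" by (simp_all add: prod_eq_iff)
      ultimately have "admissible l a b i v (?m + (0, b i))" "admissible l a b i v (?m + (a i, 0))" by metis+
      then obtain G where G: "nonneg_supp (Poly_Mapping.lookup G)" "in_filt (l i) f (v i + 1) (Poly_Mapping.lookup G)"
        "\<And>j. j \<noteq> i \<Longrightarrow> in_filt (l j) f (v j) (Poly_Mapping.lookup G)"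
        "ord_ge (l i) (wt (l i) ?m + top_wt i) (Poly_Mapping.lookup G)"
        "\<And>k. wt (l i) k = wt (l i) ?m + top_wt i \<Longrightarrow> Poly_Mapping.lookup G k = ff i (k - ?m)"
        using face_element[where d = "v i + 1"] by blast
      have e: "wt (l i) ?m + top_wt i = v i" using m(1) wt_right[of i] by simp
      have GW: "Poly_Mapping.lookup G \<in> ?W" using G(1-3) lookup_germs by (auto simp: filt_space_def)
      define c where "c = - g m / ff i (a i, 0)"
      define g1 where "g1 k = g k + c * Poly_Mapping.lookup G k" for k
      have g1V: "g1 \<in> filt_space l f v"
        unfolding g1_def using GW WV by (intro lin_closedD[OF lin_closed_filt_space Suc.prems(1)]) auto
      have g1o: "ord_ge (l i) (v i) g1"
        using ord_geD[OF Suc.prems(2)] ord_geD[OF G(4)[unfolded e]] by (auto simp: ord_ge_def g1_def)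
      have "Poly_Mapping.lookup G m = ff i (m - ?m)" by (rule G(5)) (simp only: e m(1))
      hence g1m: "g1 m = 0" using ff_right[of i] by (simp add: g1_def c_def)
      have "fst k < int n" if k: "wt (l i) k = v i" "g1 k \<noteq> 0" "k \<notin> ?X" for k
      proof -
        have "fst k \<le> int n"
        proof (cases "Poly_Mapping.lookup G k = 0")
          case True
          hence "g k \<noteq> 0" using k(2) by (simp add: g1_def)
          thus ?thesis using Suc.prems(3) k by force
        next
          case False
          hence "ff i (k - ?m) \<noteq> 0" using G(5)[of k] k(1) e by simp
          moreover have "wt (l i) (k - ?m) = top_wt i" using k(1) e by simp
          ultimately show ?thesis using ff_face(2)[of i "k - ?m"] m(4) by simp
        qed
        moreover have "fst k \<noteq> int n"
        proof
          assume "fst k = int n"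
          hence "k = m" using wt_eq_iff[of "l i" k m] l_pos[of i] k(1) m by auto
          thus False using k(2) g1m by simp
        qed
        ultimately show ?thesis by simp
      qed
      then obtain g' where g': "g' \<in> filt_space l f v" "(\<lambda>k. g1 k - g' k) \<in> ?W" "ord_ge (l i) (v i) g'"
        "\<forall>k. wt (l i) k = v i \<longrightarrow> g' k \<noteq> 0 \<longrightarrow> k \<in> ?X"
        using Suc.IH[OF g1V g1o] by blast
      have "(\<lambda>k. (g1 k - g' k) + (- c) * Poly_Mapping.lookup G k) \<in> ?W"
        by (rule lin_closedD[OF lin_closed_filt_space g'(2) GW])
      hence "(\<lambda>k. g k - g' k) \<in> ?W" by (simp add: g1_def)
      thus ?thesis using g' by blast
    qed
  qed
  moreover obtain n where "\<forall>k. wt (l i) k = v i \<longrightarrow> g k \<noteq> 0 \<longrightarrow> fst k < int n"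
  proof -
    have "fst k < int (nat (v i) + 1)" if "wt (l i) k = v i" "g k \<noteq> 0" for k
    proof -
      have "0 \<le> fst k" "0 \<le> snd k"
        using nonneg_suppD[of g k] nonneg_supp_germs[of g] assms(1) that(2) by (auto simp: filt_space_def)
      hence "fst k \<le> fst (l i) * fst k" "0 \<le> snd (l i) * snd k"
        using l_pos[of i] by (simp_all add: mult_le_cancel_right1)
      thus ?thesis using that(1) by (simp add: wt_def)
    qed
    thus thesis using that by blast
  qed
  ultimately show ?thesis using assms by blast
qed

text \<open>Spanning is order raising followed by division with remainder. For independence, a
  nonzero combination in the smaller space would have an initial form divisible by the edge
  polynomial, but made of irreducible exponents only.\<close>

theorem quotient_basis_step:
  "\<exists>B. quotient_basis (filt_space l f v) (filt_space l f (v(i := v i + 1))) B \<and>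
     card B = card (face_monomials l a b i v)"
proof -
  let ?V = "filt_space l f v" and ?W = "filt_space l f (v(i := v i + 1))"
  let ?X = "face_monomials l a b i v"
  have WV: "?W \<subseteq> ?V" by (rule filt_space_mono) auto
  have l: "0 < fst (l j)" "0 < snd (l j)" for j using l_pos by auto
  have "\<exists>P. Poly_Mapping.lookup P \<in> ?V \<and> lead (l i) P m \<and> Poly_Mapping.lookup P m = 1" if m: "m \<in> ?X" for m
  proof -
    have "admissible l a b i v m" using m by (simp add: face_monomials_def)
    then obtain P where P: "nonneg_supp (Poly_Mapping.lookup P)" "lead (l i) P m" "Poly_Mapping.lookup P m = 1"
      "\<And>j. j \<noteq> i \<Longrightarrow> in_filt (l j) f (Max (range v)) (Poly_Mapping.lookup P) \<or> ord_ge (l j) (v j) (Poly_Mapping.lookup P)"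
      using admissible_element[where V = "Max (range v)"] by blast
    have "in_filt (l j) f (v j) (Poly_Mapping.lookup P)" for j
    proof (cases "j = i")
      case True
      thus ?thesis using lead_ord_ge[OF P(2)] m by (intro in_filt_of_ord_ge) (simp add: face_monomials_def)
    next
      case False
      have "v j \<le> Max (range v)" by simp
      thus ?thesis using P(4)[OF False] in_filt_mono in_filt_of_ord_ge by blast
    qed
    thus ?thesis using P lookup_germs by (auto simp: filt_space_def)
  qed
  then obtain P where P: "\<And>m. m \<in> ?X \<Longrightarrow> Poly_Mapping.lookup (P m) \<in> ?V" "\<And>m. m \<in> ?X \<Longrightarrow> lead (l i) (P m) m"
    "\<And>m. m \<in> ?X \<Longrightarrow> Poly_Mapping.lookup (P m) m = 1"
    by metis
  define e where "e m = Poly_Mapping.lookup (P m)" for m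
  have fin: "finite ?X" by (rule finite_face_monomials)
  have wt_X: "wt (l i) m = v i" if "m \<in> ?X" for m using that by (simp add: face_monomials_def)
  \<comment> \<open>On level \<open>v i\<close> the element \<open>e m\<close> is exactly the
    monomial \<open>m\<close>: its initial form is a monomial with coefficient 1. Coefficients of
    combinations can therefore be read off there.\<close>
  have e_face: "e m k = (if k = m then 1 else 0)" if "m \<in> ?X" "wt (l i) k = v i" for m k
    using P(2,3)[OF that(1)] that wt_X[OF that(1)] unfolding e_def lead_def by force
  have e_ord: "ord_ge (l i) (v i) (e m)" if "m \<in> ?X" for m
    using lead_ord_ge[OF P(2)[OF that]] wt_X[OF that] by (simp add: e_def)
  have inj: "inj_on e ?X"
  proof (rule inj_onI)
    fix m n assume mn: "m \<in> ?X" "n \<in> ?X" "e m = e n"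
    have "e m m = e n m" using mn(3) by simp
    thus "m = n" using e_face[OF mn(1) wt_X[OF mn(1)]] e_face[OF mn(2) wt_X[OF mn(1)]] by (auto split: if_splits)
  qed
  have sum_face: "(\<Sum>m\<in>?X. c m * e m k) = (if k \<in> ?X then c k else 0)" if "wt (l i) k = v i" for c k
  proof -
    have "(\<Sum>m\<in>?X. c m * e m k) = (\<Sum>m\<in>?X. if k = m then c m else 0)"
      by (rule sum.cong) (use e_face that in auto)
    thus ?thesis using fin by simp
  qed
  have sum_ord: "ord_ge (l i) (v i) (\<lambda>k. \<Sum>m\<in>?X. c m * e m k)" for c
    unfolding ord_ge_def using ord_geD[OF e_ord] by (auto intro!: sum.neutral)
  have "quotient_basis ?V ?W (e ` ?X)"
    unfolding quotient_basis_def
  proof (intro conjI allI impI ballI)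
    show "finite (e ` ?X)" using fin by simp
    show "e ` ?X \<subseteq> ?V" using P(1) by (auto simp: e_def)
  next
    fix c x assume c: "(\<lambda>k. \<Sum>x\<in>e ` ?X. c x * x k) \<in> ?W" and "x \<in> e ` ?X"
    then obtain m where m: "m \<in> ?X" "x = e m" by blast
    define h where "h k = (\<Sum>m\<in>?X. c (e m) * e m k)" for k
    have "h = (\<lambda>k. \<Sum>x\<in>e ` ?X. c x * x k)" by (simp add: h_def fun_eq_iff sum.reindex[OF inj])
    hence h: "h \<in> ?W" using c by (simp only:)
    have h_face: "h k = (if k \<in> ?X then c (e k) else 0)" if "wt (l i) k = v i" for k
      unfolding h_def by (rule sum_face[OF that])
    show "c x = 0"
    proof (rule ccontr)
      assume "c x \<noteq> 0"
      hence hm: "h m \<noteq> 0" using h_face[OF wt_X[OF m(1)]] m by simp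
      have "in_filt (l i) f (v i + 1) h" using h unfolding filt_space_def by (auto dest: spec[of _ i])
      moreover have "ord_ge (l i) (v i) h" unfolding h_def by (rule sum_ord)
      ultimately obtain q where q: "\<And>w. w \<in> Poly_Mapping.keys q \<Longrightarrow> wt (l i) w = v i - top_wt i"
        "\<And>k. wt (l i) k = v i \<Longrightarrow> h k = act q (ff i) k"
        using face_divisible[of i "v i + 1" h "v i"] by auto
      have "q \<noteq> 0" using q(2)[OF wt_X[OF m(1)]] hm by auto
      then obtain w where w: "w \<in> Poly_Mapping.keys q" by (metis all_not_in_conv keys_eq_empty)
      obtain \<alpha> \<beta> where ab': "wt (l i) \<alpha> = v i - top_wt i" "wt (l i) \<beta> = v i - top_wt i"
        "fst \<alpha> \<le> fst w" "fst w \<le> fst \<beta>"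
        "act q (ff i) (\<alpha> + (0, b i)) \<noteq> 0" "act q (ff i) (\<beta> + (a i, 0)) \<noteq> 0"
        using act_ff_ends[OF q(1) w] by blast
      have wt': "wt (l i) (\<alpha> + (0, b i)) = v i" "wt (l i) (\<beta> + (a i, 0)) = v i" "wt (l i) (\<beta> + (0, b i)) = v i"
        using ab'(1,2) wt_right[of i] by (simp_all add: top_wt_def)
      have X: "\<alpha> + (0, b i) \<in> ?X" "\<beta> + (a i, 0) \<in> ?X"
        using h_face[OF wt'(1)] h_face[OF wt'(2)] q(2)[OF wt'(1)] q(2)[OF wt'(2)] ab'(5,6)
        by (auto split: if_splits)
      have a0: "0 \<le> a i" using ab(1) by simp
      \<comment> \<open>This point is one edge to the left of \<open>\<beta> + (a i, 0)\<close>, but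
        not left of \<open>\<alpha> + (0, b i)\<close>. Its admissibility makes the right end of the
        initial form reducible, although that end belongs to \<open>?X\<close>.\<close>
      have "admissible l a b i v (\<beta> + (0, b i))"
        by (rule admissible_between[where l = l and m = "\<alpha> + (0, b i)" and m'' = "\<beta> + (a i, 0)", OF l_pos])
          (use X wt' ab'(3,4) a0 in \<open>auto simp: face_monomials_def\<close>)
      moreover have "\<not> admissible l a b i v (\<beta> + (a i, 0) - (a i, - b i))"
        using X(2) unfolding face_monomials_def by blast
      moreover have "\<beta> + (a i, 0) - (a i, - b i) = \<beta> + (0, b i)" by (simp add: prod_eq_iff)
      ultimately show False by metis
    qed
  next
    fix g assume g: "g \<in> ?V"
    obtain g1 where g1: "g1 \<in> ?V" "(\<lambda>k. g k - g1 k) \<in> ?W" "ord_ge (l i) (v i) g1"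
      by (rule raise_order_max[OF g])
    obtain g2 where g2: "g2 \<in> ?V" "(\<lambda>k. g1 k - g2 k) \<in> ?W" "ord_ge (l i) (v i) g2"
      "\<And>k. wt (l i) k = v i \<Longrightarrow> g2 k \<noteq> 0 \<Longrightarrow> k \<in> ?X"
      using reduce_face[OF g1(1,3)] by blast
    define h where "h k = (\<Sum>m\<in>?X. g2 m * e m k)" for k
    have h_V: "h \<in> ?V" unfolding h_def
      by (rule lin_closed_sum[OF lin_closed_filt_space fin]) (use P(1) in \<open>auto simp: e_def\<close>)
    have V3: "(\<lambda>k. g2 k - h k) \<in> ?V" by (rule lin_closed_diff[OF lin_closed_filt_space g2(1) h_V])
    have "ord_ge (l i) (v i + 1) (\<lambda>k. g2 k - h k)"
      unfolding ord_ge_def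
    proof (intro allI impI)
      fix k assume k: "wt (l i) k < v i + 1"
      show "g2 k - h k = 0"
      proof (cases "wt (l i) k = v i")
        case True
        thus ?thesis using g2(4)[OF True] by (auto simp: h_def sum_face)
      next
        case False
        hence k': "wt (l i) k < v i" using k by simp
        show ?thesis using ord_geD[OF g2(3) k'] ord_geD[OF sum_ord k'] by (simp add: h_def)
      qed
    qed
    hence "(\<lambda>k. g2 k - h k) \<in> ?W" using V3 in_filt_of_ord_ge by (auto simp: filt_space_def)
    from lin_closedD[OF lin_closed_filt_space lin_closedD[OF lin_closed_filt_space g1(2) g2(2), of 1] this, of 1]
    have "(\<lambda>k. g k - h k) \<in> ?W" by simp
    moreover obtain c where c: "\<And>m. m \<in> ?X \<Longrightarrow> c (e m) = g2 m"
      using inv_into_f_f[OF inj] that[of "\<lambda>x. g2 (inv_into ?X e x)"] by auto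
    have "h k = (\<Sum>x\<in>e ` ?X. c x * x k)" for k
      unfolding h_def sum.reindex[OF inj] by (rule sum.cong) (auto simp: c)
    ultimately show "\<exists>c. (\<lambda>k. g k - (\<Sum>x\<in>e ` ?X. c x * x k)) \<in> ?W" by auto
  qed
  thus ?thesis using card_image[OF inj] by blast
qed

end

section \<open>Comparison of two germs with the same diagram\<close>

text \<open>The levels in \<open>T\<close> are raised one after the other. Each step contributes the
  number of \<open>face_monomials\<close> for the current levels, which is the same for both
  germs.\<close>

lemma quotient_bases_same_card:
  assumes f: "newton_germ l a b f A" and f': "newton_germ l a b f' A'" and "finite T"
  shows "\<exists>B B'. quotient_basis (filt_space l f v) (filt_space l f (\<lambda>j. if j \<in> T then v j + 1 else v j)) B \<and>
    quotient_basis (filt_space l f' v) (filt_space l f' (\<lambda>j. if j \<in> T then v j + 1 else v j)) B' \<and> card B = card B'"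
  using assms(3)
proof (induction T rule: finite_induct)
  case empty
  have *: "quotient_basis V V {}" if "lin_closed V" for V
    using that by (simp add: quotient_basis_def lin_closed_def)
  show ?case by (intro exI[of _ "{}"]) (simp add: *[OF lin_closed_filt_space])
next
  case (insert i T)
  let ?w = "\<lambda>j. if j \<in> T then v j + 1 else v j"
  have w: "(\<lambda>j. if j \<in> insert i T then v j + 1 else v j) = ?w(i := ?w i + 1)"
    using insert.hyps by auto
  obtain B B' where B: "quotient_basis (filt_space l f v) (filt_space l f ?w) B"
    "quotient_basis (filt_space l f' v) (filt_space l f' ?w) B'" "card B = card B'"
    using insert.IH by blast
  obtain C C' where C: "quotient_basis (filt_space l f ?w) (filt_space l f (?w(i := ?w i + 1))) C"
    "quotient_basis (filt_space l f' ?w) (filt_space l f' (?w(i := ?w i + 1))) C'" "card C = card C'"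
    using newton_germ.quotient_basis_step[OF f, of ?w i] newton_germ.quotient_basis_step[OF f', of ?w i] by auto
  have trans: "quotient_basis (filt_space l h v) (filt_space l h (?w(i := ?w i + 1))) (D \<union> E) \<and>
      card (D \<union> E) = card D + card E"
    if "quotient_basis (filt_space l h v) (filt_space l h ?w) D"
      "quotient_basis (filt_space l h ?w) (filt_space l h (?w(i := ?w i + 1))) E" for h D E
    by (rule quotient_basis_trans[OF lin_closed_filt_space _ _ lin_closed_filt_space that])
      (rule filt_space_mono; simp)+
  show ?case unfolding w using trans[OF B(1) C(1)] trans[OF B(2) C(2)] B(3) C(3)
    by (intro exI[of _ "B \<union> C"] exI[of _ "B' \<union> C'"]) simp
qed

lemma hilbert_series_cong:
  assumes "newton_germ l a b f A" "newton_germ l a b f' A'"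
  shows "hilbert_series l f v = hilbert_series l f' v"
proof -
  have J: "J_ideal l h w = filt_space l h (\<lambda>i. w $ i)" if "newton_germ l a b h C" for h C w
    using le_v_order_iff[OF newton_germ.f_germ[OF that]] newton_germ.l_pos[OF that]
    by (auto simp: J_ideal_def filt_space_def)
  obtain B B' where B: "quotient_basis (filt_space l f (\<lambda>i. v $ i)) (filt_space l f (\<lambda>j. v $ j + 1)) B"
    "quotient_basis (filt_space l f' (\<lambda>i. v $ i)) (filt_space l f' (\<lambda>j. v $ j + 1)) B'" "card B = card B'"
    using quotient_bases_same_card[OF assms finite[of UNIV], of "\<lambda>i. v $ i"] by auto
  show ?thesis
    using quotient_dim_eq[OF lin_closed_filt_space B(1)] quotient_dim_eq[OF lin_closed_filt_space B(2)] B(3)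
    by (simp add: hilbert_series_def J[OF assms(1)] J[OF assms(2)])
qed

section \<open>Newton diagrams\<close>

definition rwt :: "int \<times> int \<Rightarrow> real \<times> real \<Rightarrow> real" where
  "rwt l p = real_of_int (fst l) * fst p + real_of_int (snd l) * snd p"

definition pt :: "int \<times> int \<Rightarrow> real \<times> real" where
  "pt k = (real_of_int (fst k), real_of_int (snd k))"

lemma rwt_pt: "rwt l (pt k) = real_of_int (wt l k)"
  by (simp add: rwt_def pt_def wt_def)

lemma rwt_add: "rwt l (p + q) = rwt l p + rwt l q"
  and rwt_diff: "rwt l (p - q) = rwt l p - rwt l q"
  and rwt_scaleR: "rwt l (u *\<^sub>R p) = u * rwt l p"
  by (simp_all add: rwt_def algebra_simps)

lemma rwt_inner: "rwt l p = pt l \<bullet> p"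
  by (simp add: rwt_def pt_def inner_prod_def)

lemma rwt_eq_imp_eq: "0 < snd l \<Longrightarrow> rwt l p = rwt l q \<Longrightarrow> fst p = fst q \<Longrightarrow> p = q"
  by (auto simp: rwt_def prod_eq_iff)

lemma supp_newton_polygon: "k \<in> supp g \<Longrightarrow> pt k \<in> newton_polygon g"
  unfolding newton_polygon_def pt_def by (rule hull_inc) force

lemma newton_polygon_ge:
  fixes \<alpha> \<beta> :: real
  assumes "0 \<le> \<alpha>" "0 \<le> \<beta>"
    and k: "\<And>k. k \<in> supp g \<Longrightarrow> d \<le> \<alpha> * real_of_int (fst k) + \<beta> * real_of_int (snd k)"
    and p: "p \<in> newton_polygon g"
  shows "d \<le> \<alpha> * fst p + \<beta> * snd p"
proof -
  have "newton_polygon g \<subseteq> {p. (\<alpha>, \<beta>) \<bullet> p \<ge> d}"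
    unfolding newton_polygon_def
  proof (rule hull_minimal)
    show "(\<Union>(i, j)\<in>supp g. {(p, q). real_of_int i \<le> p \<and> real_of_int j \<le> q}) \<subseteq> {p. (\<alpha>, \<beta>) \<bullet> p \<ge> d}"
    proof clarify
      fix i j p q assume *: "(i, j) \<in> supp g" "real_of_int i \<le> p" "real_of_int j \<le> q"
      have "d \<le> \<alpha> * real_of_int i + \<beta> * real_of_int j" using k[OF *(1)] by simp
      also have "\<dots> \<le> \<alpha> * p + \<beta> * q" using assms(1,2) * by (intro add_mono mult_left_mono) auto
      finally show "d \<le> (\<alpha>, \<beta>) \<bullet> (p, q)" by simp
    qed
    show "convex {p. (\<alpha>, \<beta>) \<bullet> p \<ge> d}" by (rule convex_halfspace_ge)
  qed
  thus ?thesis using p by (auto simp: inner_prod_def)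
qed

lemma newton_polygon_add:
  assumes "p \<in> newton_polygon g" "0 \<le> s" "0 \<le> t"
  shows "p + (s, t) \<in> newton_polygon g"
proof -
  let ?U = "\<Union>(i, j)\<in>supp g. {(p, q). real_of_int i \<le> p \<and> real_of_int j \<le> q}"
  have "(\<lambda>x. (s, t) + x) ` ?U \<subseteq> ?U" using assms(2,3) by force
  hence "convex hull ((\<lambda>x. (s, t) + x) ` ?U) \<subseteq> convex hull ?U" by (rule hull_mono)
  moreover have "(s, t) + p \<in> (\<lambda>x. (s, t) + x) ` (convex hull ?U)"
    using assms(1) unfolding newton_polygon_def by blast
  ultimately show ?thesis unfolding newton_polygon_def convex_hull_translation by (auto simp: add.commute)
qed

lemma newton_diagram_subset: "newton_diagram g \<subseteq> newton_polygon g"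
  unfolding newton_diagram_def by (auto dest: face_of_imp_subset)

lemma face_of_weight:
  assumes "convex P" "\<And>p. p \<in> P \<Longrightarrow> c \<le> rwt l p"
  shows "P \<inter> {p. rwt l p = c} face_of P"
  using face_of_Int_supporting_hyperplane_ge[where S = P and a = "pt l" and b = c] assms by (simp add: rwt_inner)

text \<open>Positivity of \<open>l\<close> makes the \<open>l\<close>-minimal face of the polygon a
  compact segment, hence a part of the diagram. The last four conclusions describe its ends through
  the diagram instead of the coefficients.\<close>

lemma newton_diagram_face_ends:
  assumes g: "nonneg_supp g" "g k0 \<noteq> 0" and l: "0 < fst l" "0 < snd l"
  obtains L R where "g L \<noteq> 0" "g R \<noteq> 0" "wt l L = wt l R" "\<And>k. g k \<noteq> 0 \<Longrightarrow> wt l L \<le> wt l k"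
    "\<And>k. g k \<noteq> 0 \<Longrightarrow> wt l k = wt l L \<Longrightarrow> fst L \<le> fst k \<and> fst k \<le> fst R"
    "pt L \<in> newton_diagram g" "pt R \<in> newton_diagram g"
    "\<And>p. p \<in> newton_diagram g \<Longrightarrow> rwt l (pt L) \<le> rwt l p"
    "\<And>p. p \<in> newton_diagram g \<Longrightarrow> rwt l p = rwt l (pt L) \<Longrightarrow> fst (pt L) \<le> fst p \<and> fst p \<le> fst (pt R)"
proof -
  let ?P = "newton_polygon g"
  obtain L R where LR: "g L \<noteq> 0" "g R \<noteq> 0" "wt l L = wt l R" "\<And>k. g k \<noteq> 0 \<Longrightarrow> wt l L \<le> wt l k"
    "\<And>k. g k \<noteq> 0 \<Longrightarrow> wt l k = wt l L \<Longrightarrow> fst L \<le> fst k \<and> fst k \<le> fst R"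
    using face_ends[OF assms] by blast
  define c where "c = wt l L"
  have c: "rwt l (pt L) = c" "rwt l (pt R) = c" using LR(3) by (simp_all add: rwt_pt c_def)
  have conv: "convex ?P" by (simp add: newton_polygon_def)
  have LP: "pt L \<in> ?P" "pt R \<in> ?P" using LR(1,2) by (auto intro!: supp_newton_polygon simp: supp_def)
  have lr: "0 < real_of_int (fst l)" "0 < real_of_int (snd l)" using l by auto
  have min: "c \<le> rwt l p" if "p \<in> ?P" for p
    unfolding rwt_def
  proof (rule newton_polygon_ge[OF _ _ _ that])
    fix k assume "k \<in> supp g"
    hence "c \<le> wt l k" using LR(4)[of k] by (simp add: supp_def c_def)
    hence "real_of_int c \<le> real_of_int (wt l k)" by simp
    thus "c \<le> real_of_int (fst l) * real_of_int (fst k) + real_of_int (snd l) * real_of_int (snd k)"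
      by (simp add: wt_def)
  qed (use lr in auto)
  have "0 \<le> fst L" "0 \<le> snd R" using nonneg_suppD[OF g(1)] LR(1,2) by auto
  have snd_R: "snd R \<le> snd k" if "g k \<noteq> 0" "wt l k = c" for k
  proof -
    have "fst l * fst k \<le> fst l * fst R" using LR(5)[of k] that l by (simp add: c_def)
    hence "snd l * snd R \<le> snd l * snd k" using that(2) LR(3) by (simp add: c_def wt_def)
    thus ?thesis using l by simp
  qed
  have ends: "fst (pt L) \<le> fst p \<and> fst p \<le> fst (pt R)" if p: "p \<in> ?P" "rwt l p = c" for p
  proof -
    txt \<open>A supporting line through the end \<open>L\<close> that is steeper than the face.\<close>
    have "real_of_int (fst L) * (1 + real_of_int c) \<le>
        (1 + real_of_int (fst L) * real_of_int (fst l)) * fst p + (real_of_int (fst L) * real_of_int (snd l)) * snd p"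
    proof (rule newton_polygon_ge[OF _ _ _ p(1)])
      fix k assume k: "k \<in> supp g"
      hence gk: "g k \<noteq> 0" by (simp add: supp_def)
      \<comment> \<open>Integrality: an exponent off the face has weight at least
        \<open>c + 1\<close>, and the factor \<open>fst L\<close> lets this surplus pay for a first
        coordinate smaller than \<open>fst L\<close>.\<close>
      have "fst L * (1 + c) \<le> fst k + fst L * wt l k"
      proof (cases "wt l k = c")
        case True
        thus ?thesis using LR(5)[OF gk] by (simp add: c_def algebra_simps)
      next
        case False
        hence "1 + c \<le> wt l k" using LR(4)[OF gk] by (simp add: c_def)
        hence "fst L * (1 + c) \<le> fst L * wt l k" using \<open>0 \<le> fst L\<close> by (rule mult_left_mono)
        thus ?thesis using nonneg_suppD[OF g(1) gk] by simp
      qed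
      hence "real_of_int (fst L * (1 + c)) \<le> real_of_int (fst k + fst L * wt l k)" by (simp only: of_int_le_iff)
      thus "real_of_int (fst L) * (1 + real_of_int c) \<le> (1 + real_of_int (fst L) * real_of_int (fst l)) * real_of_int (fst k) +
          (real_of_int (fst L) * real_of_int (snd l)) * real_of_int (snd k)"
        by (simp add: wt_def algebra_simps)
    qed (use lr \<open>0 \<le> fst L\<close> in auto)
    hence "real_of_int (fst L) * (1 + real_of_int c) \<le> fst p + real_of_int (fst L) * rwt l p"
      by (simp add: rwt_def algebra_simps)
    hence 1: "fst (pt L) \<le> fst p" using p(2) by (simp add: pt_def algebra_simps)
    \<comment> \<open>The mirror argument at the end \<open>R\<close>: on the level line of the
      face, being furthest right means being lowest.\<close>
    have "real_of_int (snd R) * (1 + real_of_int c) \<le>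
        (real_of_int (snd R) * real_of_int (fst l)) * fst p + (1 + real_of_int (snd R) * real_of_int (snd l)) * snd p"
    proof (rule newton_polygon_ge[OF _ _ _ p(1)])
      fix k assume k: "k \<in> supp g"
      hence gk: "g k \<noteq> 0" by (simp add: supp_def)
      have "snd R * (1 + c) \<le> snd k + snd R * wt l k"
      proof (cases "wt l k = c")
        case True
        thus ?thesis using snd_R[OF gk] by (simp add: algebra_simps)
      next
        case False
        hence "1 + c \<le> wt l k" using LR(4)[OF gk] by (simp add: c_def)
        hence "snd R * (1 + c) \<le> snd R * wt l k" using \<open>0 \<le> snd R\<close> by (rule mult_left_mono)
        thus ?thesis using nonneg_suppD[OF g(1) gk] by simp
      qed
      hence "real_of_int (snd R * (1 + c)) \<le> real_of_int (snd k + snd R * wt l k)" by (simp only: of_int_le_iff)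
      thus "real_of_int (snd R) * (1 + real_of_int c) \<le> (real_of_int (snd R) * real_of_int (fst l)) * real_of_int (fst k) +
          (1 + real_of_int (snd R) * real_of_int (snd l)) * real_of_int (snd k)"
        by (simp add: wt_def algebra_simps)
    qed (use lr \<open>0 \<le> snd R\<close> in auto)
    hence "real_of_int (snd R) * (1 + real_of_int c) \<le> snd p + real_of_int (snd R) * rwt l p"
      by (simp add: rwt_def algebra_simps)
    hence "snd (pt R) \<le> snd p" using p(2) by (simp add: pt_def algebra_simps)
    hence "real_of_int (snd l) * snd (pt R) \<le> real_of_int (snd l) * snd p" using lr by simp
    hence "real_of_int (fst l) * fst p \<le> real_of_int (fst l) * fst (pt R)"
      using p(2) c(2) by (simp add: rwt_def)
    hence "fst p \<le> fst (pt R)" using lr by simp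
    with 1 show ?thesis ..
  qed
  have "?P \<inter> {p. rwt l p = c} = closed_segment (pt L) (pt R)"
  proof (intro equalityI subsetI)
    fix p assume p: "p \<in> ?P \<inter> {p. rwt l p = c}"
    hence e: "fst (pt L) \<le> fst p" "fst p \<le> fst (pt R)" using ends by auto
    have "fst p \<in> closed_segment (fst (pt L)) (fst (pt R))" using e by (simp add: closed_segment_eq_real_ivl)
    then obtain u where u: "0 \<le> u" "u \<le> 1" "fst p = (1 - u) * fst (pt L) + u * fst (pt R)"
      by (auto simp: in_segment)
    have "rwt l ((1 - u) *\<^sub>R pt L + u *\<^sub>R pt R) = (1 - u) * rwt l (pt L) + u * rwt l (pt R)"
      by (simp only: rwt_add rwt_scaleR)
    hence "rwt l ((1 - u) *\<^sub>R pt L + u *\<^sub>R pt R) = rwt l p" using p by (simp add: c algebra_simps)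
    hence "p = (1 - u) *\<^sub>R pt L + u *\<^sub>R pt R" using u(3) by (intro rwt_eq_imp_eq[OF l(2)]) simp_all
    thus "p \<in> closed_segment (pt L) (pt R)" using u(1,2) by (auto simp: in_segment)
  next
    fix p assume p: "p \<in> closed_segment (pt L) (pt R)"
    hence "p \<in> ?P" using LP closed_segment_subset[OF LP conv] by blast
    moreover have "rwt l p = c"
    proof -
      obtain u where "p = (1 - u) *\<^sub>R pt L + u *\<^sub>R pt R" using p by (auto simp: in_segment)
      hence "rwt l p = (1 - u) * rwt l (pt L) + u * rwt l (pt R)" by (simp only: rwt_add rwt_scaleR)
      thus ?thesis by (simp add: c algebra_simps)
    qed
    ultimately show "p \<in> ?P \<inter> {p. rwt l p = c}" by simp
  qed
  hence "compact (?P \<inter> {p. rwt l p = c})" by simp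
  hence face: "?P \<inter> {p. rwt l p = c} \<subseteq> newton_diagram g"
    using face_of_weight[OF conv min] unfolding newton_diagram_def by blast
  show thesis
  proof (rule that[OF LR])
    show "pt L \<in> newton_diagram g" "pt R \<in> newton_diagram g" using face LP c by auto
    fix p assume "p \<in> newton_diagram g"
    hence p: "p \<in> ?P" using newton_diagram_subset by blast
    show "rwt l (pt L) \<le> rwt l p" using min[OF p] c by simp
    show "rwt l p = rwt l (pt L) \<Longrightarrow> fst (pt L) \<le> fst p \<and> fst p \<le> fst (pt R)" using ends[OF p] c by simp
  qed
qed

lemma newton_diagram_empty: "supp g = {} \<Longrightarrow> newton_diagram g = {}"
  using newton_diagram_subset[of g] by (simp add: newton_polygon_def)

text \<open>The ends are the \<open>l\<close>-minimal points of \<Gamma> with smallest and largest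
  first coordinate, so they agree for all germs with this diagram. The locale data of two germs can
  thus be chosen equal.\<close>

lemma newton_diagram_common_face_ends:
  assumes \<Gamma>: "is_newton_diagram \<Gamma>" and l: "0 < fst l" "0 < snd l"
  shows "\<exists>L R. wt l L = wt l R \<and> fst L \<le> fst R \<and> (\<forall>g\<in>germs. newton_diagram g = \<Gamma> \<longrightarrow>
    g L \<noteq> 0 \<and> g R \<noteq> 0 \<and> (\<forall>k. g k \<noteq> 0 \<longrightarrow> wt l L \<le> wt l k) \<and>
    (\<forall>k. g k \<noteq> 0 \<longrightarrow> wt l k = wt l L \<longrightarrow> fst L \<le> fst k \<and> fst k \<le> fst R))"
proof -
  obtain g k0 where g: "g \<in> germs" "g k0 \<noteq> 0" "newton_diagram g = \<Gamma>"
    using \<Gamma> unfolding is_newton_diagram_def supp_def by blast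
  obtain L R where LR: "g L \<noteq> 0" "g R \<noteq> 0" "wt l L = wt l R"
    "\<And>k. g k \<noteq> 0 \<Longrightarrow> wt l k = wt l L \<Longrightarrow> fst L \<le> fst k \<and> fst k \<le> fst R"
    "pt L \<in> \<Gamma>" "pt R \<in> \<Gamma>" "\<And>p. p \<in> \<Gamma> \<Longrightarrow> rwt l (pt L) \<le> rwt l p"
    "\<And>p. p \<in> \<Gamma> \<Longrightarrow> rwt l p = rwt l (pt L) \<Longrightarrow> fst (pt L) \<le> fst p \<and> fst p \<le> fst (pt R)"
    using newton_diagram_face_ends[OF nonneg_supp_germs[OF g(1)] g(2) l] unfolding g(3) by metis
  have "h L \<noteq> 0 \<and> h R \<noteq> 0 \<and> (\<forall>k. h k \<noteq> 0 \<longrightarrow> wt l L \<le> wt l k) \<and>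
    (\<forall>k. h k \<noteq> 0 \<longrightarrow> wt l k = wt l L \<longrightarrow> fst L \<le> fst k \<and> fst k \<le> fst R)"
    if h: "h \<in> germs" "newton_diagram h = \<Gamma>" for h
  proof -
    have "supp h \<noteq> {}" using newton_diagram_empty[of h] h(2) LR(5) by auto
    then obtain k1 where k1: "h k1 \<noteq> 0" by (auto simp: supp_def)
    obtain L' R' where LR': "h L' \<noteq> 0" "h R' \<noteq> 0" "wt l L' = wt l R'" "\<And>k. h k \<noteq> 0 \<Longrightarrow> wt l L' \<le> wt l k"
      "\<And>k. h k \<noteq> 0 \<Longrightarrow> wt l k = wt l L' \<Longrightarrow> fst L' \<le> fst k \<and> fst k \<le> fst R'"
      "pt L' \<in> \<Gamma>" "pt R' \<in> \<Gamma>" "\<And>p. p \<in> \<Gamma> \<Longrightarrow> rwt l (pt L') \<le> rwt l p"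
      "\<And>p. p \<in> \<Gamma> \<Longrightarrow> rwt l p = rwt l (pt L') \<Longrightarrow> fst (pt L') \<le> fst p \<and> fst p \<le> fst (pt R')"
      by (rule newton_diagram_face_ends[OF nonneg_supp_germs[OF h(1)] k1 l, unfolded h(2)]) blast
    have e: "rwt l (pt L) = rwt l (pt L')" using LR(7)[OF LR'(6)] LR'(8)[OF LR(5)] by simp
    have e': "rwt l (pt R) = rwt l (pt L)" "rwt l (pt R') = rwt l (pt L')" using LR(3) LR'(3) by (simp_all add: rwt_pt)
    have "fst (pt L) = fst (pt L')"
      using LR(8)[OF LR'(6)] LR'(9)[OF LR(5)] e by simp
    hence "fst L = fst L'" by (simp add: pt_def)
    moreover have "wt l L = wt l L'" using e by (simp add: rwt_pt)
    ultimately have "L = L'" by (intro wt_eq_iff[OF l(2)])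
    have "fst (pt R) = fst (pt R')"
      using LR(8)[OF LR'(7)] LR'(9)[OF LR(6)] e e' by simp
    hence "fst R = fst R'" by (simp add: pt_def)
    moreover have "wt l R = wt l R'" using e e' by (simp add: rwt_pt)
    ultimately have "R = R'" by (intro wt_eq_iff[OF l(2)])
    show ?thesis using LR' \<open>L = L'\<close> \<open>R = R'\<close> by blast
  qed
  moreover have "fst L \<le> fst R" using LR(4)[OF LR(1)] by simp
  ultimately show ?thesis using LR(3) by blast
qed

section \<open>Recovering the edges from their reduced equations\<close>

text \<open>Membership in \<open>newton_edges\<close> refers to some germ with diagram \<Gamma>; the
  description obtained here uses only \<Gamma> and \<open>l\<close>, so that different edges must
  have different equations.\<close>

lemma edge_determined:
  assumes \<gamma>: "\<gamma> \<in> newton_edges \<Gamma>" and l: "reduced_equation \<gamma> l"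
  shows "\<gamma> = {p \<in> \<Gamma>. \<forall>q\<in>\<Gamma>. rwt l p \<le> rwt l q}"
proof -
  obtain g where g: "newton_diagram g = \<Gamma>" "\<gamma> edge_of newton_polygon g" "compact \<gamma>"
    using \<gamma> unfolding newton_edges_def by blast
  let ?P = "newton_polygon g"
  have face: "\<gamma> face_of ?P" and dim: "aff_dim \<gamma> = 1" using g(2) by (auto simp: edge_of_def)
  obtain c :: int where pos: "0 < fst l" "0 < snd l" and c: "\<And>p. p \<in> \<gamma> \<Longrightarrow> rwt l p = c"
    using l unfolding reduced_equation_def rwt_def by fastforce
  have lr: "0 < real_of_int (fst l)" "0 < real_of_int (snd l)" using pos by auto
  have conv: "convex ?P" by (simp add: newton_polygon_def)
  have sub: "\<gamma> \<subseteq> ?P" by (rule face_of_imp_subset[OF face])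
  have "\<gamma> \<noteq> {}" using dim by auto
  then obtain x where x: "x \<in> \<gamma>" by blast
  have "\<gamma> \<noteq> {x}" using dim by auto
  then obtain y where y: "y \<in> \<gamma>" "y \<noteq> x" using x by blast
  have "fst x \<noteq> fst y" using rwt_eq_imp_eq[OF pos(2), of x y] c x y by auto
  then obtain q1 q2 where q: "q1 \<in> \<gamma>" "q2 \<in> \<gamma>" "fst q1 < fst q2" using x y by (metis linorder_neqE)
  define p where "p = (1 / 2) *\<^sub>R q1 + (1 / 2) *\<^sub>R q2"
  have p\<gamma>: "p \<in> \<gamma>" unfolding p_def
    by (rule convexD[OF face_of_imp_convex[OF face] q(1,2)]) auto
  define \<delta> where "\<delta> = (fst q2 - fst q1) / 2"
  have \<delta>: "0 < \<delta>" "fst q1 = fst p - \<delta>" "fst q2 = fst p + \<delta>" using q(3) by (auto simp: \<delta>_def p_def field_simps)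
  have min: "c \<le> rwt l z" if z: "z \<in> ?P" for z
  proof (rule ccontr)
    txt \<open>Otherwise \<open>p\<close> is an inner point of a segment in the polygon that starts in \<open>z\<close>.\<close>
    assume "\<not> c \<le> rwt l z"
    hence zc: "rwt l z < c" by simp
    \<comment> \<open>The point \<open>w\<close> below prolongs the segment from \<open>z\<close>
      through \<open>p\<close>. Shifted left by \<open>t\<close> it returns to the line of \<gamma>,
      at the horizontal offset \<open>\<epsilon> * K\<close> from \<open>p\<close>; the choice of
      \<epsilon> keeps this offset within \<delta>, that is, between \<open>q1\<close> and
      \<open>q2\<close>.\<close>
    define K where "K = fst p - fst z - (c - rwt l z) / fst l"
    define \<epsilon> where "\<epsilon> = \<delta> / (\<delta> + \<bar>K\<bar>)"
    have \<epsilon>: "0 < \<epsilon>" using \<delta>(1) by (simp add: \<epsilon>_def add_pos_nonneg)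
    have "\<bar>\<epsilon> * K\<bar> \<le> \<delta>"
    proof -
      have "\<bar>\<epsilon> * K\<bar> = \<delta> * (\<bar>K\<bar> / (\<delta> + \<bar>K\<bar>))" using \<delta>(1) by (simp add: \<epsilon>_def abs_mult)
      also have "\<dots> \<le> \<delta> * 1" using \<delta>(1) by (intro mult_left_mono) (auto simp: divide_le_eq)
      finally show ?thesis by simp
    qed
    define w where "w = p + \<epsilon> *\<^sub>R (p - z)"
    define t where "t = \<epsilon> * (c - rwt l z) / fst l"
    have t: "0 \<le> t" using \<epsilon> zc lr by (simp add: t_def)
    define s where "s = w - (t, 0)"
    have rp: "rwt l p = c" by (rule c[OF p\<gamma>])
    have "rwt l w = c + \<epsilon> * (c - rwt l z)" using rp by (simp add: w_def rwt_add rwt_diff rwt_scaleR)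
    moreover have "rwt l (t, 0) = \<epsilon> * (c - rwt l z)" using lr by (simp add: t_def rwt_def)
    ultimately have rs: "rwt l s = c" by (simp add: s_def rwt_diff)
    have "fst s = fst p + \<epsilon> * K" by (simp add: s_def w_def t_def K_def algebra_simps)
    hence s_between: "fst q1 \<le> fst s" "fst s \<le> fst q2" using \<open>\<bar>\<epsilon> * K\<bar> \<le> \<delta>\<close> \<delta> by (auto simp: abs_le_iff)
    have "fst s \<in> closed_segment (fst q1) (fst q2)" using s_between by (simp add: closed_segment_eq_real_ivl)
    then obtain u where u: "0 \<le> u" "u \<le> 1" "fst s = (1 - u) * fst q1 + u * fst q2" by (auto simp: in_segment)
    have "rwt l ((1 - u) *\<^sub>R q1 + u *\<^sub>R q2) = (1 - u) * rwt l q1 + u * rwt l q2" by (simp only: rwt_add rwt_scaleR)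
    hence "rwt l ((1 - u) *\<^sub>R q1 + u *\<^sub>R q2) = rwt l s" using c q by (simp add: rs algebra_simps)
    hence "s = (1 - u) *\<^sub>R q1 + u *\<^sub>R q2" using u(3) by (intro rwt_eq_imp_eq[OF pos(2)]) simp_all
    moreover have "(1 - u) *\<^sub>R q1 + u *\<^sub>R q2 \<in> ?P"
      using u(1,2) q sub by (intro convexD[OF conv]) auto
    ultimately have "s \<in> ?P" by simp
    \<comment> \<open>The polygon is closed under moving right, which undoes the shift by
      \<open>t\<close>.\<close>
    from newton_polygon_add[OF this t, of 0] have w: "w \<in> ?P" by (simp add: s_def)
    have "p \<in> open_segment z w"
    proof -
      have "z \<noteq> w"
        using \<open>rwt l w = c + \<epsilon> * (c - rwt l z)\<close> zc mult_pos_pos[OF \<epsilon>, of "c - rwt l z"] by auto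
      have e1: "1 + \<epsilon> \<noteq> 0" using \<epsilon> by simp
      have "(1 + \<epsilon>) *\<^sub>R p = \<epsilon> *\<^sub>R z + w" by (simp add: w_def algebra_simps)
      moreover have "p = (1 / (1 + \<epsilon>)) *\<^sub>R ((1 + \<epsilon>) *\<^sub>R p)" using e1 by simp
      ultimately have "p = (\<epsilon> / (1 + \<epsilon>)) *\<^sub>R z + (1 / (1 + \<epsilon>)) *\<^sub>R w"
        by (simp add: scaleR_add_right)
      moreover have "\<epsilon> / (1 + \<epsilon>) = 1 - 1 / (1 + \<epsilon>)" using e1 by (simp add: field_simps)
      ultimately have "p = (1 - 1 / (1 + \<epsilon>)) *\<^sub>R z + (1 / (1 + \<epsilon>)) *\<^sub>R w" by simp
      moreover have "0 < 1 / (1 + \<epsilon>)" "1 / (1 + \<epsilon>) < 1" using \<epsilon> by auto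
      ultimately show ?thesis using \<open>z \<noteq> w\<close> unfolding in_segment by blast
    qed
    hence "z \<in> \<gamma>" using face z w p\<gamma> unfolding face_of_def by blast
    thus False using c zc by simp
  qed
  let ?F = "?P \<inter> {p. rwt l p = c}"
  have "?F face_of ?P" by (rule face_of_weight[OF conv min])
  have \<gamma>F: "\<gamma> \<subseteq> ?F" using sub c by auto
  have "\<gamma> face_of ?F" by (rule face_of_subset[OF face \<gamma>F]) auto
  moreover have "convex ?F" using \<open>?F face_of ?P\<close> by (rule face_of_imp_convex)
  \<comment> \<open>The minimal face lies on a line, so a face of it of dimension 1 cannot be
    proper.\<close>
  moreover have "aff_dim ?F \<le> 1"
  proof -
    have "aff_dim ?F \<le> aff_dim {p. pt l \<bullet> p = c}" by (rule aff_dim_subset) (auto simp: rwt_inner)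
    also have "\<dots> = 1" using pos by (subst aff_dim_hyperplane) (auto simp: pt_def prod_eq_iff)
    finally show ?thesis .
  qed
  ultimately have F: "\<gamma> = ?F" using face_of_aff_dim_lt[of ?F \<gamma>] dim by force
  have \<gamma>\<Gamma>: "\<gamma> \<subseteq> \<Gamma>" unfolding g(1)[symmetric] newton_diagram_def using face g(3) by blast
  have \<Gamma>P: "\<Gamma> \<subseteq> ?P" using newton_diagram_subset[of g] g(1) by simp
  show ?thesis
  proof (intro equalityI subsetI)
    fix p assume p: "p \<in> \<gamma>"
    have "rwt l p \<le> rwt l q" if "q \<in> \<Gamma>" for q using c[OF p] min[of q] \<Gamma>P that by auto
    thus "p \<in> {p \<in> \<Gamma>. \<forall>q\<in>\<Gamma>. rwt l p \<le> rwt l q}" using p \<gamma>\<Gamma> by blast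
  next
    fix p assume "p \<in> {p \<in> \<Gamma>. \<forall>q\<in>\<Gamma>. rwt l p \<le> rwt l q}"
    hence p: "p \<in> ?P" "rwt l p \<le> rwt l x" using \<Gamma>P \<gamma>\<Gamma> x by auto
    hence "rwt l p = c" using min[OF p(1)] c[OF x] by simp
    thus "p \<in> \<gamma>" using p(1) by (subst F) simp
  qed
qed

lemma coprime_slope_inj:
  assumes "0 < fst l" "0 < snd l" "coprime (fst l) (snd l)" "0 < fst l'" "0 < snd l'" "coprime (fst l') (snd l')"
    and "slope l = slope l'"
  shows "l = l'"
proof -
  have e: "snd l * fst l' = snd l' * fst l"
    using slope_less_iff[of l l'] slope_less_iff[of l' l] assms by (simp add: mult.commute)
  have "fst l dvd fst l' * snd l" "fst l' dvd fst l * snd l'" using e by (metis dvd_triv_right mult.commute)+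
  hence "fst l dvd fst l'" "fst l' dvd fst l"
    using assms by (simp_all add: coprime_dvd_mult_left_iff)
  hence "fst l = fst l'" using assms zdvd_antisym_nonneg[of "fst l" "fst l'"] by simp
  thus ?thesis using e assms(1) by (auto simp: prod_eq_iff)
qed

theorem corollary1:
  fixes \<Gamma> :: "(real \<times> real) set"
    and \<gamma> :: "'r::finite \<Rightarrow> (real \<times> real) set"
    and l :: "'r \<Rightarrow> int \<times> int"
    and f f' :: lseries
  assumes "is_newton_diagram \<Gamma>"
    and "bij_betw \<gamma> UNIV (newton_edges \<Gamma>)"
    and "\<And>i. reduced_equation (\<gamma> i) (l i)"
    and "f \<in> germs" and "f (0, 0) = 0" and "newton_diagram f = \<Gamma>"
    and "f' \<in> germs" and "f' (0, 0) = 0" and "newton_diagram f' = \<Gamma>"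
  shows "poincare_series l f = poincare_series l f'"
proof -
  have l: "0 < fst (l i)" "0 < snd (l i)" "coprime (fst (l i)) (snd (l i))" for i
    using assms(3)[of i] by (auto simp: reduced_equation_def)
  have edge: "\<gamma> i = {p \<in> \<Gamma>. \<forall>q\<in>\<Gamma>. rwt (l i) p \<le> rwt (l i) q}" for i
    using assms(2,3) by (intro edge_determined) (auto simp: bij_betw_def)
  \<comment> \<open>Equal slopes give equal reduced equations by coprimality, and by
    \<open>edge\<close> the equation determines the edge.\<close>
  have inj: "inj (\<lambda>i. slope (l i))"
  proof (rule injI)
    fix i j assume "slope (l i) = slope (l j)"
    hence "l i = l j" by (rule coprime_slope_inj[OF l l])
    hence "\<gamma> i = \<gamma> j" using edge[of i] edge[of j] by simp
    thus "i = j" using assms(2) by (auto simp: bij_betw_def dest: injD)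
  qed
  have "\<forall>i. \<exists>L R. wt (l i) L = wt (l i) R \<and> fst L \<le> fst R \<and> (\<forall>g\<in>germs. newton_diagram g = \<Gamma> \<longrightarrow>
    g L \<noteq> 0 \<and> g R \<noteq> 0 \<and> (\<forall>k. g k \<noteq> 0 \<longrightarrow> wt (l i) L \<le> wt (l i) k) \<and>
    (\<forall>k. g k \<noteq> 0 \<longrightarrow> wt (l i) k = wt (l i) L \<longrightarrow> fst L \<le> fst k \<and> fst k \<le> fst R))"
    using newton_diagram_common_face_ends[OF assms(1) l(1,2)] by blast
  from choice[OF this] obtain L where "\<forall>i. \<exists>R. wt (l i) (L i) = wt (l i) R \<and> fst (L i) \<le> fst R \<and>
    (\<forall>g\<in>germs. newton_diagram g = \<Gamma> \<longrightarrow>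
    g (L i) \<noteq> 0 \<and> g R \<noteq> 0 \<and> (\<forall>k. g k \<noteq> 0 \<longrightarrow> wt (l i) (L i) \<le> wt (l i) k) \<and>
    (\<forall>k. g k \<noteq> 0 \<longrightarrow> wt (l i) k = wt (l i) (L i) \<longrightarrow> fst (L i) \<le> fst k \<and> fst k \<le> fst R))" ..
  from choice[OF this] obtain R where LR: "\<forall>i. wt (l i) (L i) = wt (l i) (R i) \<and> fst (L i) \<le> fst (R i) \<and>
    (\<forall>g\<in>germs. newton_diagram g = \<Gamma> \<longrightarrow>
    g (L i) \<noteq> 0 \<and> g (R i) \<noteq> 0 \<and> (\<forall>k. g k \<noteq> 0 \<longrightarrow> wt (l i) (L i) \<le> wt (l i) k) \<and>
    (\<forall>k. g k \<noteq> 0 \<longrightarrow> wt (l i) k = wt (l i) (L i) \<longrightarrow> fst (L i) \<le> fst k \<and> fst k \<le> fst (R i)))" ..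
  define a where "a i = fst (R i) - fst (L i)" for i
  define b where "b i = snd (L i) - snd (R i)" for i
  \<comment> \<open>\<open>L\<close>, \<open>a\<close> and \<open>b\<close> were chosen from
    \<Gamma> alone, so the same data serve for \<open>f\<close> and for \<open>f'\<close>.\<close>
  have ng: "newton_germ l a b g L" if g: "g \<in> germs" "newton_diagram g = \<Gamma>" for g
  proof
    fix i k
    note LRi = LR[THEN spec, of i]
    show "0 < fst (l i) \<and> 0 < snd (l i)" using l by simp
    show e: "fst (l i) * a i = snd (l i) * b i" using LRi by (simp add: a_def b_def wt_def algebra_simps)
    have "0 \<le> a i" using LRi by (simp add: a_def)
    hence "0 \<le> snd (l i) * b i" using e l(1)[of i] by (metis mult_nonneg_nonneg less_imp_le)
    thus "0 \<le> a i \<and> 0 \<le> b i" using \<open>0 \<le> a i\<close> l(2)[of i] by (simp add: zero_le_mult_iff)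
    show "inj (\<lambda>k. slope (l k))" by (rule inj)
    show "g \<in> germs" by (rule g(1))
    show "g (L i) \<noteq> 0" using LRi g by blast
    have "L i + (a i, - b i) = R i" by (simp add: a_def b_def prod_eq_iff)
    thus "g (L i + (a i, - b i)) \<noteq> 0" using LRi g by metis
    show "g k \<noteq> 0 \<Longrightarrow> wt (l i) (L i) \<le> wt (l i) k" using LRi g by blast
    show "fst (L i) \<le> fst k \<and> fst k \<le> fst (L i) + a i" if "g k \<noteq> 0" "wt (l i) k = wt (l i) (L i)"
    proof -
      have "fst (L i) \<le> fst k \<and> fst k \<le> fst (R i)" using LRi g that by blast
      thus ?thesis by (simp add: a_def)
    qed
  qed
  have "hilbert_series l f = hilbert_series l f'"
    using hilbert_series_cong[OF ng[OF assms(4,6)] ng[OF assms(7,9)]] by (rule ext)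
  thus ?thesis by (simp add: poincare_series_def)
qed

end
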